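(* Consider the weighted recursive tree with i.i.d. vertex-weights $(W_i)_{i\in\mathbb N}$ distributed as $W$, where $W$ satisfies: (1) $W$ takes values in $(0,1]$ and $\sup\{x\in\mathbb R:\mathbb P(W\le x)<1\}=1$; (2) there exist $C,\rho>0$ and $x_1\in(0,1)$ such that $\mathbb P(W\le x)\le Cx^\rho$ for all $x\in[0,x_1]$; (3) $\mathbb P(W=1)=q_0$ for some $q_0\in(0,1]$. Then, for any integer-valued $i_n=i(n)$ with $i_n+\log_\theta n<(\theta/(\theta-1))\log n$ and $\liminf_{n\to\infty}i_n>-\infty$, as $n\to\infty$, $$\mathbb P\Big(\max_{j\in[n]}\mathcal Z_n(j)\ge\lfloor\log_\theta n\rfloor+i_n\Big)=\big(1-\exp(-q_0\theta^{-i_n+\varepsilon_n})\big)(1+o(1)).$$ Moreover, let $\mathcal M_n\subseteq[n]$ denote the (random) set of vertices that attain the maximum in-degree in $T_n$, fix $\varepsilon\in[0,1]$, and let $(n_\ell)_{\ell\in\mathbb N}$ be a sequence of positive integers with $n_\ell\to\infty$ and $\varepsilon_{n_\ell}\to\varepsilon$ as $\ell\to\infty$. Then $|\mathcal M_{n_\ell}|\xrightarrow{d}M_\varepsilon$ as $\ell\to\infty$, where $M_\varepsilon$ has distribution $$\mathbb P(M_\varepsilon=k)=\sum_{j\in\mathbb Z}\frac1{k!}\big(q_0(1-\theta^{-1})\theta^{-j+\varepsilon}\big)^k e^{-q_0\theta^{-j+\varepsilon}},\qquad k\in\mathbb N=\{1,2,\ldots\}.$$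
   Context: Weighted recursive tree (WRT): let $(W_i)_{i\ge1}$ be i.i.d. copies of a random variable $W$ with $\mathbb P(W>0)=1$ and $S_n:=\sum_{i=1}^nW_i$. $T_1$ consists of the single vertex $1$ (the root) with vertex-weight $W_1$. For $n\ge1$, $T_{n+1}$ is obtained from $T_n$ by adding vertex $n+1$ with vertex-weight $W_{n+1}$ and, conditionally on $T_n$ (including its vertex-weights), connecting it to one vertex $i\in[n]:=\{1,\ldots,n\}$ chosen with probability $W_i/S_n$, by an edge directed from $n+1$ to $i$. $\mathcal Z_n(i)$ denotes the in-degree of vertex $i$ in $T_n$. Set $\theta:=1+\mathbb E[W]$; $\log_\theta$ is the logarithm to base $\theta$ and $\log$ the natural logarithm. Define $\varepsilon_n:=\log_\theta n-\lfloor\log_\theta n\rfloor$.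
   Formalization: The condition i_n + log_θ n < (θ/(θ-1)) log n is replaced by limsup (i_n + log_θ n)/log n < θ/(θ-1); with only the pointwise inequality the first claim fails, e.g. for W = 1 and the largest admissible i_n, where the probability is at most about half the claimed value. *)

theory Defs
  imports
    "HOL-Probability.Probability"
    "HOL-Library.Landau_Symbols"
    "Graph_Theory.Digraph"
begin

text \<open>
  Vertices are the positive integers. \<open>W i\<close> is the weight of vertex \<open>i\<close> and, for \<open>m \<ge> 2\<close>,
  \<open>J m\<close> is the vertex that \<open>m\<close> is attached to when it is added. The values \<open>W 0\<close>,
  \<open>J 0\<close> and \<open>J 1\<close> play no role.
\<close>

definition wrt_graph :: "(nat \<Rightarrow> 'a \<Rightarrow> nat) \<Rightarrow> nat \<Rightarrow> 'a \<Rightarrow> (nat, nat \<times> nat) pre_digraph" where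
  "wrt_graph J n \<omega> =
     \<lparr>verts = {1..n}, arcs = (\<lambda>m. (m, J m \<omega>)) ` {2..n}, tail = fst, head = snd\<rparr>"

text \<open>
  The tree \<open>T\<^sub>n\<close> together with its vertex-weights, as a random element: the weights of
  \<open>1, \<dots>, n\<close> and the edges leaving \<open>2, \<dots>, n\<close>.
\<close>

definition wrt_tree ::
    "(nat \<Rightarrow> 'a \<Rightarrow> real) \<Rightarrow> (nat \<Rightarrow> 'a \<Rightarrow> nat) \<Rightarrow> nat \<Rightarrow> 'a \<Rightarrow> (nat \<Rightarrow> real) \<times> (nat \<Rightarrow> nat)" where
  "wrt_tree W J n \<omega> = ((\<lambda>i\<in>{1..n}. W i \<omega>), (\<lambda>m\<in>{2..n}. J m \<omega>))"

definition wrt_space :: "nat \<Rightarrow> ((nat \<Rightarrow> real) \<times> (nat \<Rightarrow> nat)) measure" where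
  "wrt_space n = PiM {1..n} (\<lambda>_. borel) \<Otimes>\<^sub>M PiM {2..n} (\<lambda>_. count_space UNIV)"

text \<open>
  \<open>\<mu>\<close> is the law of the generic weight. The assumption \<open>weight_fresh\<close> makes explicit that the
  weight of the new vertex \<open>n + 1\<close> is independent of \<open>T\<^sub>n\<close> and of the choice of the vertex that
  \<open>n + 1\<close> is attached to. Independence of the weights alone, together with the conditional law
  of \<open>J (n + 1)\<close> given \<open>T\<^sub>n\<close>, would not exclude that attachments depend on later weights.
\<close>

locale weighted_recursive_tree = prob_space M + law: real_distribution \<mu>
  for M :: "'a measure" and \<mu> :: "real measure" +
  fixes W :: "nat \<Rightarrow> 'a \<Rightarrow> real" and J :: "nat \<Rightarrow> 'a \<Rightarrow> nat"
  assumes weight_pos: "measure \<mu> {0<..} = 1"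
    and weights_indep: "indep_vars (\<lambda>_. borel) W {1..}"
    and weights_law: "\<And>i. 1 \<le> i \<Longrightarrow> distr M borel (W i) = \<mu>"
    and attach_measurable: "\<And>n. 1 \<le> n \<Longrightarrow> J (Suc n) \<in> measurable M (count_space UNIV)"
    and attach_range: "\<And>n \<omega>. 1 \<le> n \<Longrightarrow> \<omega> \<in> space M \<Longrightarrow> J (Suc n) \<omega> \<in> {1..n}"
    and attach_law: "\<And>n i. 1 \<le> n \<Longrightarrow> i \<in> {1..n} \<Longrightarrow>
        AE \<omega> in M.
          real_cond_exp M (vimage_algebra (space M) (wrt_tree W J n) (wrt_space n))
            (indicator {\<omega> \<in> space M. J (Suc n) \<omega> = i}) \<omega>
          = W i \<omega> / (\<Sum>k=1..n. W k \<omega>)"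
    and weight_fresh: "\<And>n. 1 \<le> n \<Longrightarrow>
        indep_set (sets (vimage_algebra (space M) (W (Suc n)) borel))
          (sets (vimage_algebra (space M) (\<lambda>\<omega>. (wrt_tree W J n \<omega>, J (Suc n) \<omega>))
            (wrt_space n \<Otimes>\<^sub>M count_space UNIV)))"

definition wrt_indegree :: "(nat \<Rightarrow> 'a \<Rightarrow> nat) \<Rightarrow> nat \<Rightarrow> nat \<Rightarrow> 'a \<Rightarrow> nat" where
  "wrt_indegree J n i \<omega> = in_degree (wrt_graph J n \<omega>) i"

definition max_indegree :: "(nat \<Rightarrow> 'a \<Rightarrow> nat) \<Rightarrow> nat \<Rightarrow> 'a \<Rightarrow> nat" where
  "max_indegree J n \<omega> = Max ((\<lambda>j. wrt_indegree J n j \<omega>) ` {1..n})"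

definition max_vertices :: "(nat \<Rightarrow> 'a \<Rightarrow> nat) \<Rightarrow> nat \<Rightarrow> 'a \<Rightarrow> nat set" where
  "max_vertices J n \<omega> = {j \<in> {1..n}. wrt_indegree J n j \<omega> = max_indegree J n \<omega>}"

definition wrt_theta :: "real measure \<Rightarrow> real" where
  "wrt_theta \<mu> = 1 + (\<integral>x. x \<partial>\<mu>)"

definition wrt_eps :: "real measure \<Rightarrow> nat \<Rightarrow> real" where
  "wrt_eps \<mu> n = log (wrt_theta \<mu>) (real n) - of_int \<lfloor>log (wrt_theta \<mu>) (real n)\<rfloor>"

text \<open>
  The constraint that \<open>i n + log\<^sub>\<theta> n\<close> stays below \<open>(\<theta> / (\<theta> - 1)) ln n\<close>, read
  asymptotically: up to finitely many \<open>n\<close>, \<open>i n + log\<^sub>\<theta> n \<le> c ln n\<close> for some constant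
  \<open>c < \<theta> / (\<theta> - 1)\<close>. The bare pointwise inequality is not enough for the asymptotics of the
  maximum. Take \<open>W = 1\<close>, so \<open>\<theta> = 2\<close>, and let \<open>A n d\<close> be the expected number of vertices of
  \<open>T\<^sub>n\<close> with in-degree at least \<open>d\<close>. From \<open>A (n+1) d = A n d + (A n (d-1) - A n d) / n\<close> one gets
  \<open>A n d = n 2\<^sup>-\<^sup>d P(B\<^sub>2 + \<dots> + B\<^sub>n \<ge> d)\<close> for independent Bernoulli variables \<open>B\<^sub>k\<close> with mean
  \<open>2/k\<close>. For the largest admissible \<open>i n\<close>, the level \<open>d = \<lfloor>log\<^sub>2 n\<rfloor> + i n\<close> is
  \<open>2 ln n + O(1)\<close>, the last probability tends to \<open>1/2\<close>, and the probability that the maximum is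
  at least \<open>d\<close> is at most \<open>(1/2 + o(1)) n 2\<^sup>-\<^sup>d\<close>, whereas
  \<open>1 - exp (- n 2\<^sup>-\<^sup>d)\<close> is asymptotic to \<open>n 2\<^sup>-\<^sup>d\<close>.
\<close>

definition strictly_below_threshold :: "real measure \<Rightarrow> (nat \<Rightarrow> int) \<Rightarrow> bool" where
  "strictly_below_threshold \<mu> i \<longleftrightarrow>
     limsup (\<lambda>n. ereal ((of_int (i n) + log (wrt_theta \<mu>) (real n)) / ln (real n)))
       < ereal (wrt_theta \<mu> / (wrt_theta \<mu> - 1))"

end

theory Submission
  imports Defs "HOL-Real_Asymp.Real_Asymp"
begin

text \<open>
  In the comments degree means in-degree, and \<open>mw = \<theta> - 1\<close> is the mean weight. When vertex \<open>n + 1\<close>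
  arrives, vertex \<open>i\<close> gains an edge with probability \<open>W i / S n\<close>, and \<open>S n\<close> is close to \<open>mw * n\<close>.
  The degree at time \<open>n\<close> of a vertex of weight \<open>w\<close> that arrived at time \<open>v\<close> is therefore roughly
  Poisson with mean \<open>(w / mw) * ln (n / v)\<close>. For a uniformly chosen \<open>v\<close> the logarithm is roughly a
  standard exponential variable, so the degree is roughly geometric: it reaches \<open>d\<close> with probability
  \<open>(w / (mw + w)) ^ d\<close>. The base is largest at \<open>w = 1\<close>, where it is \<open>1 / \<theta>\<close>. Hence about
  \<open>\<lambda> = q * n * (1 / \<theta>) ^ d\<close> vertices have degree at least \<open>d\<close>, almost all of them have weight one,
  and a fraction \<open>1 - 1 / \<theta>\<close> of them has degree exactly \<open>d\<close>. Their number is almost Poisson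
  distributed. This is the first claim; the second one follows by summing, over the level \<open>d\<close> of the
  maximum, the probability that \<open>k\<close> vertices have degree exactly \<open>d\<close> and none has a larger one.

  The Poisson approximation is proved with factorial moments, that is, with the expected number
  \<open>F n m\<close> of tuples of distinct vertices whose \<open>l\<close>-th entry has degree at least \<open>m l\<close>. If all
  thresholds are positive, one step of the tree gives, up to the fluctuations of \<open>S n\<close>,
  \<open>F (n + 1) m = F n m + (\<Sum>l. F n (m - e\<^sub>l) - F n m) / (mw * n)\<close>
  (\<open>hit_prod_step\<close>, \<open>tuples_step_compare\<close>), where \<open>e\<^sub>l\<close> is the \<open>l\<close>-th unit vector. A threshold
  \<open>m l = 0\<close> is no condition, and the tuple can be shortened (\<open>tuples_insert_zero\<close>). The product of the
  numbers \<open>q * n * (1 / \<theta>) ^ m l\<close> solves this recursion with these boundary values up to lower order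
  terms. The recursion is monotone, so \<open>F\<close> is squeezed between a supersolution
  (\<open>tuples_upper\<close>) and a subsolution (\<open>tuples_lower\<close>) of this form. The recursion can be used only
  once \<open>S\<close> is concentrated, so the tuples are restricted to vertices that arrive after a small power of
  the final size. At that time \<open>F\<close> still vanishes, and the subsolution carries an error term that pays
  for this. The error term is negligible because \<open>d \<le> c * ln n\<close> with \<open>c < \<theta> / (\<theta> - 1)\<close>
  (\<open>saddle_point\<close>, \<open>tuple_mean_asymp\<close>).

  Vertices of weight below one have a thinner tail and are removed by the same supersolution
  (\<open>light_vertices_negligible\<close>). Early vertices are removed by an exponential moment of their degree
  (\<open>early_vertices_negligible\<close>). Bonferroni's inequalities then turn moments into probabilities. As
  \<open>\<lambda>\<close> may tend to zero, the error is controlled relative to \<open>\<lambda>\<close> in \<open>exists_above_asymp\<close>. In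
  \<open>exact_count_asymp\<close> two adjacent levels are treated jointly, by writing the indicator of degree exactly \<open>d\<close>
  as a difference of two others and expanding the product (\<open>factorial_moment_expand\<close>). Finally,
  \<open>level_window\<close> confines the maximum to a bounded window of levels around \<open>log \<theta> n\<close>.
\<close>

section \<open>Sums over tuples of distinct elements\<close>

definition inj_maps :: "'i set \<Rightarrow> 'v set \<Rightarrow> ('i \<Rightarrow> 'v) set" where
  "inj_maps I U = {v \<in> I \<rightarrow>\<^sub>E U. inj_on v I}"

text \<open>
  For indicator functions this counts the tuples of distinct elements of \<open>U\<close> whose \<open>l\<close>-th entry has the
  \<open>l\<close>-th property. General functions are allowed because the sum is multilinear in \<open>a\<close>, and this is
  used to expand indicators that are differences of others.
\<close>

definition distinct_sum :: "'v set \<Rightarrow> 'i set \<Rightarrow> ('i \<Rightarrow> 'v \<Rightarrow> real) \<Rightarrow> real" where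
  "distinct_sum U I a = (\<Sum>v\<in>inj_maps I U. \<Prod>l\<in>I. a l (v l))"

lemma finite_inj_maps: "finite I \<Longrightarrow> finite U \<Longrightarrow> finite (inj_maps I U)"
  unfolding inj_maps_def by (rule finite_subset[OF _ finite_PiE[of I "\<lambda>_. U"]]) auto

lemma card_inj_maps_le:
  assumes "finite I" "finite U" shows "card (inj_maps I U) \<le> card U ^ card I"
proof -
  have "card (inj_maps I U) \<le> card (I \<rightarrow>\<^sub>E U)"
    unfolding inj_maps_def by (rule card_mono) (use assms in \<open>auto intro: finite_PiE\<close>)
  then show ?thesis using assms by (simp add: card_PiE)
qed

lemma distinct_sum_empty [simp]: "distinct_sum U {} a = 1"
  by (simp add: distinct_sum_def inj_maps_def)

lemma distinct_sum_cong:
  assumes "\<And>l x. l \<in> I \<Longrightarrow> x \<in> U \<Longrightarrow> a l x = b l x"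
  shows "distinct_sum U I a = distinct_sum U I b"
  unfolding distinct_sum_def
  by (intro sum.cong refl prod.cong assms) (auto simp: inj_maps_def)

lemma distinct_sum_insert:
  assumes "finite I" "finite U" "l \<notin> I"
  shows "distinct_sum U (insert l I) a =
    (\<Sum>v\<in>inj_maps I U. (\<Prod>i\<in>I. a i (v i)) * (\<Sum>x\<in>U - v ` I. a l x))"
proof -
  have "(\<Sum>v\<in>inj_maps I U. (\<Prod>i\<in>I. a i (v i)) * (\<Sum>x\<in>U - v ` I. a l x)) =
      (\<Sum>v\<in>inj_maps I U. \<Sum>x\<in>U - v ` I. (\<Prod>i\<in>I. a i (v i)) * a l x)"
    by (simp add: sum_distrib_left)
  also have "\<dots> = (\<Sum>p\<in>Sigma (inj_maps I U) (\<lambda>v. U - v ` I). (\<Prod>i\<in>I. a i (fst p i)) * a l (snd p))"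
    using assms by (subst sum.Sigma) (auto simp: finite_inj_maps case_prod_beta)
  also have "\<dots> = (\<Sum>w\<in>inj_maps (insert l I) U. \<Prod>i\<in>insert l I. a i (w i))"
  proof (rule sum.reindex_bij_witness[where i="\<lambda>w. (restrict w I, w l)" and j="\<lambda>p. (fst p)(l := snd p)"], goal_cases)
    case (1 p) 
    obtain v x where p: "p = (v, x)" by (cases p)
    have "v \<in> I \<rightarrow>\<^sub>E U" using 1 p by (auto simp: inj_maps_def)
    then have "restrict (v(l := x)) I = v" using assms(3) by (auto simp: fun_eq_iff PiE_def extensional_def)
    then show ?case using p by simp
  next
    case (2 p) 
    obtain v x where p: "p = (v, x)" by (cases p)
    have "v \<in> I \<rightarrow>\<^sub>E U" "inj_on v I" "x \<in> U" "x \<notin> v ` I" using 2 p by (auto simp: inj_maps_def)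
    then show ?case using p assms(3) by (auto simp: inj_maps_def inj_on_def PiE_def extensional_def)
  next
    case (3 w) 
    then have "w \<in> insert l I \<rightarrow>\<^sub>E U" by (auto simp: inj_maps_def)
    then show ?case by (auto simp: fun_eq_iff PiE_def extensional_def restrict_def)
  next
    case (4 w) 
    then show ?case using assms(3) by (auto simp: inj_maps_def inj_on_def)
  next
    case (5 p)
    have "(\<Prod>i\<in>I. a i (((fst p)(l := snd p)) i)) = (\<Prod>i\<in>I. a i (fst p i))"
      by (rule prod.cong) (use assms(3) in auto)
    then show ?case using assms by simp
  qed
  finally show ?thesis unfolding distinct_sum_def by simp
qed

text \<open>
  Entries that contribute to the sum also have the \<open>l\<close>-th property, so exactly \<open>card I\<close> of the candidates
  for the \<open>l\<close>-th entry are already taken, whatever the other entries are.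
\<close>

lemma distinct_sum_insert_dominating:
  assumes "finite I" "finite U" "l \<notin> I"
    and dom: "\<And>i x. i \<in> I \<Longrightarrow> x \<in> U \<Longrightarrow> a i x \<noteq> 0 \<Longrightarrow> a l x = 1"
  shows "distinct_sum U (insert l I) a = ((\<Sum>x\<in>U. a l x) - real (card I)) * distinct_sum U I a"
proof -
  have "(\<Prod>i\<in>I. a i (v i)) * (\<Sum>x\<in>U - v ` I. a l x) =
      ((\<Sum>x\<in>U. a l x) - real (card I)) * (\<Prod>i\<in>I. a i (v i))" if v: "v \<in> inj_maps I U" for v
  proof (cases "\<exists>i\<in>I. a i (v i) = 0")
    case True
    then have "(\<Prod>i\<in>I. a i (v i)) = 0" using assms(1) by auto
    then show ?thesis by simp
  next
    case False
    have sub: "v ` I \<subseteq> U" and inj: "inj_on v I" using v by (auto simp: inj_maps_def)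
    have "(\<Sum>x\<in>v ` I. a l x) = (\<Sum>i\<in>I. a l (v i))" by (rule sum.reindex_cong[OF inj refl refl])
    also have "\<dots> = (\<Sum>i\<in>I. 1)" by (rule sum.cong) (use False sub dom in auto)
    finally have "(\<Sum>x\<in>v ` I. a l x) = real (card I)" by simp
    then have "(\<Sum>x\<in>U - v ` I. a l x) = (\<Sum>x\<in>U. a l x) - real (card I)"
      using sub assms(2) by (simp add: sum_diff)
    then show ?thesis by simp
  qed
  then show ?thesis using assms(1-3)
    by (simp add: distinct_sum_insert distinct_sum_def[of U I] sum_distrib_left)
qed

lemma distinct_sum_single: "finite U \<Longrightarrow> distinct_sum U {l} a = (\<Sum>x\<in>U. a l x)"
  using distinct_sum_insert_dominating[of "{}" U l a] by simp

text \<open>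
  The entries in the smaller set \<open>X\<close> are chosen first; every one of them also uses up an element of \<open>Z\<close>.
\<close>

lemma distinct_sum_two_levels:
  fixes U X Z :: "'v set" and K R :: "'i set"
  assumes "finite U" "finite K" "finite R" "K \<inter> R = {}" "X \<subseteq> Z" "Z \<subseteq> U"
  shows "distinct_sum U (K \<union> R) (\<lambda>l x. of_bool (x \<in> (if l \<in> K then X else Z))) =
    fact (card K) * fact (card R) * real (card X choose card K) * real ((card Z - card K) choose card R)"
proof -
  let ?a = "\<lambda>l x. of_bool (x \<in> (if l \<in> K then X else Z)) :: real"
  have sX: "(\<Sum>x\<in>U. of_bool (x \<in> X)) = real (card X)" and sZ: "(\<Sum>x\<in>U. of_bool (x \<in> Z)) = real (card Z)"
    using assms by (auto simp: Int_absorb1 subset_trans of_bool_def sum.If_cases)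
  have ff: "(\<Prod>i<k. real n - real i) = fact k * real (n choose k)" for n k
    by (simp add: binomial_gbinomial gbinomial_prod_rev lessThan_atLeast0)
  have K: "distinct_sum U K' (\<lambda>l x. of_bool (x \<in> X)) = (\<Prod>i<card K'. real (card X) - real i)" if "finite K'" for K' :: "'i set"
    using that
  proof (induction K' rule: finite_induct)
    case (insert l F)
    then show ?case using assms sX 
      by (subst distinct_sum_insert_dominating) (auto simp: mult.commute)
  qed simp
  have "distinct_sum U (K \<union> R') ?a = (\<Prod>i<card K. real (card X) - real i) * (\<Prod>i<card R'. real (card Z) - real (card K) - real i)"
    if "finite R'" "R' \<subseteq> R" for R'
    using that
  proof (induction R' rule: finite_induct)
    case empty
    have "distinct_sum U K ?a = distinct_sum U K (\<lambda>l x. of_bool (x \<in> X))" by (rule distinct_sum_cong) simp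
    then show ?case using K[OF assms(2)] by simp
  next
    case (insert l F)
    have l: "l \<notin> K" using insert.prems assms(4) by auto
    have "card (K \<union> F) = card K + card F" 
      using insert assms by (intro card_Un_disjoint) auto
    moreover have "distinct_sum U (insert l (K \<union> F)) ?a = ((\<Sum>x\<in>U. ?a l x) - real (card (K \<union> F))) * distinct_sum U (K \<union> F) ?a"
      using insert assms l by (intro distinct_sum_insert_dominating) (auto split: if_splits)
    ultimately show ?case using l insert sZ by (simp add: algebra_simps)
  qed
  from this[OF assms(3) subset_refl]
  have *: "distinct_sum U (K \<union> R) ?a = fact (card K) * real (card X choose card K) * (\<Prod>i<card R. real (card Z) - real (card K) - real i)"
    by (simp add: ff)
  show ?thesis
  proof (cases "card X < card K")
    case True
    then show ?thesis using * by (simp add: binomial_eq_0)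
  next
    case False
    have "card X \<le> card Z" using assms by (meson card_mono finite_subset)
    then have eq: "real (card Z) - real (card K) = real (card Z - card K)" using False by simp
    have "(\<Prod>i<card R. real (card Z) - real (card K) - real i) = fact (card R) * real ((card Z - card K) choose card R)"
      unfolding eq by (rule ff)
    then show ?thesis unfolding * by (simp only: mult_ac)
  qed
qed

section \<open>Bonferroni inequalities and power series\<close>

text \<open>
  For \<open>z > 0\<close> the truncated alternating sum is \<open>(z - 1) choose (R - 1)\<close> up to the sign, and this is one
  of the two summands of \<open>z choose R\<close> in Pascal's rule.
\<close>

lemma bonferroni:
  "\<bar>of_bool (z = 0) - (\<Sum>r<R. (-1) ^ r * real (z choose r))\<bar> \<le> real (z choose R)"
proof (cases R)
  case (Suc R')
  show ?thesis
  proof (cases z)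
    case 0
    have "(\<Sum>r<R. (-1) ^ r * real (z choose r)) = 1"
      unfolding 0 Suc by (subst sum.lessThan_Suc_shift) simp
    then show ?thesis using 0 by simp
  next
    case (Suc z')
    have "(\<Sum>r<R. (-1) ^ r * real (z choose r)) = (-1) ^ R' * real (z' choose R')"
      using gbinomial_sum_lower_neg[of "real z" R'] \<open>R = Suc R'\<close> Suc
      by (simp add: lessThan_Suc_atMost binomial_gbinomial mult.commute)
    then show ?thesis using Suc \<open>R = Suc R'\<close> by (simp add: abs_mult)
  qed
qed simp

lemma bonferroni_positive:
  "\<bar>of_bool (z > 0) - (\<Sum>r<R. (-1) ^ r * real (z choose Suc r))\<bar> \<le> real (z choose Suc R)"
proof -
  have "(\<Sum>r<Suc R. (-1) ^ r * real (z choose r)) = 1 - (\<Sum>r<R. (-1) ^ r * real (z choose Suc r))"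
    by (subst sum.lessThan_Suc_shift) (simp add: sum_negf)
  moreover have "of_bool (z > 0) = 1 - (of_bool (z = 0) :: real)" by auto
  ultimately show ?thesis using bonferroni[of z "Suc R"] by (simp add: abs_minus_commute)
qed

text \<open>
  This turns asymptotics of factorial moments into asymptotics of a probability: \<open>T r\<close> is the \<open>r\<close>-th moment
  and the last assumption is Bonferroni's inequality. Convergence is known for each \<open>r\<close> separately, but on
  a bounded range of \<open>lam\<close> the factorials make the remainder after \<open>R\<close> terms small, uniformly in \<open>N\<close>.
  The parameter \<open>lam\<close> may oscillate or tend to zero.
\<close>

lemma power_series_limit:
  fixes T :: "nat \<Rightarrow> nat \<Rightarrow> real" and a lam c :: "nat \<Rightarrow> real" and \<Lambda> \<tau> :: real
  assumes c: "\<And>r. \<bar>c r\<bar> \<le> 1 / fact r"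
    and bd: "\<forall>\<^sub>F N in sequentially. 0 < lam N \<and> lam N \<le> \<Lambda>"
    and T: "\<And>r. (\<lambda>N. T r N / lam N ^ r) \<longlonglongrightarrow> \<tau>" and \<tau>: "\<tau> \<ge> 0"
    and a: "\<And>R. \<forall>\<^sub>F N in sequentially. \<bar>a N - (\<Sum>r<R. c r * T r N)\<bar> \<le> T R N / fact R"
  shows "(\<lambda>N. a N - \<tau> * (\<Sum>r. c r * lam N ^ r)) \<longlonglongrightarrow> 0"
proof (rule LIMSEQ_I)
  fix e :: real assume e: "e > 0"
  define L where "L = max \<Lambda> 0"
  have L: "L \<ge> 0" "\<Lambda> \<le> L" by (auto simp: L_def)
  have sumL: "summable (\<lambda>r. L ^ r / fact r)" using summable_exp[of L] by (simp add: field_simps)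
  have "(\<lambda>R. (\<tau> + 1) * (L ^ R / fact R) + \<tau> * (\<Sum>r. L ^ (r + R) / fact (r + R))) \<longlonglongrightarrow> (\<tau> + 1) * 0 + \<tau> * 0"
    by (intro tendsto_intros summable_LIMSEQ_zero sumL suminf_exist_split2)
  then have "\<forall>\<^sub>F R in sequentially. (\<tau> + 1) * (L ^ R / fact R) + \<tau> * (\<Sum>r. L ^ (r + R) / fact (r + R)) < e / 2"
    using e by (intro order_tendstoD) auto
  then obtain R where R: "(\<tau> + 1) * (L ^ R / fact R) + \<tau> * (\<Sum>r. L ^ (r + R) / fact (r + R)) < e / 2"
    by (meson eventually_happens sequentially_bot)
  have "(\<lambda>N. \<Sum>r<R. \<bar>c r\<bar> * L ^ r * \<bar>T r N / lam N ^ r - \<tau>\<bar>) \<longlonglongrightarrow> (\<Sum>r<R. \<bar>c r\<bar> * L ^ r * \<bar>\<tau> - \<tau>\<bar>)"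
    by (intro tendsto_intros T)
  then have ev1: "\<forall>\<^sub>F N in sequentially. (\<Sum>r<R. \<bar>c r\<bar> * L ^ r * \<bar>T r N / lam N ^ r - \<tau>\<bar>) < e / 2"
    using e by (intro order_tendstoD) auto
  have ev2: "\<forall>\<^sub>F N in sequentially. T R N / lam N ^ R < \<tau> + 1" using T by (rule order_tendstoD) simp
  from bd ev1 ev2 a[of R] have "\<forall>\<^sub>F N in sequentially. norm (a N - \<tau> * (\<Sum>r. c r * lam N ^ r) - 0) < e"
  proof eventually_elim
    case (elim N)
    define x where "x = lam N"
    have x: "0 < x" "x \<le> L" using elim L by (auto simp: x_def)
    have xr: "x ^ r \<le> L ^ r" for r using x by (intro power_mono) auto
    have crb: "\<bar>c r * x ^ r\<bar> \<le> L ^ r / fact r" for r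
      using mult_mono[OF c[of r] xr[of r]] x by (simp add: abs_mult)
    have sumc: "summable (\<lambda>r. c r * x ^ r)"
      by (rule summable_comparison_test'[OF sumL, of 0]) (use crb in auto)
    have split: "(\<Sum>r. c r * x ^ r) = (\<Sum>r. c (r + R) * x ^ (r + R)) + (\<Sum>r<R. c r * x ^ r)"
      by (rule suminf_split_initial_segment[OF sumc])
    have tail: "\<bar>\<Sum>r. c (r + R) * x ^ (r + R)\<bar> \<le> (\<Sum>r. L ^ (r + R) / fact (r + R))"
    proof -
      have s1: "summable (\<lambda>r. L ^ (r + R) / fact (r + R))" using summable_ignore_initial_segment[OF sumL] .
      have s2: "summable (\<lambda>r. \<bar>c (r + R) * x ^ (r + R)\<bar>)"
        by (rule summable_comparison_test'[OF s1, of 0]) (use crb in auto)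
      have "\<bar>\<Sum>r. c (r + R) * x ^ (r + R)\<bar> \<le> (\<Sum>r. \<bar>c (r + R) * x ^ (r + R)\<bar>)" by (rule summable_rabs[OF s2])
      also have "\<dots> \<le> (\<Sum>r. L ^ (r + R) / fact (r + R))" by (intro suminf_le s1 s2 crb)
      finally show ?thesis .
    qed
    have head: "\<bar>(\<Sum>r<R. c r * T r N) - \<tau> * (\<Sum>r<R. c r * x ^ r)\<bar> \<le> (\<Sum>r<R. \<bar>c r\<bar> * L ^ r * \<bar>T r N / x ^ r - \<tau>\<bar>)"
    proof -
      have "(\<Sum>r<R. c r * T r N) - \<tau> * (\<Sum>r<R. c r * x ^ r) = (\<Sum>r<R. c r * x ^ r * (T r N / x ^ r - \<tau>))"
        using x by (simp add: sum_distrib_left sum_subtractf[symmetric] algebra_simps)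
      also have "\<bar>\<dots>\<bar> \<le> (\<Sum>r<R. \<bar>c r * x ^ r * (T r N / x ^ r - \<tau>)\<bar>)" by (rule sum_abs)
      also have "\<dots> \<le> (\<Sum>r<R. \<bar>c r\<bar> * L ^ r * \<bar>T r N / x ^ r - \<tau>\<bar>)"
        using x xr by (intro sum_mono) (auto simp: abs_mult intro!: mult_mono)
      finally show ?thesis .
    qed
    have "T R N \<le> (\<tau> + 1) * x ^ R" using elim(3) x by (simp add: x_def[symmetric] divide_simps mult.commute)
    also have "\<dots> \<le> (\<tau> + 1) * L ^ R" using \<tau> xr by (intro mult_left_mono) auto
    finally have rem: "T R N / fact R \<le> (\<tau> + 1) * (L ^ R / fact R)" by (simp add: divide_right_mono)
    have "\<bar>a N - \<tau> * (\<Sum>r. c r * x ^ r)\<bar> \<le> \<bar>a N - (\<Sum>r<R. c r * T r N)\<bar>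
       + \<bar>(\<Sum>r<R. c r * T r N) - \<tau> * (\<Sum>r<R. c r * x ^ r)\<bar> + \<bar>\<tau> * (\<Sum>r. c (r + R) * x ^ (r + R))\<bar>"
      unfolding split by (simp add: algebra_simps)
    also have "\<dots> < e"
    proof -
      have "\<bar>\<tau> * (\<Sum>r. c (r + R) * x ^ (r + R))\<bar> \<le> \<tau> * (\<Sum>r. L ^ (r + R) / fact (r + R))"
        using mult_left_mono[OF tail \<tau>] \<tau> by (simp add: abs_mult)
      then show ?thesis using elim(4) head rem R elim(2) unfolding x_def[symmetric] by linarith
    qed
    finally show ?case by (simp add: x_def)
  qed
  then show "\<exists>no. \<forall>n\<ge>no. norm (a n - \<tau> * (\<Sum>r. c r * lam n ^ r) - 0) < e"
    by (simp add: eventually_sequentially)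
qed

lemma exp_quotient_series:
  fixes x :: real assumes "x \<noteq> 0"
  shows "(\<Sum>r. (-1) ^ r / fact (Suc r) * x ^ r) = (1 - exp (- x)) / x"
proof -
  have s: "(\<lambda>n. (- x) ^ n / fact n) sums exp (- x)" using exp_converges[of "- x"] by (simp add: field_simps)
  have "(\<lambda>n. (- x) ^ Suc n / fact (Suc n)) sums (exp (- x) - 1)"
    using sums_split_initial_segment[OF s, of 1] by simp
  from sums_mult[OF this, of "- 1 / x"]
  have "(\<lambda>n. - 1 / x * ((- x) ^ Suc n / fact (Suc n))) sums (- 1 / x * (exp (- x) - 1))" .
  also have "- 1 / x * (exp (- x) - 1) = (1 - exp (- x)) / x" using assms by (simp add: field_simps)
  finally have "(\<lambda>n. - 1 / x * ((- x) ^ Suc n / fact (Suc n))) sums ((1 - exp (- x)) / x)" .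
  moreover have "- 1 / x * ((- x) ^ Suc n / fact (Suc n)) = (-1) ^ n / fact (Suc n) * x ^ n" for n
    using assms by (simp add: power_minus[of x] field_simps)
  ultimately show ?thesis by (simp add: sums_iff)
qed

lemma exp_minus_series: "(\<Sum>r. (-1) ^ r / fact r * x ^ r) = exp (- x :: real)"
proof -
  have "(\<lambda>n. (- x) ^ n / fact n) sums exp (- x)" using exp_converges[of "- x"] by (simp add: field_simps)
  moreover have "(- x) ^ n / fact n = (-1) ^ n / fact n * x ^ n" for n by (simp add: power_minus[of x])
  ultimately show ?thesis by (simp add: sums_iff)
qed

section \<open>Elementary estimates and the choice of scales\<close>

text \<open>
  Up to lower order terms, \<open>i powr b\<close> solves \<open>y (i + 1) = (1 + b / i) * y i\<close>. Shifting the argument absorbs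
  these terms: \<open>(i - 1) powr b\<close> is a supersolution, and by the next lemma \<open>(i + b) powr a\<close> is a subsolution
  when \<open>a \<le> b\<close>.
\<close>

lemma powr_step_ge:
  fixes i b :: real
  assumes "i > 1" "b \<ge> 0"
  shows "(i - 1) powr b * (1 + b / i) \<le> i powr b"
proof -
  have "ln ((i - 1) / i) \<le> (i - 1) / i - 1" using assms by (intro ln_le_minus_one) auto
  also have "(i - 1) / i - 1 = - (1 / i)" using assms by (simp add: field_simps)
  finally have "ln i - ln (i - 1) \<ge> 1 / i" using assms by (simp add: ln_div)
  then have "b / i \<le> b * (ln i - ln (i - 1))" using assms mult_left_mono[of "1 / i" _ b] by simp
  moreover have "1 + b / i \<le> exp (b / i)" by (rule exp_ge_add_one_self)
  ultimately have "1 + b / i \<le> exp (b * (ln i - ln (i - 1)))" by (meson exp_le_cancel_iff order_trans)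
  also have "\<dots> = i powr b / (i - 1) powr b" using assms by (simp add: powr_def exp_diff[symmetric] algebra_simps)
  finally show ?thesis using assms by (simp add: pos_le_divide_eq mult.commute)
qed

lemma powr_step_le:
  fixes x b a :: real
  assumes "x > 0" "0 \<le> a" "a \<le> b"
  shows "(x + 1 + b) powr a \<le> (1 + a / x) * (x + b) powr a"
proof -
  have "ln ((x + 1 + b) / (x + b)) \<le> (x + 1 + b) / (x + b) - 1" using assms by (intro ln_le_minus_one) auto
  also have "\<dots> = 1 / (x + b)" using assms by (simp add: field_simps)
  finally have "a * (ln (x + 1 + b) - ln (x + b)) \<le> a / (x + b)" using assms mult_left_mono[of _ "1 / (x + b)" a] by (simp add: ln_div)
  then have "(x + 1 + b) powr a / (x + b) powr a \<le> exp (a / (x + b))"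
    using assms by (simp add: powr_def exp_diff[symmetric] algebra_simps)
  also have "\<dots> \<le> 1 + a / x"
  proof -
    have "exp (- (a / (x + b))) \<ge> 1 - a / (x + b)" using exp_ge_add_one_self[of "- (a / (x + b))"] by simp
    moreover have "1 - a / (x + b) > 0" using assms by (simp add: field_simps)
    ultimately have "exp (a / (x + b)) \<le> 1 / (1 - a / (x + b))" by (simp add: exp_minus field_simps)
    also have "\<dots> = 1 + a / (x + b - a)" using assms by (simp add: field_simps)
    also have "\<dots> \<le> 1 + a / x" using assms by (simp add: frac_le)
    finally show ?thesis .
  qed
  finally show ?thesis using assms by (simp add: pos_divide_le_eq)
qed

text \<open>
  The effect of lowering one threshold on a product of geometric tails.
\<close>

lemma prod_decrement:
  fixes z :: real and m :: "'i \<Rightarrow> nat"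
  assumes "finite I" "l \<in> I" "1 \<le> m l"
  shows "z * (\<Prod>i\<in>I. z ^ ((m(l := m l - 1)) i)) = (\<Prod>i\<in>I. z ^ m i)"
proof -
  have "(\<Prod>i\<in>I. z ^ ((m(l := m l - 1)) i)) = z ^ (m l - 1) * (\<Prod>i\<in>I - {l}. z ^ m i)"
    using assms by (subst prod.remove[of I l]) (auto intro!: prod.cong)
  moreover have "(\<Prod>i\<in>I. z ^ m i) = z ^ m l * (\<Prod>i\<in>I - {l}. z ^ m i)"
    using assms by (subst prod.remove[of I l]) auto
  moreover have "z ^ m l = z * z ^ (m l - 1)" using assms by (metis Suc_pred' less_eq_Suc_le One_nat_def power_Suc)
  ultimately show ?thesis by simp
qed

lemma prod_one_plus_le:
  fixes b :: real
  assumes "2 \<le> a" "a \<le> n" "0 \<le> b"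
  shows "(\<Prod>j\<in>{a..<n}. 1 + b / real j) \<le> (real n - 1) powr b"
  using assms(2)
proof (induction n rule: dec_induct)
  case base
  have "1 \<le> real a - 1" using assms(1) by simp
  then show ?case using assms(3) by (simp add: ge_one_powr_ge_zero)
next
  case (step n)
  have "(\<Prod>j\<in>{a..<Suc n}. 1 + b / real j) = (\<Prod>j\<in>{a..<n}. 1 + b / real j) * (1 + b / real n)"
    using step.hyps by (simp add: atLeastLessThanSuc)
  also have "\<dots> \<le> (real n - 1) powr b * (1 + b / real n)"
    using step.IH assms(3) by (intro mult_right_mono) auto
  also have "\<dots> \<le> real n powr b" using step.hyps assms by (intro powr_step_ge) auto
  finally show ?case by simp
qed

text \<open>
  The exponent exceeds 1 only by a multiple of \<open>N powr (-\<eta>/4)\<close>, which beats the logarithm of \<open>N\<close>.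
\<close>

lemma powr_upper_factor_limit:
  fixes w \<eta> :: real assumes "0 < \<eta>" "0 < w"
  shows "(\<lambda>N. (real N - 1) powr (w / (w - real N powr (-\<eta>/4))) / real N) \<longlonglongrightarrow> 1"
proof -
  have a: "(\<lambda>N. (real N - 1) / real N * exp (real N powr (-\<eta>/4) / (w - real N powr (-\<eta>/4)) * ln (real N - 1))) \<longlonglongrightarrow> 1 * exp 0"
    by (intro tendsto_intros) (use assms in real_asymp)+
  have "\<forall>\<^sub>F N in sequentially. real N powr (-\<eta>/4) < w" using assms by real_asymp
  with eventually_gt_at_top[of 1]
  have "\<forall>\<^sub>F N in sequentially. (real N - 1) / real N * exp (real N powr (-\<eta>/4) / (w - real N powr (-\<eta>/4)) * ln (real N - 1)) =
     (real N - 1) powr (w / (w - real N powr (-\<eta>/4))) / real N"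
  proof eventually_elim
    case (elim N)
    define d where "d = real N powr (-\<eta>/4)"
    have N: "0 < real N - 1" using elim by simp
    have "w / (w - d) = 1 + d / (w - d)" using elim by (simp add: d_def field_simps)
    then have "(real N - 1) powr (w / (w - d)) = (real N - 1) * (real N - 1) powr (d / (w - d))"
      using N by (simp add: powr_add)
    also have "(real N - 1) powr (d / (w - d)) = exp (d / (w - d) * ln (real N - 1))" using N by (simp add: powr_def)
    finally show ?case unfolding d_def[symmetric] by simp
  qed
  from tendsto_cong[THEN iffD1, OF this a] show ?thesis by simp
qed

lemma powr_lower_factor_limit:
  fixes w \<eta> b :: real assumes "0 < \<eta>" "0 < w" "0 \<le> b"
  shows "(\<lambda>N. (real N + b) powr (w / (w + real N powr (-\<eta>/4))) / real N) \<longlonglongrightarrow> 1"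
proof -
  have a: "(\<lambda>N. (real N + b) / real N * exp (- (real N powr (-\<eta>/4) / (w + real N powr (-\<eta>/4)) * ln (real N + b)))) \<longlonglongrightarrow> 1 * exp (- 0)"
    by (intro tendsto_intros) (use assms in real_asymp)+
  have "\<forall>\<^sub>F N in sequentially. (real N + b) / real N * exp (- (real N powr (-\<eta>/4) / (w + real N powr (-\<eta>/4)) * ln (real N + b))) =
     (real N + b) powr (w / (w + real N powr (-\<eta>/4))) / real N"
    using eventually_gt_at_top[of 1]
  proof eventually_elim
    case (elim N)
    define d where "d = real N powr (-\<eta>/4)"
    have N: "0 < real N + b" using elim assms by simp
    have d0: "0 < w + d" using assms by (simp add: d_def add_pos_nonneg)
    then have "w / (w + d) = 1 + - (d / (w + d))" by (simp add: field_simps)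
    then have "(real N + b) powr (w / (w + d)) = (real N + b) * (real N + b) powr (- (d / (w + d)))"
      using N by (simp only: powr_add) simp
    also have "(real N + b) powr (- (d / (w + d))) = exp (- (d / (w + d) * ln (real N + b)))" using N by (simp add: powr_def)
    finally show ?case unfolding d_def[symmetric] by simp
  qed
  from tendsto_cong[THEN iffD1, OF this a] show ?thesis by simp
qed

text \<open>
  Vertices that arrive up to this time are treated as early.
\<close>

definition cutoff :: "real \<Rightarrow> nat \<Rightarrow> nat" where "cutoff \<eta> N = nat \<lceil>real N powr \<eta>\<rceil>"

text \<open>
  The deviation per vertex that is allowed for the weight sums. It is so large that deviations beyond it after time
  \<open>cutoff \<eta> N\<close> have probability of order \<open>exp (- 2 * N powr (\<eta>/2))\<close>, up to a power of \<open>N\<close>, and so small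
  that its product with \<open>ln N\<close> vanishes.
\<close>

definition tolerance :: "real \<Rightarrow> nat \<Rightarrow> real" where "tolerance \<eta> N = real N powr (-\<eta>/4)"

lemma cutoff_at_top: "0 < \<eta> \<Longrightarrow> filterlim (cutoff \<eta>) at_top sequentially"
  unfolding cutoff_def[abs_def] by real_asymp

lemma cutoff_le: "0 < \<eta> \<Longrightarrow> \<eta> < 1 \<Longrightarrow> \<forall>\<^sub>F N in sequentially. cutoff \<eta> N \<le> N"
  unfolding cutoff_def[abs_def] by real_asymp

lemma cutoff_le_powr: "0 < \<eta> \<Longrightarrow> \<forall>\<^sub>F N in sequentially. real (cutoff \<eta> N) \<le> 2 * real N powr \<eta>"
  unfolding cutoff_def[abs_def] by real_asymp

lemma tolerance_tendsto: "0 < \<eta> \<Longrightarrow> tolerance \<eta> \<longlonglongrightarrow> 0"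
  unfolding tolerance_def[abs_def] by real_asymp

lemma eventually_cutoff_ge: "0 < \<eta> \<Longrightarrow> \<forall>\<^sub>F N in sequentially. C \<le> real (cutoff \<eta> N)"
proof -
  assume "0 < \<eta>"
  then have "filterlim (\<lambda>N. real (cutoff \<eta> N)) at_top sequentially"
    by (intro filterlim_compose[OF filterlim_real_sequentially cutoff_at_top])
  then show ?thesis by (simp add: filterlim_at_top)
qed

lemma cutoff_ratio: assumes "0 < \<eta>" shows "(\<lambda>N. real (cutoff \<eta> N) / (real (cutoff \<eta> N) - 1)) \<longlonglongrightarrow> 1"
proof -
  have "(\<lambda>n. real n / (real n - 1)) \<longlonglongrightarrow> 1" by real_asymp
  from filterlim_compose[OF this cutoff_at_top[OF assms]] show ?thesis .
qed

section \<open>The limit law of the number of maximisers\<close>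

text \<open>
  The positive and the negative integers are summed separately, because the sum over all integers is
  unordered.
\<close>

lemma telescoping_int_has_sum:
  fixes g :: "int \<Rightarrow> real"
  assumes mono: "\<And>j. g j \<le> g (j + 1)"
    and top: "(\<lambda>n. g (int n)) \<longlonglongrightarrow> 1" and bot: "(\<lambda>n. g (- int n)) \<longlonglongrightarrow> 0"
  shows "((\<lambda>j. g (j + 1) - g j) has_sum 1) UNIV"
proof -
  have "(\<lambda>n. g (int n + 1) - g (int n)) sums (1 - g 0)"
    using telescope_sums[OF top] by (simp add: add.commute)
  then have "((\<lambda>n. g (int n + 1) - g (int n)) has_sum (1 - g 0)) UNIV"
    by (rule sums_nonneg_imp_has_sum) (simp add: mono)
  then have A: "((\<lambda>j. g (j + 1) - g j) has_sum (1 - g 0)) (range int)"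
    by (subst has_sum_reindex) (auto simp: comp_def)
  have "(\<lambda>n. g (- int n) - g (- int (Suc n))) sums (g (- int 0) - 0)" by (rule telescope_sums'[OF bot])
  then have "((\<lambda>n. g (- int n) - g (- int (Suc n))) has_sum (g 0 - 0)) UNIV"
    using mono[of "- int (Suc n)" for n] by (intro sums_nonneg_imp_has_sum) auto
  then have B: "((\<lambda>j. g (j + 1) - g j) has_sum (g 0 - 0)) (range (\<lambda>n. - int (Suc n)))"
    by (subst has_sum_reindex) (auto simp: comp_def inj_def)
  have "range int \<inter> range (\<lambda>n. - int (Suc n)) = {}" by auto
  moreover have "range int \<union> range (\<lambda>n. - int (Suc n)) = UNIV"
  proof -
    have "j \<in> range int \<union> range (\<lambda>n. - int (Suc n))" for j :: int
    proof (cases "0 \<le> j")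
      case True
      then have "j = int (nat j)" by simp
      then show ?thesis by blast
    next
      case False
      then have "j = - int (Suc (nat (- j - 1)))" by simp
      then show ?thesis by blast
    qed
    then show ?thesis by blast
  qed
  ultimately show ?thesis using has_sum_Un_disjoint[OF A B] by simp
qed

lemma intensity_limits:
  fixes \<theta> q e :: real
  assumes th: "1 < \<theta>" and q: "0 < q"
  defines "L \<equiv> \<lambda>j :: int. q * \<theta> powr (- of_int j + e)"
  shows "(\<lambda>n. exp (- L (int n))) \<longlonglongrightarrow> 1" "(\<lambda>n. exp (- L (- int n))) \<longlonglongrightarrow> 0"
proof -
  have z: "(\<lambda>n. (1 / \<theta>) ^ n) \<longlonglongrightarrow> 0" using th by (intro LIMSEQ_realpow_zero) auto
  define C where "C = q * \<theta> powr e"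
  have C: "0 < C" using th q by (simp add: C_def)
  have Lp: "L (int n) = C * (1 / \<theta>) ^ n" for n
  proof -
    have "\<theta> powr (- real n) = (1 / \<theta>) ^ n"
      using th by (simp add: powr_minus powr_realpow power_one_over inverse_eq_divide)
    moreover have "\<theta> powr (- real n + e) = \<theta> powr (- real n) * \<theta> powr e" by (rule powr_add)
    ultimately show ?thesis by (simp add: L_def C_def)
  qed
  have Lm: "L (- int n) = C * \<theta> ^ n" for n
  proof -
    have "\<theta> powr (real n + e) = \<theta> powr real n * \<theta> powr e" by (rule powr_add)
    then show ?thesis using th by (simp add: L_def C_def powr_realpow add.commute)
  qed
  have "(\<lambda>n. exp (- (C * (1 / \<theta>) ^ n))) \<longlonglongrightarrow> exp (- (C * 0))" by (intro tendsto_intros z)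
  then show "(\<lambda>n. exp (- L (int n))) \<longlonglongrightarrow> 1" by (simp add: Lp)
  have "(\<lambda>n. 1 / C * (1 / \<theta>) ^ n) \<longlonglongrightarrow> 0" by (intro tendsto_mult_right_zero z)
  then show "(\<lambda>n. exp (- L (- int n))) \<longlonglongrightarrow> 0"
  proof (rule Lim_null_comparison[rotated], intro always_eventually allI)
    fix n
    have x: "0 < C * \<theta> ^ n" using C th by simp
    have "C * \<theta> ^ n \<le> exp (C * \<theta> ^ n)" using exp_ge_add_one_self[of "C * \<theta> ^ n"] by linarith
    then have "exp (- (C * \<theta> ^ n)) \<le> 1 / (C * \<theta> ^ n)" using x by (simp add: exp_minus divide_simps)
    then show "norm (exp (- L (- int n))) \<le> 1 / C * (1 / \<theta>) ^ n" by (simp add: Lm power_one_over)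
  qed
qed

text \<open>
  Let \<open>L j\<close> be the intensity at level \<open>j\<close>. As \<open>L (j + 1) = L j / \<theta>\<close>, the terms with fixed \<open>j\<close> add up over
  \<open>k \<ge> 1\<close> to \<open>exp (- L (j + 1)) - exp (- L j)\<close>, and these differences telescope to 1.
\<close>

lemma maximiser_law_exists:
  fixes \<theta> q e :: real
  assumes th: "1 < \<theta>" and q: "0 < q"
  defines "L \<equiv> \<lambda>j :: int. q * \<theta> powr (- of_int j + e)"
  shows "\<exists>Q :: nat pmf. set_pmf Q \<subseteq> {1..} \<and>
     (\<forall>k\<ge>1. ((\<lambda>j. 1 / fact k * (q * (1 - 1 / \<theta>) * \<theta> powr (- of_int j + e)) ^ k * exp (- q * \<theta> powr (- of_int j + e))) has_sum pmf Q k) UNIV)"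
proof -
  define a where "a = 1 - 1 / \<theta>"
  have a: "0 < a" using th by (simp add: a_def)
  have L0: "0 < L j" for j using q th by (simp add: L_def)
  define f where "f k j = 1 / fact k * (L j * a) ^ k * exp (- L j)" for k :: nat and j :: int
  have f0: "0 \<le> f k j" for k j using L0[of j] a by (simp add: f_def)
  define g where "g j = exp (- L j)" for j
  have Ls: "L (j + 1) = L j / \<theta>" for j
  proof -
    have "- of_int (j + 1) + e = (- of_int j + e) + (-1)" by simp
    then have "\<theta> powr (- of_int (j + 1) + e) = \<theta> powr (- of_int j + e) * \<theta> powr (-1)" by (simp only: powr_add)
    also have "\<theta> powr (-1) = 1 / \<theta>" using th by (simp add: powr_minus_divide)
    finally have pw: "\<theta> powr (- of_int (j + 1) + e) = \<theta> powr (- of_int j + e) * (1 / \<theta>)" .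
    show ?thesis unfolding L_def pw by simp
  qed
  have row: "((\<lambda>k. f k j) has_sum (g (j + 1) - g j)) {1..}" for j
  proof -
    have "(\<lambda>k. (L j * a) ^ k / fact k) sums exp (L j * a)" using exp_converges[of "L j * a"] by (simp add: field_simps)
    then have "(\<lambda>k. exp (- L j) * ((L j * a) ^ k / fact k)) sums (exp (- L j) * exp (L j * a))" by (rule sums_mult)
    then have "(\<lambda>k. f k j) sums (exp (- L j) * exp (L j * a))" by (simp add: f_def mult_ac)
    then have "((\<lambda>k. f k j) has_sum (exp (- L j) * exp (L j * a))) UNIV" by (rule sums_nonneg_imp_has_sum) (rule f0)
    moreover have "((\<lambda>k. f k j) has_sum f 0 j) {0}" by (rule has_sum_finiteI) auto
    ultimately have "((\<lambda>k. f k j) has_sum (exp (- L j) * exp (L j * a) - f 0 j)) (UNIV - {0})" by (rule has_sum_Diff) simp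
    moreover have "UNIV - {0} = {1::nat..}" by auto
    moreover have "exp (- L j) * exp (L j * a) - f 0 j = g (j + 1) - g j"
    proof -
      have "- L j + L j * a = - L (j + 1)" by (simp add: Ls a_def right_diff_distrib)
      then show ?thesis by (simp add: exp_add[symmetric] f_def g_def)
    qed
    ultimately show ?thesis by simp
  qed
  have tel: "((\<lambda>j. g (j + 1) - g j) has_sum 1) UNIV"
  proof (rule telescoping_int_has_sum)
    show "g j \<le> g (j + 1)" for j
    proof -
      have "L j / \<theta> \<le> L j / 1" using th L0[of j] by (intro divide_left_mono) auto
      then show ?thesis by (simp add: g_def Ls)
    qed
    show "(\<lambda>n. g (int n)) \<longlonglongrightarrow> 1" "(\<lambda>n. g (- int n)) \<longlonglongrightarrow> 0"
      unfolding g_def L_def by (rule intensity_limits[OF th q])+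
  qed
  have "(\<lambda>p. norm (case p of (j, k) \<Rightarrow> f k j)) summable_on UNIV \<times> {1..}"
  proof (rule Infinite_Sum.abs_summable_on_Sigma_iff[THEN iffD2], intro conjI ballI)
    show "(\<lambda>y. norm (case (x, y) of (j, k) \<Rightarrow> f k j)) summable_on {1..}" for x
      using row[of x] f0 by (auto simp: summable_on_def)
    have "infsum (\<lambda>k. f k j) {1..} = g (j + 1) - g j" for j using row by (rule infsumI)
    then show "(\<lambda>x. norm (\<Sum>\<^sub>\<infinity>y\<in>{1..}. norm (case (x, y) of (j, k) \<Rightarrow> f k j))) summable_on UNIV"
      using tel f0 has_sum_nonneg[OF row] by (auto simp: summable_on_def)
  qed
  then have summ: "(\<lambda>(j, k). f k j) summable_on UNIV \<times> {1..}" by (rule Infinite_Sum.abs_summable_summable)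
  have full: "((\<lambda>(j, k). f k j) has_sum 1) (UNIV \<times> {1..})"
    by (rule has_sum_SigmaI[OF _ tel summ]) (use row in simp)
  then have full': "((\<lambda>(k, j). f k j) has_sum 1) ({1..} \<times> UNIV)"
    by (subst (asm) has_sum_swap) (simp add: case_prod_unfold)
  define p where "p k = (if k = 0 then 0 else infsum (\<lambda>j. f k j) UNIV)" for k
  have colsum: "(\<lambda>j. f k j) summable_on UNIV" if "k \<in> {1..}" for k
    using summable_on_SigmaD1[of "\<lambda>k j. f k j" "{1..}" "\<lambda>_. UNIV" k] full' that by (auto simp: summable_on_def)
  have col: "((\<lambda>j. f k j) has_sum p k) UNIV" if "k \<in> {1..}" for k
    using has_sum_infsum[OF colsum[OF that]] that by (simp add: p_def)
  have p0: "0 \<le> p k" for k unfolding p_def using f0 by (auto intro: infsum_nonneg)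
  have "(p has_sum 1) {1..}"
    by (rule has_sum_SigmaD[OF full']) (use col in simp)
  then have "(p has_sum 1) UNIV"
    by (rule has_sum_cong_neutral[THEN iffD1, rotated -1]) (auto simp: p_def)
  then have sums1: "p sums 1" by (rule has_sum_imp_sums)
  have nn: "(\<integral>\<^sup>+ k. ennreal (p k) \<partial>count_space UNIV) = 1"
    using sums1 p0 by (simp add: nn_integral_count_space_nat suminf_ennreal2 sums_iff)
  have pmfp: "pmf (embed_pmf p) k = p k" for k by (rule pmf_embed_pmf[OF p0 nn])
  show ?thesis
  proof (intro exI[of _ "embed_pmf p"] conjI allI impI)
    show "set_pmf (embed_pmf p) \<subseteq> {1..}"
    proof
      fix k assume "k \<in> set_pmf (embed_pmf p)"
      then have "p k \<noteq> 0" unfolding set_embed_pmf[OF p0 nn] by simp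
      then show "k \<in> {1..}" by (cases k) (auto simp: p_def)
    qed
    fix k :: nat assume "1 \<le> k"
    moreover have "(\<lambda>j. f k j) = (\<lambda>j. 1 / fact k * (q * (1 - 1 / \<theta>) * \<theta> powr (- of_int j + e)) ^ k * exp (- q * \<theta> powr (- of_int j + e)))"
      by (simp add: f_def L_def a_def mult_ac)
    ultimately show "((\<lambda>j. 1 / fact k * (q * (1 - 1 / \<theta>) * \<theta> powr (- of_int j + e)) ^ k * exp (- q * \<theta> powr (- of_int j + e))) has_sum pmf (embed_pmf p) k) UNIV"
      using col[of k] by (simp add: pmfp)
  qed
qed

lemma has_sum_int_interval:
  fixes f :: "int \<Rightarrow> real"
  assumes "(f has_sum s) UNIV"
  shows "(\<lambda>J. \<Sum>j\<in>{- int J..int J}. f j) \<longlonglongrightarrow> s"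
proof -
  have "filterlim (\<lambda>J. {- int J..int J}) (finite_subsets_at_top UNIV) sequentially"
    unfolding filterlim_finite_subsets_at_top
  proof (intro allI impI)
    fix X :: "int set" assume X: "finite X \<and> X \<subseteq> UNIV"
    define B where "B = (\<Sum>j\<in>X. nat \<bar>j\<bar>)"
    have b: "nat \<bar>j\<bar> \<le> B" if "j \<in> X" for j unfolding B_def using X that by (intro member_le_sum) auto
    show "\<forall>\<^sub>F J in sequentially. finite {- int J..int J} \<and> X \<subseteq> {- int J..int J} \<and> {- int J..int J} \<subseteq> UNIV"
      using eventually_ge_at_top[of B]
    proof eventually_elim
      case (elim J)
      have "- int J \<le> j \<and> j \<le> int J" if "j \<in> X" for j using b[OF that] elim by linarith
      then show ?case by auto
    qed
  qed
  then show ?thesis using assms unfolding has_sum_def by (rule filterlim_compose[rotated])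
qed

section \<open>Trees with weights in the unit interval\<close>

locale bounded_weight_tree = weighted_recursive_tree +
  assumes weight_unit: "AE x in \<mu>. x \<in> {0<..1}" and atom_pos: "measure \<mu> {1} > 0"
begin

abbreviation mw :: real where "mw \<equiv> (\<integral>x. x \<partial>\<mu>)"
abbreviation \<theta> :: real where "\<theta> \<equiv> wrt_theta \<mu>"
abbreviation q :: real where "q \<equiv> measure \<mu> {1}"

definition S :: "nat \<Rightarrow> 'a \<Rightarrow> real" where "S n \<omega> = (\<Sum>k=1..n. W k \<omega>)"

definition deg :: "nat \<Rightarrow> nat \<Rightarrow> 'a \<Rightarrow> nat" where
  "deg n v \<omega> = card {m \<in> {2..n}. J m \<omega> = v}"

text \<open>
  The information contained in the weighted tree \<open>T\<^sub>n\<close>.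
\<close>

definition hist :: "nat \<Rightarrow> 'a measure" where
  "hist n = vimage_algebra (space M) (wrt_tree W J n) (wrt_space n)"

lemma q_le_1: "q \<le> 1" by simp

lemma integrable_id_mu: "integrable \<mu> (\<lambda>x. x)"
  by (rule law.integrable_const_bound[where B=1]) (use weight_unit in auto)

lemma mw_bounds: "q \<le> mw" "0 < mw" "mw \<le> 1"
proof -
  have "q = (\<integral>x. indicator {1} x \<partial>\<mu>)" by simp
  also have "\<dots> \<le> mw"
  proof (rule integral_mono_AE)
    show "integrable \<mu> (indicator {1} :: real \<Rightarrow> real)"
      by (rule law.integrable_const_bound[where B=1]) (auto simp: indicator_def)
    show "AE x in \<mu>. indicator {1} x \<le> x"
      using weight_unit by eventually_elim (auto simp: indicator_def)
  qed (rule integrable_id_mu)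
  finally show "q \<le> mw" .
  then show "0 < mw" using atom_pos by simp
  have "mw \<le> (\<integral>x. 1 \<partial>\<mu>)"
    by (rule integral_mono_AE) (use weight_unit in \<open>auto simp: integrable_id_mu\<close>)
  also have "\<dots> \<le> 1" by simp
  finally show "mw \<le> 1" .
qed

lemma theta_eq: "\<theta> = 1 + mw" by (simp add: wrt_theta_def)

lemma W_measurable [measurable]:
  assumes "1 \<le> i" shows "W i \<in> borel_measurable M"
proof -
  have "\<forall>i\<in>{1..}. W i \<in> borel_measurable M"
    using weights_indep unfolding indep_vars_def2 by (rule conjunct1)
  moreover have "i \<in> {1..}" using assms by simp
  ultimately show ?thesis by (rule bspec)
qed

lemma J_measurable [measurable]: "2 \<le> m \<Longrightarrow> J m \<in> measurable M (count_space UNIV)"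
  using attach_measurable[of "m - 1"] by simp

lemma AE_weights: "AE \<omega> in M. \<forall>i\<ge>1. W i \<omega> \<in> {0<..1}"
proof -
  have "AE \<omega> in M. W i \<omega> \<in> {0<..1}" if "1 \<le> i" for i
  proof -
    have "AE x in distr M borel (W i). x \<in> {0<..1}" unfolding weights_law[OF that] by (rule weight_unit)
    then show ?thesis by (rule AE_distrD[OF W_measurable[OF that]])
  qed
  then have "AE \<omega> in M. 1 \<le> i \<longrightarrow> W i \<omega> \<in> {0<..1}" for i by (cases "1 \<le> i") auto
  then show ?thesis by (subst AE_all_countable) (rule allI)
qed

lemma wrt_tree_measurable: "wrt_tree W J n \<in> measurable M (wrt_space n)"
  unfolding wrt_tree_def wrt_space_def
  by (intro measurable_Pair measurable_restrict) auto

lemma subalgebra_hist: "subalgebra M (hist n)"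
proof -
  have "wrt_tree W J n \<in> space M \<rightarrow> space (wrt_space n)" using wrt_tree_measurable by (auto simp: measurable_def)
  then show ?thesis unfolding subalgebra_def hist_def
    using wrt_tree_measurable[of n] by (auto simp: sets_vimage_algebra2 measurable_sets)
qed

lemma space_hist: "space (hist n) = space M" by (simp add: hist_def)

lemma hist_measurable_M: "f \<in> borel_measurable (hist n) \<Longrightarrow> f \<in> borel_measurable M"
  by (rule measurable_from_subalg[OF subalgebra_hist])

lemma wrt_tree_measurable_hist: "wrt_tree W J n \<in> measurable (hist n) (wrt_space n)"
  unfolding hist_def by (rule measurable_vimage_algebra1) (use wrt_tree_measurable in \<open>auto simp: measurable_def\<close>)

lemma W_hist [measurable]:
  assumes "i \<in> {1..n}" shows "W i \<in> borel_measurable (hist n)"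
proof -
  have "(\<lambda>t. fst t i) \<in> borel_measurable (wrt_space n)"
    unfolding wrt_space_def using assms by (intro measurable_compose[OF measurable_fst] measurable_component_singleton)
  from measurable_compose[OF wrt_tree_measurable_hist this]
  show ?thesis using assms by (simp add: wrt_tree_def)
qed

lemma J_hist [measurable]:
  assumes "m \<in> {2..n}" shows "J m \<in> measurable (hist n) (count_space UNIV)"
proof -
  have "(\<lambda>t. snd t m) \<in> measurable (wrt_space n) (count_space UNIV)"
    unfolding wrt_space_def using assms by (intro measurable_compose[OF measurable_snd] measurable_component_singleton)
  from measurable_compose[OF wrt_tree_measurable_hist this]
  show ?thesis using assms by (simp add: wrt_tree_def)
qed

lemma S_hist [measurable]: "j \<le> n \<Longrightarrow> S j \<in> borel_measurable (hist n)"
  unfolding S_def[abs_def] by (intro borel_measurable_sum W_hist) auto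

lemma deg_sum: "deg n v \<omega> = (\<Sum>m\<in>{2..n}. of_bool (J m \<omega> = v))"
  by (simp add: deg_def of_bool_def sum.If_cases Int_def)

lemma deg_hist_gen: "j \<le> n \<Longrightarrow> deg j v \<in> measurable (hist n) (count_space UNIV)"
  unfolding deg_sum[abs_def]
  by (intro measurable_sum_nat) (auto intro!: measurable_compose[OF J_hist])

lemma deg_hist [measurable]: "deg n v \<in> measurable (hist n) (count_space UNIV)"
  by (rule deg_hist_gen) simp

lemma deg_measurable [measurable]: "deg n v \<in> measurable M (count_space UNIV)"
  by (rule measurable_from_subalg[OF subalgebra_hist deg_hist])

lemma deg_Suc: "1 \<le> n \<Longrightarrow> deg (Suc n) v \<omega> = deg n v \<omega> + of_bool (J (Suc n) \<omega> = v)"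
  unfolding deg_sum by (simp add: atLeastAtMostSuc_conv)

lemma deg_late: assumes "\<omega> \<in> space M" "n \<le> v" shows "deg n v \<omega> = 0"
proof -
  have "J m \<omega> \<noteq> v" if m: "m \<in> {2..n}" for m
  proof -
    have "Suc (m - 1) = m" "1 \<le> m - 1" using m by auto
    then have "J m \<omega> \<in> {1..m - 1}" using attach_range[of "m - 1" \<omega>] assms(1) by metis
    then show ?thesis using m assms(2) by auto
  qed
  then show ?thesis by (simp add: deg_def)
qed

lemma deg_le: "deg n v \<omega> \<le> n"
proof -
  have "deg n v \<omega> \<le> card {2..n}" unfolding deg_def by (rule card_mono) auto
  then show ?thesis by simp
qed

lemma wrt_indegree_eq_deg: "wrt_indegree J n v \<omega> = deg n v \<omega>"
proof -
  have "{e \<in> (\<lambda>m. (m, J m \<omega>)) ` {2..n}. snd e = v} = (\<lambda>m. (m, J m \<omega>)) ` {m \<in> {2..n}. J m \<omega> = v}" by auto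
  then have "wrt_indegree J n v \<omega> = card ((\<lambda>m. (m, J m \<omega>)) ` {m \<in> {2..n}. J m \<omega> = v})"
    by (simp add: wrt_indegree_def in_degree_def in_arcs_def wrt_graph_def)
  also have "\<dots> = deg n v \<omega>" unfolding deg_def by (rule card_image) (auto simp: inj_on_def)
  finally show ?thesis .
qed

text \<open>
  The conditional law of the next edge, tested against bounded functions of the present tree. All further
  arguments use the attachment rule in this form.
\<close>

lemma attach_integral:
  assumes n: "1 \<le> n" "i \<in> {1..n}" and g [measurable]: "g \<in> borel_measurable (hist n)"
    and b: "\<And>\<omega>. \<bar>g \<omega>\<bar> \<le> K"
  shows "(\<integral>\<omega>. g \<omega> * of_bool (J (Suc n) \<omega> = i) \<partial>M) = (\<integral>\<omega>. g \<omega> * (W i \<omega> / S n \<omega>) \<partial>M)"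
proof -
  interpret sub: finite_measure_subalgebra M "hist n"
    by unfold_locales (rule subalgebra_hist)
  let ?I = "indicator {\<omega> \<in> space M. J (Suc n) \<omega> = i} :: 'a \<Rightarrow> real"
  have gM [measurable]: "g \<in> borel_measurable M" by (rule hist_measurable_M[OF g])
  have Jm [measurable]: "J (Suc n) \<in> measurable M (count_space UNIV)" using attach_measurable n by simp
  have int: "integrable M (\<lambda>\<omega>. g \<omega> * ?I \<omega>)"
    by (rule integrable_const_bound[where B=K]) 
      (use b in \<open>auto simp: indicator_def intro: order_trans[OF abs_ge_zero]\<close>)
  have "(\<integral>\<omega>. g \<omega> * of_bool (J (Suc n) \<omega> = i) \<partial>M) = (\<integral>\<omega>. g \<omega> * ?I \<omega> \<partial>M)"
    by (rule Bochner_Integration.integral_cong) (auto simp: indicator_def)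
  also have "\<dots> = (\<integral>\<omega>. g \<omega> * real_cond_exp M (hist n) ?I \<omega> \<partial>M)"
    by (rule sub.real_cond_exp_intg(2)[OF int g, symmetric]) measurable
  also have "\<dots> = (\<integral>\<omega>. g \<omega> * (W i \<omega> / S n \<omega>) \<partial>M)"
  proof (rule integral_cong_AE)
    show "(\<lambda>\<omega>. g \<omega> * real_cond_exp M (hist n) ?I \<omega>) \<in> borel_measurable M" by measurable
    have [measurable]: "W i \<in> borel_measurable M" "S n \<in> borel_measurable M"
      using n by (auto intro: hist_measurable_M[OF S_hist])
    show "(\<lambda>\<omega>. g \<omega> * (W i \<omega> / S n \<omega>)) \<in> borel_measurable M" by measurable
    show "AE \<omega> in M. g \<omega> * real_cond_exp M (hist n) ?I \<omega> = g \<omega> * (W i \<omega> / S n \<omega>)"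
      using attach_law[OF n, folded hist_def] by eventually_elim (simp add: S_def)
  qed
  finally show ?thesis .
qed

section \<open>The recursion for tuples of vertices\<close>

definition cnt :: "real set \<Rightarrow> nat \<Rightarrow> 'a \<Rightarrow> real" where
  "cnt B n \<omega> = (\<Sum>k=1..n. indicator B (W k \<omega>))"

text \<open>
  The weight sums, and the numbers of weights in \<open>B\<close>, stay close to their means from time \<open>n0\<close> to time \<open>n\<close>.
  The event decreases in \<open>n\<close> and is determined by \<open>T\<^sub>n\<close>, so that its indicator can be carried along the
  recursion in \<open>n\<close>.
\<close>

definition good :: "real set \<Rightarrow> nat \<Rightarrow> real \<Rightarrow> nat \<Rightarrow> 'a set" where
  "good B n0 \<delta> n = {\<omega> \<in> space M. \<forall>j\<in>{n0..n}.
     \<bar>S j \<omega> - mw * real j\<bar> \<le> \<delta> * real j \<and> \<bar>cnt B j \<omega> - measure \<mu> B * real j\<bar> \<le> \<delta> * real j}"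

definition hit :: "real set \<Rightarrow> nat \<Rightarrow> nat \<Rightarrow> 'a \<Rightarrow> nat \<Rightarrow> real" where
  "hit B n m \<omega> x = of_bool (W x \<omega> \<in> B \<and> m \<le> deg n x \<omega>)"

text \<open>
  The number of tuples of distinct vertices that arrived after time \<open>n0\<close>, have weights in \<open>B\<close>, and whose
  \<open>l\<close>-th entry has degree at least \<open>m l\<close>.
\<close>

definition tuples :: "real set \<Rightarrow> nat \<Rightarrow> nat \<Rightarrow> 'i set \<Rightarrow> ('i \<Rightarrow> nat) \<Rightarrow> 'a \<Rightarrow> real" where
  "tuples B n0 n I m \<omega> = distinct_sum {n0<..n} I (\<lambda>l x. hit B n (m l) \<omega> x)"

lemma good_hist [measurable]:
  assumes [measurable]: "B \<in> sets borel" shows "good B n0 \<delta> n \<in> sets (hist n)"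
proof -
  have cm: "cnt B j \<in> borel_measurable (hist n)" if "j \<le> n" for j
    unfolding cnt_def[abs_def]
    by (intro borel_measurable_sum measurable_compose[OF W_hist]) (use that in auto)
  have "{\<omega> \<in> space (hist n). \<forall>j\<in>{n0..n}.
     \<bar>S j \<omega> - mw * real j\<bar> \<le> \<delta> * real j \<and> \<bar>cnt B j \<omega> - measure \<mu> B * real j\<bar> \<le> \<delta> * real j} \<in> sets (hist n)"
  proof (rule sets.sets_Collect_finite_All)
    fix j assume "j \<in> {n0..n}"
    then have [measurable]: "cnt B j \<in> borel_measurable (hist n)" "S j \<in> borel_measurable (hist n)"
      using cm by auto
    show "{\<omega> \<in> space (hist n). \<bar>S j \<omega> - mw * real j\<bar> \<le> \<delta> * real j \<and> \<bar>cnt B j \<omega> - measure \<mu> B * real j\<bar> \<le> \<delta> * real j} \<in> sets (hist n)"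
      by measurable
  qed simp
  then show ?thesis unfolding good_def space_hist .
qed

lemma good_sets [measurable]: "B \<in> sets borel \<Longrightarrow> good B n0 \<delta> n \<in> sets M"
  using good_hist subalgebra_hist unfolding subalgebra_def by blast

lemma good_antimono: "m \<le> n \<Longrightarrow> good B n0 \<delta> n \<subseteq> good B n0 \<delta> m"
  by (auto simp: good_def)

lemma hit_hist [measurable]:
  assumes "B \<in> sets borel" "x \<in> {1..n}" shows "(\<lambda>\<omega>. hit B n m \<omega> x) \<in> borel_measurable (hist n)"
proof -
  have [measurable]: "W x \<in> borel_measurable (hist n)" using assms by auto
  note assms(1)[measurable]
  show ?thesis unfolding hit_def by measurable
qed

lemma hit_bounds: "0 \<le> hit B n m \<omega> x" "hit B n m \<omega> x \<le> 1"
  by (auto simp: hit_def)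

lemma hit_prod_bounds: "0 \<le> (\<Prod>l\<in>I. hit B n (m l) \<omega> (v l))" "(\<Prod>l\<in>I. hit B n (m l) \<omega> (v l)) \<le> 1"
  by (auto intro!: prod_nonneg prod_le_1 simp: hit_bounds)

lemma hit_prod_hist [measurable]:
  assumes "B \<in> sets borel" "v \<in> inj_maps I {n0<..n}"
  shows "(\<lambda>\<omega>. \<Prod>l\<in>I. hit B n (m l) \<omega> (v l)) \<in> borel_measurable (hist n)"
proof (intro borel_measurable_prod hit_hist assms(1))
  fix l assume "l \<in> I"
  then have "v l \<in> {n0<..n}" using assms(2) by (auto simp: inj_maps_def)
  then show "v l \<in> {1..n}" by auto
qed

lemma tuples_hist [measurable]:
  "B \<in> sets borel \<Longrightarrow> tuples B n0 n I m \<in> borel_measurable (hist n)"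
  unfolding tuples_def[abs_def] distinct_sum_def by (intro borel_measurable_sum hit_prod_hist)

lemma tuples_measurable [measurable]:
  "B \<in> sets borel \<Longrightarrow> tuples B n0 n I m \<in> borel_measurable M"
  by (rule hist_measurable_M[OF tuples_hist])

lemma tuples_nonneg: "0 \<le> tuples B n0 n I m \<omega>"
  unfolding tuples_def distinct_sum_def by (intro sum_nonneg hit_prod_bounds)

lemma tuples_le:
  assumes "finite I" shows "tuples B n0 n I m \<omega> \<le> real n ^ card I"
proof -
  have "tuples B n0 n I m \<omega> \<le> (\<Sum>v\<in>inj_maps I {n0<..n}. 1)"
    unfolding tuples_def distinct_sum_def by (intro sum_mono hit_prod_bounds)
  also have "\<dots> = real (card (inj_maps I {n0<..n}))" by simp
  also have "\<dots> \<le> real (card {n0<..n} ^ card I)"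
    using card_inj_maps_le[OF assms, of "{n0<..n}"] by (simp only: of_nat_le_iff finite_greaterThanAtMost)
  also have "\<dots> \<le> real n ^ card I" by (simp add: power_mono)
  finally show ?thesis .
qed

lemma integrable_bounded_M:
  assumes "f \<in> borel_measurable M" "\<And>\<omega>. \<bar>f \<omega>\<bar> \<le> (K::real)" shows "integrable M f"
  by (rule integrable_const_bound[where B=K]) (use assms in auto)

lemma integrable_weight_ratio:
  assumes "f \<in> borel_measurable M" "\<And>\<omega>. \<bar>f \<omega>\<bar> \<le> (K::real)" "x \<in> {1..n}"
  shows "integrable M (\<lambda>\<omega>. f \<omega> * (W x \<omega> / S n \<omega>))"
proof (rule integrable_const_bound[where B=K])
  have [measurable]: "W x \<in> borel_measurable M" "S n \<in> borel_measurable M"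
    using assms(3) by (auto intro: hist_measurable_M[OF S_hist])
  note assms(1)[measurable]
  show "(\<lambda>\<omega>. f \<omega> * (W x \<omega> / S n \<omega>)) \<in> borel_measurable M" by measurable
  show "AE \<omega> in M. norm (f \<omega> * (W x \<omega> / S n \<omega>)) \<le> K"
    using AE_weights
  proof eventually_elim
    case (elim \<omega>)
    have pos: "0 < W k \<omega>" if "k \<in> {1..n}" for k using elim that by auto
    have "W x \<omega> \<le> S n \<omega>" unfolding S_def
      by (rule member_le_sum) (use assms(3) pos in \<open>auto intro: less_imp_le\<close>)
    then have "0 \<le> W x \<omega> / S n \<omega>" "W x \<omega> / S n \<omega> \<le> 1" using pos[OF assms(3)] by auto
    then have "\<bar>W x \<omega> / S n \<omega>\<bar> \<le> 1" by simp
    from mult_mono[OF assms(2)[of \<omega>] this] show ?case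
      using order_trans[OF abs_ge_zero assms(2)[of \<omega>]] unfolding real_norm_def abs_mult by simp
  qed
qed

text \<open>
  The new edge ends in at most one entry of a tuple of distinct vertices. If it ends in the \<open>l\<close>-th entry, then
  afterwards the threshold \<open>m l\<close> is met if \<open>m l - 1\<close> was met before.
\<close>

lemma hit_prod_step:
  assumes n: "1 \<le> n" and fin: "finite I" and m: "\<And>l. l \<in> I \<Longrightarrow> 1 \<le> m l" and v: "inj_on v I"
  shows "(\<Prod>i\<in>I. hit B (Suc n) (m i) \<omega> (v i)) = (\<Prod>i\<in>I. hit B n (m i) \<omega> (v i)) +
     (\<Sum>l\<in>I. ((\<Prod>i\<in>I. hit B n ((m(l := m l - 1)) i) \<omega> (v i)) - (\<Prod>i\<in>I. hit B n (m i) \<omega> (v i)))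
        * of_bool (J (Suc n) \<omega> = v l))"
proof (cases "\<exists>l\<in>I. J (Suc n) \<omega> = v l")
  case False
  then have "(\<Prod>i\<in>I. hit B (Suc n) (m i) \<omega> (v i)) = (\<Prod>i\<in>I. hit B n (m i) \<omega> (v i))"
    by (intro prod.cong refl) (auto simp: hit_def deg_Suc[OF n])
  then show ?thesis using False by simp
next
  case True
  then obtain l where l: "l \<in> I" "J (Suc n) \<omega> = v l" by blast
  have other: "J (Suc n) \<omega> = v i \<longleftrightarrow> i = l" if "i \<in> I" for i
    using l v that by (auto simp: inj_on_def)
  have "(\<Prod>i\<in>I. hit B (Suc n) (m i) \<omega> (v i)) = (\<Prod>i\<in>I. hit B n ((m(l := m l - 1)) i) \<omega> (v i))"
    by (intro prod.cong refl) (use m[OF l(1)] in \<open>auto simp: hit_def deg_Suc[OF n] other\<close>)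
  moreover have "(\<Sum>k\<in>I. ((\<Prod>i\<in>I. hit B n ((m(k := m k - 1)) i) \<omega> (v i)) - (\<Prod>i\<in>I. hit B n (m i) \<omega> (v i)))
        * of_bool (J (Suc n) \<omega> = v k)) = (\<Sum>k\<in>{l}. ((\<Prod>i\<in>I. hit B n ((m(k := m k - 1)) i) \<omega> (v i)) - (\<Prod>i\<in>I. hit B n (m i) \<omega> (v i))))"
    by (rule sum.mono_neutral_cong_right) (use l fin other in auto)
  ultimately show ?thesis by simp
qed

text \<open>
  The vertex that has just arrived has degree zero and cannot meet a positive threshold.
\<close>

lemma tuples_Suc:
  assumes n: "1 \<le> n" and fin: "finite I" "I \<noteq> {}" and m: "\<And>l. l \<in> I \<Longrightarrow> 1 \<le> m l" and w: "\<omega> \<in> space M"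
  shows "tuples B n0 (Suc n) I m \<omega> = (\<Sum>v\<in>inj_maps I {n0<..n}. \<Prod>i\<in>I. hit B (Suc n) (m i) \<omega> (v i))"
  unfolding tuples_def distinct_sum_def
proof (rule sum.mono_neutral_right)
  show "finite (inj_maps I {n0<..Suc n})" using fin by (simp add: finite_inj_maps)
  show "inj_maps I {n0<..n} \<subseteq> inj_maps I {n0<..Suc n}" by (auto simp: inj_maps_def PiE_def Pi_def intro: le_SucI)
  show "\<forall>v\<in>inj_maps I {n0<..Suc n} - inj_maps I {n0<..n}. (\<Prod>i\<in>I. hit B (Suc n) (m i) \<omega> (v i)) = 0"
  proof
    fix v assume v: "v \<in> inj_maps I {n0<..Suc n} - inj_maps I {n0<..n}"
    then obtain l where l: "l \<in> I" "v l \<notin> {n0<..n}" "v l \<in> {n0<..Suc n}"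
      unfolding inj_maps_def by (smt (verit) DiffE PiE_iff mem_Collect_eq)
    then have "v l = Suc n" by auto
    then have "deg (Suc n) (v l) \<omega> = 0" using deg_late[OF w] by simp
    then have "hit B (Suc n) (m l) \<omega> (v l) = 0" using m[OF l(1)] by (simp add: hit_def)
    then show "(\<Prod>i\<in>I. hit B (Suc n) (m i) \<omega> (v i)) = 0" using l(1) fin by auto
  qed
qed

text \<open>
  The expected change in one step, split over the tuples and their entries. The attachment probabilities are
  still random here.
\<close>

lemma tuples_step:
  fixes m :: "'i \<Rightarrow> nat" and I B
  defines "P \<equiv> \<lambda>n m v \<omega>. \<Prod>i\<in>I. hit B n (m i) \<omega> (v i)"
  assumes n: "1 \<le> n" and fin: "finite I" "I \<noteq> {}" and m: "\<And>l. l \<in> I \<Longrightarrow> 1 \<le> m l"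
    and B [measurable]: "B \<in> sets borel"
    and g [measurable]: "g \<in> borel_measurable (hist n)" and gK: "\<And>\<omega>. \<bar>g \<omega>\<bar> \<le> K"
  shows "(\<integral>\<omega>. g \<omega> * tuples B n0 (Suc n) I m \<omega> \<partial>M) =
    (\<Sum>v\<in>inj_maps I {n0<..n}. (\<integral>\<omega>. g \<omega> * P n m v \<omega> \<partial>M) +
       (\<Sum>l\<in>I. \<integral>\<omega>. (g \<omega> * (P n (m(l := m l - 1)) v \<omega> - P n m v \<omega>)) * (W (v l) \<omega> / S n \<omega>) \<partial>M))"
proof -
  let ?V = "inj_maps I {n0<..n}"
  have K: "0 \<le> K" using gK[of undefined] by simp
  have P01: "0 \<le> P n m v \<omega>" "P n m v \<omega> \<le> 1" for n m v \<omega> 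
    unfolding P_def by (auto simp: hit_prod_bounds)
  have Pm: "P n m' v \<in> borel_measurable (hist n)" if "v \<in> ?V" for m' v
    unfolding P_def by (rule hit_prod_hist[OF B that])
  have dm: "(\<lambda>\<omega>. g \<omega> * (P n (m(l := m l - 1)) v \<omega> - P n m v \<omega>)) \<in> borel_measurable (hist n)" if "v \<in> ?V" for v l
    using Pm[OF that] by measurable
  have db: "\<bar>g \<omega> * (P n (m(l := m l - 1)) v \<omega> - P n m v \<omega>)\<bar> \<le> K" for v l \<omega>
  proof -
    have "\<bar>P n (m(l := m l - 1)) v \<omega> - P n m v \<omega>\<bar> \<le> 1" using P01[of n m v \<omega>] P01[of n "m(l := m l - 1)" v \<omega>] by simp
    from mult_mono[OF gK this K] show ?thesis by (simp add: abs_mult)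
  qed
  have vl: "v l \<in> {1..n}" if "v \<in> ?V" "l \<in> I" for v l
  proof -
    have "v l \<in> {n0<..n}" using that by (auto simp: inj_maps_def)
    then show ?thesis by auto
  qed
  have i1: "integrable M (\<lambda>\<omega>. g \<omega> * P n m v \<omega>)" if "v \<in> ?V" for v
  proof (rule integrable_bounded_M)
    show "(\<lambda>\<omega>. g \<omega> * P n m v \<omega>) \<in> borel_measurable M"
      by (rule hist_measurable_M) (use Pm[OF that] in measurable)
    show "\<bar>g \<omega> * P n m v \<omega>\<bar> \<le> K" for \<omega>
      using mult_mono[OF gK[of \<omega>] P01(2)[of n m v \<omega>] K P01(1)] P01(1)[of n m v \<omega>] by (simp add: abs_mult)
  qed
  have i2: "integrable M (\<lambda>\<omega>. (g \<omega> * (P n (m(l := m l - 1)) v \<omega> - P n m v \<omega>)) * of_bool (J (Suc n) \<omega> = v l))"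
    if v: "v \<in> ?V" "l \<in> I" for v l
  proof (rule integrable_bounded_M)
    have [measurable]: "J (Suc n) \<in> measurable M (count_space UNIV)" using n by (intro J_measurable) auto
    have [measurable]: "(\<lambda>\<omega>. g \<omega> * (P n (m(l := m l - 1)) v \<omega> - P n m v \<omega>)) \<in> borel_measurable M"
      by (rule hist_measurable_M[OF dm[OF v(1)]])
    show "(\<lambda>\<omega>. (g \<omega> * (P n (m(l := m l - 1)) v \<omega> - P n m v \<omega>)) * of_bool (J (Suc n) \<omega> = v l)) \<in> borel_measurable M"
      by measurable
    show "\<bar>(g \<omega> * (P n (m(l := m l - 1)) v \<omega> - P n m v \<omega>)) * of_bool (J (Suc n) \<omega> = v l)\<bar> \<le> K" for \<omega>
      using db[of \<omega> l v] K by (simp add: of_bool_def)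
  qed
  have "(\<integral>\<omega>. g \<omega> * tuples B n0 (Suc n) I m \<omega> \<partial>M) = (\<integral>\<omega>. (\<Sum>v\<in>?V. g \<omega> * P n m v \<omega> +
      (\<Sum>l\<in>I. (g \<omega> * (P n (m(l := m l - 1)) v \<omega> - P n m v \<omega>)) * of_bool (J (Suc n) \<omega> = v l))) \<partial>M)"
  proof (rule Bochner_Integration.integral_cong[OF refl])
    fix \<omega> assume w: "\<omega> \<in> space M"
    have "g \<omega> * tuples B n0 (Suc n) I m \<omega> = (\<Sum>v\<in>?V. g \<omega> * P (Suc n) m v \<omega>)"
      unfolding P_def by (simp add: tuples_Suc[OF n fin m w] sum_distrib_left)
    also have "\<dots> = (\<Sum>v\<in>?V. g \<omega> * P n m v \<omega> +
      (\<Sum>l\<in>I. (g \<omega> * (P n (m(l := m l - 1)) v \<omega> - P n m v \<omega>)) * of_bool (J (Suc n) \<omega> = v l)))"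
    proof (rule sum.cong[OF refl])
      fix v assume "v \<in> ?V"
      then have "inj_on v I" by (simp add: inj_maps_def)
      from hit_prod_step[OF n fin(1) _ this, where B=B and \<omega>=\<omega> and m=m] m
      have e: "P (Suc n) m v \<omega> = P n m v \<omega> + (\<Sum>l\<in>I. (P n (m(l := m l - 1)) v \<omega> - P n m v \<omega>) * of_bool (J (Suc n) \<omega> = v l))"
        unfolding P_def by blast
      show "g \<omega> * P (Suc n) m v \<omega> = g \<omega> * P n m v \<omega> +
         (\<Sum>l\<in>I. (g \<omega> * (P n (m(l := m l - 1)) v \<omega> - P n m v \<omega>)) * of_bool (J (Suc n) \<omega> = v l))"
        unfolding e by (simp only: distrib_left sum_distrib_left mult.assoc)
    qed
    finally show "g \<omega> * tuples B n0 (Suc n) I m \<omega> = (\<Sum>v\<in>?V. g \<omega> * P n m v \<omega> +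
      (\<Sum>l\<in>I. (g \<omega> * (P n (m(l := m l - 1)) v \<omega> - P n m v \<omega>)) * of_bool (J (Suc n) \<omega> = v l)))" .
  qed
  also have "\<dots> = (\<Sum>v\<in>?V. (\<integral>\<omega>. g \<omega> * P n m v \<omega> \<partial>M) +
      (\<Sum>l\<in>I. \<integral>\<omega>. (g \<omega> * (P n (m(l := m l - 1)) v \<omega> - P n m v \<omega>)) * of_bool (J (Suc n) \<omega> = v l) \<partial>M))"
    using i1 i2 by (subst Bochner_Integration.integral_sum)
      (auto simp: Bochner_Integration.integral_add Bochner_Integration.integral_sum intro!: sum.cong)
  also have "\<dots> = (\<Sum>v\<in>?V. (\<integral>\<omega>. g \<omega> * P n m v \<omega> \<partial>M) +
       (\<Sum>l\<in>I. \<integral>\<omega>. (g \<omega> * (P n (m(l := m l - 1)) v \<omega> - P n m v \<omega>)) * (W (v l) \<omega> / S n \<omega>) \<partial>M))"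
    using attach_integral[OF n vl dm db] by (intro sum.cong refl arg_cong2[where f="(+)"]) auto
  finally show ?thesis .
qed

lemma integral_tuples_sum:
  assumes fin: "finite I" and B: "B \<in> sets borel"
    and g: "g \<in> borel_measurable (hist n)" and gK: "\<And>\<omega>. \<bar>g \<omega>\<bar> \<le> K"
  shows "(\<Sum>v\<in>inj_maps I {n0<..n}. \<integral>\<omega>. g \<omega> * (\<Prod>i\<in>I. hit B n (m i) \<omega> (v i)) \<partial>M)
      = (\<integral>\<omega>. g \<omega> * tuples B n0 n I m \<omega> \<partial>M)"
    and "v \<in> inj_maps I {n0<..n} \<Longrightarrow> integrable M (\<lambda>\<omega>. g \<omega> * (\<Prod>i\<in>I. hit B n (m i) \<omega> (v i)))"
proof -
  have K: "0 \<le> K" using gK[of undefined] by simp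
  show i: "integrable M (\<lambda>\<omega>. g \<omega> * (\<Prod>i\<in>I. hit B n (m i) \<omega> (v i)))" if v: "v \<in> inj_maps I {n0<..n}" for v
  proof (rule integrable_bounded_M)
    show "(\<lambda>\<omega>. g \<omega> * (\<Prod>i\<in>I. hit B n (m i) \<omega> (v i))) \<in> borel_measurable M"
      by (intro hist_measurable_M[where n=n] borel_measurable_times g hit_prod_hist[OF B v])
    show "\<bar>g \<omega> * (\<Prod>i\<in>I. hit B n (m i) \<omega> (v i))\<bar> \<le> K" for \<omega>
    proof -
      have "\<bar>\<Prod>i\<in>I. hit B n (m i) \<omega> (v i)\<bar> \<le> 1"
        using hit_prod_bounds[where B=B and n=n and m=m and \<omega>=\<omega> and v=v and I=I] by (simp only: abs_of_nonneg)
      from mult_mono[OF gK this K] show ?thesis by (simp only: abs_mult mult_1_right abs_ge_zero)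
    qed
  qed
  show "(\<Sum>v\<in>inj_maps I {n0<..n}. \<integral>\<omega>. g \<omega> * (\<Prod>i\<in>I. hit B n (m i) \<omega> (v i)) \<partial>M)
      = (\<integral>\<omega>. g \<omega> * tuples B n0 n I m \<omega> \<partial>M)"
    unfolding tuples_def distinct_sum_def sum_distrib_left
    by (rule Bochner_Integration.integral_sum[symmetric]) (rule i)
qed

text \<open>
  Lowering a threshold can only help, so the sum in \<open>tuples_step\<close> is monotone in the attachment
  probabilities \<open>W (v l) / S n\<close>. Replacing them by a common bound \<open>p\<close> closes the recursion.
\<close>

lemma tuples_step_compare:
  fixes m :: "'i \<Rightarrow> nat" and I B n0 and g :: "'a \<Rightarrow> real"
    and F :: "nat \<Rightarrow> ('i \<Rightarrow> nat) \<Rightarrow> real" and p :: real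
  defines "F \<equiv> \<lambda>n m. \<integral>\<omega>. g \<omega> * tuples B n0 n I m \<omega> \<partial>M"
  assumes n: "1 \<le> n" and fin: "finite I" "I \<noteq> {}" and m: "\<And>l. l \<in> I \<Longrightarrow> 1 \<le> m l"
    and B: "B \<in> sets borel"
    and g: "g \<in> borel_measurable (hist n)" and gK: "\<And>\<omega>. \<bar>g \<omega>\<bar> \<le> K" and g0: "\<And>\<omega>. 0 \<le> g \<omega>"
  shows "(\<And>\<omega> x. g \<omega> \<noteq> 0 \<Longrightarrow> x \<in> {n0<..n} \<Longrightarrow> W x \<omega> \<in> B \<Longrightarrow> W x \<omega> / S n \<omega> \<le> p) \<Longrightarrow>
      F (Suc n) m \<le> (1 - card I * p) * F n m + p * (\<Sum>l\<in>I. F n (m(l := m l - 1)))"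
    and "(\<And>\<omega> x. g \<omega> \<noteq> 0 \<Longrightarrow> x \<in> {n0<..n} \<Longrightarrow> W x \<omega> \<in> B \<Longrightarrow> p \<le> W x \<omega> / S n \<omega>) \<Longrightarrow>
      F (Suc n) m \<ge> (1 - card I * p) * F n m + p * (\<Sum>l\<in>I. F n (m(l := m l - 1)))"
proof -
  let ?V = "inj_maps I {n0<..n}"
  define P where "P m v \<omega> = (\<Prod>i\<in>I. hit B n (m i) \<omega> (v i))" for m :: "'i \<Rightarrow> nat" and v \<omega>
  have K: "0 \<le> K" using gK[of undefined] by simp
  have iP: "integrable M (\<lambda>\<omega>. g \<omega> * P m' v \<omega>)" if "v \<in> ?V" for m' v
    unfolding P_def by (rule integral_tuples_sum(2)[OF fin(1) B g gK that])
  have sP: "(\<Sum>v\<in>?V. \<integral>\<omega>. g \<omega> * P m' v \<omega> \<partial>M) = F n m'" for m'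
    unfolding P_def F_def by (rule integral_tuples_sum(1)[OF fin(1) B g gK])
  have P01: "0 \<le> P m v \<omega>" "P m v \<omega> \<le> 1" for m v \<omega> 
    unfolding P_def by (auto simp: hit_prod_bounds)
  have diff0: "0 \<le> P (m(l := m l - 1)) v \<omega> - P m v \<omega>" for l v \<omega>
    unfolding P_def by simp (auto intro!: prod_mono simp: hit_def)
  have diffB: "W (v l) \<omega> \<in> B" if "P (m(l := m l - 1)) v \<omega> - P m v \<omega> \<noteq> 0" "l \<in> I" for l v \<omega>
  proof -
    have "P (m(l := m l - 1)) v \<omega> \<noteq> 0" using that diff0[of l v \<omega>] P01(1)[of m v \<omega>] by linarith
    then have "hit B n ((m(l := m l - 1)) l) \<omega> (v l) \<noteq> 0" using that fin(1) unfolding P_def by auto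
    then show ?thesis by (simp add: hit_def)
  qed
  have vl: "v l \<in> {n0<..n}" if "v \<in> ?V" "l \<in> I" for v l using that by (auto simp: inj_maps_def)
  have i2: "integrable M (\<lambda>\<omega>. (g \<omega> * (P (m(l := m l - 1)) v \<omega> - P m v \<omega>)) * (W (v l) \<omega> / S n \<omega>))"
    if v: "v \<in> ?V" "l \<in> I" for v l
  proof (rule integrable_weight_ratio)
    show "(\<lambda>\<omega>. g \<omega> * (P (m(l := m l - 1)) v \<omega> - P m v \<omega>)) \<in> borel_measurable M"
      unfolding P_def by (intro hist_measurable_M[where n=n] borel_measurable_times borel_measurable_diff g hit_prod_hist[OF B v(1)])
    show "\<bar>g \<omega> * (P (m(l := m l - 1)) v \<omega> - P m v \<omega>)\<bar> \<le> K" for \<omega>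
    proof -
      have "\<bar>P (m(l := m l - 1)) v \<omega> - P m v \<omega>\<bar> \<le> 1" using P01[of m v \<omega>] P01[of "m(l := m l - 1)" v \<omega>] by simp
      from mult_mono[OF gK this K] show ?thesis by (simp add: abs_mult)
    qed
    show "v l \<in> {1..n}" using vl[OF v] by auto
  qed
  have i3: "integrable M (\<lambda>\<omega>. (g \<omega> * (P (m(l := m l - 1)) v \<omega> - P m v \<omega>)) * p)" if "v \<in> ?V" for v l
    using iP[OF that, of m] iP[OF that, of "m(l := m l - 1)"] by (simp add: right_diff_distrib)
  have i3e: "(\<integral>\<omega>. (g \<omega> * (P (m(l := m l - 1)) v \<omega> - P m v \<omega>)) * p \<partial>M) = 
      p * ((\<integral>\<omega>. g \<omega> * P (m(l := m l - 1)) v \<omega> \<partial>M) - (\<integral>\<omega>. g \<omega> * P m v \<omega> \<partial>M))" if "v \<in> ?V" for v l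
    using iP[OF that, of m] iP[OF that, of "m(l := m l - 1)"] by (simp add: right_diff_distrib) (simp add: algebra_simps)
  have rhs: "(\<Sum>v\<in>?V. (\<integral>\<omega>. g \<omega> * P m v \<omega> \<partial>M) +
       (\<Sum>l\<in>I. \<integral>\<omega>. (g \<omega> * (P (m(l := m l - 1)) v \<omega> - P m v \<omega>)) * p \<partial>M)) =
       (1 - card I * p) * F n m + p * (\<Sum>l\<in>I. F n (m(l := m l - 1)))"
  proof -
    have "(\<Sum>v\<in>?V. (\<integral>\<omega>. g \<omega> * P m v \<omega> \<partial>M) +
       (\<Sum>l\<in>I. \<integral>\<omega>. (g \<omega> * (P (m(l := m l - 1)) v \<omega> - P m v \<omega>)) * p \<partial>M)) =
       (\<Sum>v\<in>?V. (\<integral>\<omega>. g \<omega> * P m v \<omega> \<partial>M) +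
       (\<Sum>l\<in>I. p * ((\<integral>\<omega>. g \<omega> * P (m(l := m l - 1)) v \<omega> \<partial>M) - (\<integral>\<omega>. g \<omega> * P m v \<omega> \<partial>M))))"
      by (intro sum.cong refl arg_cong2[where f="(+)"] i3e) auto
    also have "\<dots> = F n m + p * ((\<Sum>l\<in>I. \<Sum>v\<in>?V. (\<integral>\<omega>. g \<omega> * P (m(l := m l - 1)) v \<omega> \<partial>M) - (\<integral>\<omega>. g \<omega> * P m v \<omega> \<partial>M)))"
      by (subst sum.swap) (simp add: sum.distrib sP sum_distrib_left)
    also have "\<dots> = F n m + p * ((\<Sum>l\<in>I. F n (m(l := m l - 1)) - F n m))"
      by (simp add: sum_subtractf sP)
    finally show ?thesis by (simp add: sum_subtractf algebra_simps)
  qed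
  have step: "F (Suc n) m = (\<Sum>v\<in>?V. (\<integral>\<omega>. g \<omega> * P m v \<omega> \<partial>M) +
       (\<Sum>l\<in>I. \<integral>\<omega>. (g \<omega> * (P (m(l := m l - 1)) v \<omega> - P m v \<omega>)) * (W (v l) \<omega> / S n \<omega>) \<partial>M))"
    unfolding F_def P_def by (rule tuples_step[OF n fin m B g gK])
  show "F (Suc n) m \<le> (1 - card I * p) * F n m + p * (\<Sum>l\<in>I. F n (m(l := m l - 1)))" if u: "\<And>\<omega> x. g \<omega> \<noteq> 0 \<Longrightarrow> x \<in> {n0<..n} \<Longrightarrow> W x \<omega> \<in> B \<Longrightarrow> W x \<omega> / S n \<omega> \<le> p"
    unfolding rhs[symmetric] step
  proof (intro sum_mono add_left_mono integral_mono i2 i3)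
    fix v l \<omega> assume v: "v \<in> ?V" "l \<in> I"
    show "(g \<omega> * (P (m(l := m l - 1)) v \<omega> - P m v \<omega>)) * (W (v l) \<omega> / S n \<omega>) \<le> (g \<omega> * (P (m(l := m l - 1)) v \<omega> - P m v \<omega>)) * p"
    proof (cases "g \<omega> * (P (m(l := m l - 1)) v \<omega> - P m v \<omega>) = 0")
      case False
      then have "W (v l) \<omega> / S n \<omega> \<le> p" using u vl[OF v] diffB[OF _ v(2)] by auto
      then show ?thesis using g0 diff0 by (intro mult_left_mono mult_nonneg_nonneg) auto
    next
      case True
      show ?thesis unfolding True by simp
    qed
  qed auto
  show "F (Suc n) m \<ge> (1 - card I * p) * F n m + p * (\<Sum>l\<in>I. F n (m(l := m l - 1)))" if u: "\<And>\<omega> x. g \<omega> \<noteq> 0 \<Longrightarrow> x \<in> {n0<..n} \<Longrightarrow> W x \<omega> \<in> B \<Longrightarrow> p \<le> W x \<omega> / S n \<omega>"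
    unfolding rhs[symmetric] step
  proof (intro sum_mono add_left_mono integral_mono i2 i3)
    fix v l \<omega> assume v: "v \<in> ?V" "l \<in> I"
    show "(g \<omega> * (P (m(l := m l - 1)) v \<omega> - P m v \<omega>)) * p \<le> (g \<omega> * (P (m(l := m l - 1)) v \<omega> - P m v \<omega>)) * (W (v l) \<omega> / S n \<omega>)"
    proof (cases "g \<omega> * (P (m(l := m l - 1)) v \<omega> - P m v \<omega>) = 0")
      case False
      then have "p \<le> W (v l) \<omega> / S n \<omega>" using u vl[OF v] diffB[OF _ v(2)] by auto
      then show ?thesis using g0 diff0 by (intro mult_left_mono mult_nonneg_nonneg) auto
    next
      case True
      show ?thesis unfolding True by simp
    qed
  qed auto
qed

text \<open>
  Threshold zero is met by every vertex of the class. These are the boundary values of the recursion; they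
  reduce tuples to shorter ones.
\<close>

lemma tuples_insert_zero:
  assumes "finite I" "l \<notin> I" "m l = 0" "n0 \<le> n"
  shows "tuples B n0 n (insert l I) m \<omega> = (cnt B n \<omega> - cnt B n0 \<omega> - real (card I)) * tuples B n0 n I m \<omega>"
proof -
  have "{1..n} = {1..n0} \<union> {n0<..n}" using assms(4) by auto
  then have "cnt B n \<omega> = cnt B n0 \<omega> + (\<Sum>k\<in>{n0<..n}. indicator B (W k \<omega>))"
    unfolding cnt_def by (simp only:) (rule sum.union_disjoint, auto)
  moreover have "(\<Sum>x\<in>{n0<..n}. hit B n (m l) \<omega> x) = (\<Sum>k\<in>{n0<..n}. indicator B (W k \<omega>))"
    using assms(3) by (simp add: hit_def indicator_def)
  ultimately have "(\<Sum>x\<in>{n0<..n}. hit B n (m l) \<omega> x) = cnt B n \<omega> - cnt B n0 \<omega>" by simp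
  moreover have "distinct_sum {n0<..n} (insert l I) (\<lambda>l x. hit B n (m l) \<omega> x) =
     ((\<Sum>x\<in>{n0<..n}. hit B n (m l) \<omega> x) - real (card I)) * distinct_sum {n0<..n} I (\<lambda>l x. hit B n (m l) \<omega> x)"
    using assms by (intro distinct_sum_insert_dominating) (auto simp: hit_def split: if_splits)
  ultimately show ?thesis unfolding tuples_def by simp
qed

lemma cnt_bounds: "0 \<le> cnt B n \<omega>" "cnt B n \<omega> \<le> real n"
proof -
  show "0 \<le> cnt B n \<omega>" unfolding cnt_def by (intro sum_nonneg) auto
  have "cnt B n \<omega> \<le> (\<Sum>k=1..n. 1)" unfolding cnt_def by (intro sum_mono) (auto simp: indicator_def)
  then show "cnt B n \<omega> \<le> real n" by simp
qed

section \<open>Super- and subsolutions of the recursion\<close>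

lemma good_S:
  assumes "\<omega> \<in> good B n0 \<delta> n" "n0 \<le> n"
  shows "(mw - \<delta>) * real n \<le> S n \<omega>" "S n \<omega> \<le> (mw + \<delta>) * real n"
proof -
  have "\<bar>S n \<omega> - mw * real n\<bar> \<le> \<delta> * real n" using assms by (auto simp: good_def)
  then show "(mw - \<delta>) * real n \<le> S n \<omega>" "S n \<omega> \<le> (mw + \<delta>) * real n" by (auto simp: algebra_simps abs_le_iff)
qed

lemma good_cnt:
  assumes "\<omega> \<in> good B n0 \<delta> n" "n0 \<le> n"
  shows "(measure \<mu> B - \<delta>) * real n \<le> cnt B n \<omega>" "cnt B n \<omega> \<le> (measure \<mu> B + \<delta>) * real n"
proof -
  have "\<bar>cnt B n \<omega> - measure \<mu> B * real n\<bar> \<le> \<delta> * real n" using assms by (auto simp: good_def)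
  then show "(measure \<mu> B - \<delta>) * real n \<le> cnt B n \<omega>" "cnt B n \<omega> \<le> (measure \<mu> B + \<delta>) * real n" 
    by (auto simp: algebra_simps abs_le_iff)
qed

lemma good_indicator_hist: "B \<in> sets borel \<Longrightarrow> (indicator (good B n0 \<delta> n) :: 'a \<Rightarrow> real) \<in> borel_measurable (hist n)"
  by (rule borel_measurable_indicator[OF good_hist])

lemma integrable_good_tuples:
  assumes "B \<in> sets borel" "finite I"
  shows "integrable M (\<lambda>\<omega>. indicator (good B n0 \<delta> n) \<omega> * tuples B n0 n' I m \<omega>)"
proof (rule integrable_bounded_M)
  note assms(1)[measurable]
  show "(\<lambda>\<omega>. indicator (good B n0 \<delta> n) \<omega> * tuples B n0 n' I m \<omega>) \<in> borel_measurable M" by measurable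
  show "\<bar>indicator (good B n0 \<delta> n) \<omega> * tuples B n0 n' I m \<omega>\<bar> \<le> real n' ^ card I" for \<omega>
    using tuples_le[OF assms(2), of B n0 n' m \<omega>] tuples_nonneg[of B n0 n' I m \<omega>] by (auto simp: indicator_def)
qed

lemma tuples_initial: "I \<noteq> {} \<Longrightarrow> tuples B n0 n0 I m \<omega> = 0"
proof -
  assume "I \<noteq> {}"
  then have "inj_maps I {n0<..n0} = {}" by (auto simp: inj_maps_def PiE_eq_empty_iff)
  then show ?thesis by (simp add: tuples_def distinct_sum_def)
qed

definition good_mean :: "real set \<Rightarrow> nat \<Rightarrow> real \<Rightarrow> nat \<Rightarrow> 'i set \<Rightarrow> ('i \<Rightarrow> nat) \<Rightarrow> real" where
  "good_mean B n0 \<delta> n I m = (\<integral>\<omega>. indicator (good B n0 \<delta> n) \<omega> * tuples B n0 n I m \<omega> \<partial>M)"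

lemma good_mean_nonneg: "0 \<le> good_mean B n0 \<delta> n I m"
  unfolding good_mean_def by (intro integral_nonneg_AE) (auto simp: tuples_nonneg)

lemma good_mean_empty: "B \<in> sets borel \<Longrightarrow> good_mean B n0 \<delta> n {} m = prob (good B n0 \<delta> n)"
  by (simp add: good_mean_def tuples_def)

lemma good_mean_initial: "I \<noteq> {} \<Longrightarrow> good_mean B n0 \<delta> n0 I m = 0"
  by (simp add: good_mean_def tuples_initial)

text \<open>
  The free entry ranges over the vertices of the class, and on the good event their number is close to its
  mean. The vertices up to time \<open>n0\<close> and those already in the tuple only matter for the lower bound.
\<close>

lemma good_mean_boundary:
  assumes B: "B \<in> sets borel" and I: "finite I" "l \<in> I" "m l = 0" and n: "n0 \<le> n"
  shows "good_mean B n0 \<delta> n I m \<le> (measure \<mu> B + \<delta>) * real n * good_mean B n0 \<delta> n (I - {l}) m" (is ?upper)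
    and "c \<le> (measure \<mu> B - \<delta>) * real n - real n0 - real (card (I - {l})) \<Longrightarrow>
      c * good_mean B n0 \<delta> n (I - {l}) m \<le> good_mean B n0 \<delta> n I m"
proof -
  define I' where "I' = I - {l}"
  have I': "insert l I' = I" "l \<notin> I'" "finite I'" using I by (auto simp: I'_def)
  define a where "a \<omega> = cnt B n \<omega> - cnt B n0 \<omega> - real (card I')" for \<omega>
  have t: "tuples B n0 n I m \<omega> = a \<omega> * tuples B n0 n I' m \<omega>" for \<omega>
    using tuples_insert_zero[where m=m, OF I'(3,2) I(3) n] I' by (simp add: a_def)
  have int: "integrable M (\<lambda>\<omega>. c' * (indicator (good B n0 \<delta> n) \<omega> * tuples B n0 n I' m \<omega>))"
    "integrable M (\<lambda>\<omega>. indicator (good B n0 \<delta> n) \<omega> * tuples B n0 n I m \<omega>)" for c'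
    by (intro integrable_mult_right integrable_good_tuples[OF B] I' I)+
  have scale: "c' * good_mean B n0 \<delta> n I' m = (\<integral>\<omega>. c' * (indicator (good B n0 \<delta> n) \<omega> * tuples B n0 n I' m \<omega>) \<partial>M)" for c'
    by (simp add: good_mean_def)
  have "good_mean B n0 \<delta> n I m \<le> (measure \<mu> B + \<delta>) * real n * good_mean B n0 \<delta> n I' m"
    unfolding scale unfolding good_mean_def
  proof (rule integral_mono[OF int(2,1)])
    fix \<omega>
    show "indicator (good B n0 \<delta> n) \<omega> * tuples B n0 n I m \<omega>
        \<le> (measure \<mu> B + \<delta>) * real n * (indicator (good B n0 \<delta> n) \<omega> * tuples B n0 n I' m \<omega>)"
    proof (cases "\<omega> \<in> good B n0 \<delta> n")
      case True
      have "a \<omega> \<le> (measure \<mu> B + \<delta>) * real n"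
        using good_cnt(2)[OF True n] cnt_bounds(1)[of B n0 \<omega>] unfolding a_def by linarith
      then show ?thesis using True tuples_nonneg[of B n0 n I' m \<omega>] by (simp add: t mult_right_mono)
    qed simp
  qed
  then show ?upper by (simp add: I'_def)
  assume c: "c \<le> (measure \<mu> B - \<delta>) * real n - real n0 - real (card (I - {l}))"
  have "c * good_mean B n0 \<delta> n I' m \<le> good_mean B n0 \<delta> n I m"
    unfolding scale unfolding good_mean_def
  proof (rule integral_mono[OF int(1,2)])
    fix \<omega>
    show "c * (indicator (good B n0 \<delta> n) \<omega> * tuples B n0 n I' m \<omega>) \<le> indicator (good B n0 \<delta> n) \<omega> * tuples B n0 n I m \<omega>"
    proof (cases "\<omega> \<in> good B n0 \<delta> n")
      case True
      have "c \<le> a \<omega>"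
        using good_cnt(1)[OF True n] cnt_bounds(2)[of B n0 \<omega>] c unfolding a_def I'_def by linarith
      then show ?thesis using True tuples_nonneg[of B n0 n I' m \<omega>] by (simp add: t mult_right_mono)
    qed simp
  qed
  then show "c * good_mean B n0 \<delta> n (I - {l}) m \<le> good_mean B n0 \<delta> n I m" by (simp add: I'_def)
qed

lemma good_mean_step_upper:
  fixes I :: "'i set" and m :: "'i \<Rightarrow> nat" and p :: real
  assumes B: "B \<in> sets borel" "\<And>x. x \<in> B \<Longrightarrow> x \<le> r" and r: "0 < r" and \<delta>: "\<delta> < mw"
    and I: "finite I" "I \<noteq> {}" and n: "n0 \<le> n" "1 \<le> n" and m: "\<And>l. l \<in> I \<Longrightarrow> 1 \<le> m l"
  defines "p \<equiv> r / ((mw - \<delta>) * real n)"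
  shows "good_mean B n0 \<delta> (Suc n) I m \<le>
    (1 - card I * p) * good_mean B n0 \<delta> n I m + p * (\<Sum>l\<in>I. good_mean B n0 \<delta> n I (m(l := m l - 1)))"
proof -
  have "good_mean B n0 \<delta> (Suc n) I m \<le> (\<integral>\<omega>. indicator (good B n0 \<delta> n) \<omega> * tuples B n0 (Suc n) I m \<omega> \<partial>M)"
    unfolding good_mean_def
  proof (intro integral_mono integrable_good_tuples B I)
    show "indicator (good B n0 \<delta> (Suc n)) \<omega> * tuples B n0 (Suc n) I m \<omega> \<le> indicator (good B n0 \<delta> n) \<omega> * tuples B n0 (Suc n) I m \<omega>" for \<omega>
      using good_antimono[of n "Suc n" B n0 \<delta>] tuples_nonneg[of B n0 "Suc n" I m \<omega>] by (auto simp: indicator_def)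
  qed
  also have "\<dots> \<le> (1 - card I * p) * good_mean B n0 \<delta> n I m + p * (\<Sum>l\<in>I. good_mean B n0 \<delta> n I (m(l := m l - 1)))"
    unfolding good_mean_def
  proof (rule tuples_step_compare(1)[where K=1, OF n(2) I m B(1) good_indicator_hist[OF B(1)]])
    fix \<omega> x assume "indicator (good B n0 \<delta> n) \<omega> \<noteq> (0::real)" "x \<in> {n0<..n}" "W x \<omega> \<in> B"
    then have "\<omega> \<in> good B n0 \<delta> n" and w: "W x \<omega> \<le> r" using B(2) by (auto simp: indicator_def split: if_splits)
    then have s: "(mw - \<delta>) * real n \<le> S n \<omega>" using good_S(1) n by auto
    have pos: "0 < (mw - \<delta>) * real n" using \<delta> n by simp
    show "W x \<omega> / S n \<omega> \<le> p" unfolding p_def by (rule frac_le[OF less_imp_le[OF r] w pos s])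
  qed (auto simp: indicator_def)
  finally show ?thesis .
qed

text \<open>
  Restricting to the smaller event \<open>good {1} n0 \<delta> (Suc n)\<close> loses at most the largest possible number of
  tuples, times the probability to leave the good event in this step.
\<close>

lemma good_mean_step_lower:
  fixes I :: "'i set" and m :: "'i \<Rightarrow> nat" and p :: real
  assumes \<delta>: "0 < \<delta>" "\<delta> < mw"
    and I: "finite I" "I \<noteq> {}" and n: "n0 \<le> n" "1 \<le> n" "Suc n \<le> N" and m: "\<And>l. l \<in> I \<Longrightarrow> 1 \<le> m l"
  defines "p \<equiv> 1 / ((mw + \<delta>) * real n)"
  shows "(1 - card I * p) * good_mean {1} n0 \<delta> n I m + p * (\<Sum>l\<in>I. good_mean {1} n0 \<delta> n I (m(l := m l - 1)))
    \<le> good_mean {1} n0 \<delta> (Suc n) I m + real N ^ card I * (prob (good {1} n0 \<delta> n) - prob (good {1} n0 \<delta> (Suc n)))"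
proof -
  let ?g = "\<lambda>n \<omega>. indicator (good {1} n0 \<delta> n) \<omega> :: real" and ?t = "tuples {1} n0 (Suc n) I m"
  have it: "integrable M (\<lambda>\<omega>. ?g k \<omega> * ?t \<omega>)" for k by (rule integrable_good_tuples[OF _ I(1)]) simp
  have ig: "integrable M (?g k)" for k by (rule integrable_real_indicator) (auto simp: less_top[symmetric])
  have "(1 - card I * p) * good_mean {1} n0 \<delta> n I m + p * (\<Sum>l\<in>I. good_mean {1} n0 \<delta> n I (m(l := m l - 1)))
      \<le> (\<integral>\<omega>. ?g n \<omega> * ?t \<omega> \<partial>M)"
    unfolding good_mean_def
  proof (rule tuples_step_compare(2)[where K=1, OF n(2) I m _ good_indicator_hist])
    fix \<omega> x assume "?g n \<omega> \<noteq> 0" "x \<in> {n0<..n}" "W x \<omega> \<in> {1}"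
    then have "\<omega> \<in> good {1} n0 \<delta> n" and w: "W x \<omega> = 1" by (auto simp: indicator_def split: if_splits)
    then have s: "(mw - \<delta>) * real n \<le> S n \<omega>" "S n \<omega> \<le> (mw + \<delta>) * real n" using good_S n by auto
    have "0 < (mw - \<delta>) * real n" using \<delta> n by (intro mult_pos_pos) auto
    then have "0 < S n \<omega>" using s by linarith
    then show "p \<le> W x \<omega> / S n \<omega>" unfolding p_def w by (intro frac_le s) auto
  qed (auto simp: indicator_def)
  also have "\<dots> \<le> (\<integral>\<omega>. ?g (Suc n) \<omega> * ?t \<omega> + real N ^ card I * (?g n \<omega> - ?g (Suc n) \<omega>) \<partial>M)"
  proof (rule integral_mono)
    show "integrable M (\<lambda>\<omega>. ?g (Suc n) \<omega> * ?t \<omega> + real N ^ card I * (?g n \<omega> - ?g (Suc n) \<omega>))"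
      by (intro Bochner_Integration.integrable_add integrable_mult_right Bochner_Integration.integrable_diff it ig)
    fix \<omega>
    have "?t \<omega> \<le> real (Suc n) ^ card I" by (rule tuples_le[OF I(1)])
    also have "\<dots> \<le> real N ^ card I" using n by (intro power_mono) auto
    finally show "?g n \<omega> * ?t \<omega> \<le> ?g (Suc n) \<omega> * ?t \<omega> + real N ^ card I * (?g n \<omega> - ?g (Suc n) \<omega>)"
      using good_antimono[of n "Suc n" "{1}" n0 \<delta>] by (auto simp: indicator_def)
  qed (rule it)
  also have "\<dots> = good_mean {1} n0 \<delta> (Suc n) I m + real N ^ card I * (prob (good {1} n0 \<delta> n) - prob (good {1} n0 \<delta> (Suc n)))"
    unfolding good_mean_def
    by (subst Bochner_Integration.integral_add[OF it integrable_mult_right[OF Bochner_Integration.integrable_diff[OF ig ig]]])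
       (simp add: Bochner_Integration.integral_diff[OF ig ig])
  finally show ?thesis .
qed

text \<open>
  The right-hand side is a supersolution. With \<open>z = r / (r + mw)\<close> and the rate \<open>p = r / ((mw - \<delta>) * n)\<close> of
  the recursion, \<open>p * (1 / z - 1)\<close> equals \<open>\<gamma> / n\<close> for the exponent \<open>\<gamma> = mw / (mw - \<delta>)\<close>, so that
  \<open>powr_step_ge\<close> applies. If some threshold is zero, the bound follows from the one for shorter tuples. The
  factor \<open>n0 / (n0 - 1)\<close> makes up for the shift from \<open>n\<close> to \<open>n - 1\<close>.
\<close>

lemma tuples_upper:
  fixes I :: "'i set"
  assumes B: "B \<in> sets borel" "\<And>x. x \<in> B \<Longrightarrow> x \<le> r" and r: "0 < r" and \<delta>: "0 < \<delta>" "\<delta> < mw"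
    and n0: "2 \<le> n0" and I: "finite I" "real (card I) * r \<le> (mw - \<delta>) * real n0" and n: "n0 \<le> n"
  shows "good_mean B n0 \<delta> n I m \<le>
    ((measure \<mu> B + \<delta>) * (real n0 / (real n0 - 1)) * (real n - 1) powr (mw / (mw - \<delta>))) ^ card I
      * (\<Prod>l\<in>I. (r / (r + mw)) ^ m l)"
proof -
  define z where "z = r / (r + mw)"
  define g where "g = mw / (mw - \<delta>)"
  define C where "C = (measure \<mu> B + \<delta>) * (real n0 / (real n0 - 1))"
  define X where "X n = C * (real n - 1) powr g" for n :: nat
  define F where "F n I m = good_mean B n0 \<delta> n I m" for n and I :: "'i set" and m
  have z: "0 < z" using r mw_bounds by (simp add: z_def)
  have g1: "1 \<le> g" using \<delta> mw_bounds by (simp add: g_def)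
  have C0: "0 \<le> C" using n0 \<delta> by (simp add: C_def)
  have X0: "0 \<le> X n" for n using C0 by (simp add: X_def)
  have Xge: "(measure \<mu> B + \<delta>) * real n \<le> X n" if "n0 \<le> n" for n
  proof -
    have n1: "1 \<le> real n - 1" "1 \<le> real n0 - 1" "real n0 \<le> real n" using n0 that by auto
    then have "real n \<le> real n0 / (real n0 - 1) * (real n - 1)" by (simp add: field_simps)
    also have "\<dots> \<le> real n0 / (real n0 - 1) * (real n - 1) powr g"
      using n1 g1 powr_mono[of 1 g "real n - 1"] by (intro mult_left_mono) auto
    finally show ?thesis using \<delta> unfolding X_def C_def mult.assoc by (intro mult_left_mono) auto
  qed
  have "F n I m \<le> X n ^ card I * (\<Prod>l\<in>I. z ^ m l)" if "n0 \<le> n" for n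
    using I that
  proof (induction I arbitrary: m n rule: finite_psubset_induct)
    case (psubset I)
    show ?case
    proof (cases "I = {}")
      case True
      then show ?thesis using B by (simp add: F_def good_mean_empty)
    next
      case ne: False
      have boundary: "F n I m \<le> X n ^ card I * (\<Prod>l\<in>I. z ^ m l)" if nn: "n0 \<le> n" and l: "l \<in> I" "m l = 0" for n m l
      proof -
        define I' where "I' = I - {l}"
        have I': "insert l I' = I" "l \<notin> I'" "finite I'" "I' \<subset> I" "card I = Suc (card I')"
          using l psubset.hyps card_Suc_Diff1[OF psubset.hyps(1) l(1)] unfolding I'_def by (auto simp del: card_Diff_singleton)
        have card': "real (card I') * r \<le> (mw - \<delta>) * real n0"
          using psubset.prems(1) I'(5) r by (simp add: algebra_simps)
        have "F n I m \<le> ((measure \<mu> B + \<delta>) * real n) * F n I' m"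
          unfolding F_def I'_def by (rule good_mean_boundary(1)[where m=m, OF B(1) psubset.hyps(1) l nn])
        also have "\<dots> \<le> X n * F n I' m"
          by (intro mult_right_mono Xge nn) (simp add: F_def good_mean_nonneg)
        also have "\<dots> \<le> X n * (X n ^ card I' * (\<Prod>i\<in>I'. z ^ m i))"
          by (intro mult_left_mono psubset.IH[OF I'(4) card' nn] X0)
        also have "\<dots> = X n ^ card I * (\<Prod>i\<in>I. z ^ m i)"
        proof -
          have "(\<Prod>i\<in>I. z ^ m i) = (\<Prod>i\<in>I'. z ^ m i)" using I' l by (metis (no_types, lifting) mult.left_neutral power_0 prod.insert)
          then show ?thesis using I'(5) by simp
        qed
        finally show ?thesis .
      qed
      show ?thesis using psubset.prems(2)
      proof (induction n arbitrary: m rule: dec_induct)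
        case base
        have "F n0 I m = 0" by (simp add: F_def good_mean_initial[OF ne])
        then show ?case using X0 z by (auto intro!: mult_nonneg_nonneg prod_nonneg)
      next
        case (step n)
        show ?case
        proof (cases "\<exists>l\<in>I. m l = 0")
          case True
          then show ?thesis using boundary[of "Suc n"] step.hyps by auto
        next
          case False
          then have m1: "1 \<le> m l" if "l \<in> I" for l using that by (metis One_nat_def Suc_leI neq0_conv)
          define p where "p = r / ((mw - \<delta>) * real n)"
          have npos: "0 < real n" "n0 \<le> n" "1 \<le> n" "1 < real n" using n0 step.hyps by auto
          have p0: "0 \<le> p" using r \<delta> npos by (simp add: p_def)
          have kp: "real (card I) * p \<le> 1"
          proof -
            have "real (card I) * r \<le> (mw - \<delta>) * real n0" by (rule psubset.prems(1))
            also have "\<dots> \<le> (mw - \<delta>) * real n" using \<delta> npos by simp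
            finally show ?thesis using \<delta> npos by (simp add: p_def field_simps)
          qed
          define K where "K = X n ^ card I * (\<Prod>l\<in>I. z ^ m l)"
          have K0: "0 \<le> K" unfolding K_def using X0 z by (auto intro!: mult_nonneg_nonneg prod_nonneg)
          have "F (Suc n) I m \<le> (1 - card I * p) * F n I m + p * (\<Sum>l\<in>I. F n I (m(l := m l - 1)))"
            unfolding F_def p_def by (rule good_mean_step_upper[OF B r \<delta>(2) psubset.hyps(1) ne npos(2,3) m1])
          also have "\<dots> \<le> (1 - card I * p) * K + p * (\<Sum>l\<in>I. K / z)"
          proof (intro add_mono mult_left_mono sum_mono)
            show "F n I m \<le> K" unfolding K_def by (rule step.IH)
            fix l assume l: "l \<in> I"
            have "F n I (m(l := m l - 1)) \<le> X n ^ card I * (\<Prod>i\<in>I. z ^ ((m(l := m l - 1)) i))" by (rule step.IH)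
            also have "(\<Prod>i\<in>I. z ^ ((m(l := m l - 1)) i)) = (\<Prod>i\<in>I. z ^ m i) / z"
              using prod_decrement[where m=m, OF psubset.hyps(1) l m1[OF l], of z] z by (simp add: eq_divide_eq mult.commute)
            finally show "F n I (m(l := m l - 1)) \<le> K / z" unfolding K_def by (simp only: times_divide_eq_right)
          qed (use kp p0 in auto)
          also have "\<dots> = K * (1 + g * card I / real n)"
          proof -
            have "p * (1 / z - 1) = g / real n"
              using r \<delta> mw_bounds npos by (simp add: p_def z_def g_def field_simps)
            moreover have "(1 - card I * p) * K + p * (\<Sum>l\<in>I. K / z) = K * (1 + card I * (p * (1 / z - 1)))"
              by (simp add: algebra_simps)
            ultimately show ?thesis by (simp add: mult.commute)
          qed
          also have "\<dots> \<le> X (Suc n) ^ card I * (\<Prod>l\<in>I. z ^ m l)"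
          proof -
            have "(real n - 1) powr (g * card I) * (1 + g * card I / real n) \<le> real n powr (g * card I)"
              by (rule powr_step_ge) (use npos g1 in auto)
            then have "((real n - 1) powr g) ^ card I * (1 + g * card I / real n) \<le> (real n powr g) ^ card I"
              using npos by (simp add: powr_realpow[symmetric] powr_powr)
            then have "C ^ card I * (((real n - 1) powr g) ^ card I * (1 + g * card I / real n)) * (\<Prod>l\<in>I. z ^ m l) \<le> 
               C ^ card I * (real n powr g) ^ card I * (\<Prod>l\<in>I. z ^ m l)"
              using C0 z by (intro mult_right_mono mult_left_mono) (auto intro!: prod_nonneg)
            then show ?thesis by (simp add: K_def X_def power_mult_distrib mult_ac)
          qed
          finally show ?thesis .
        qed
      qed
    qed
  qed
  from this[OF n] show ?thesis by (simp add: F_def X_def C_def g_def z_def)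
qed

text \<open>
  The left-hand side is a subsolution. The first term alone satisfies the recursion and has nearly the right
  boundary values, but it is positive at time \<open>n0\<close>, when there is no tuple yet. The second term corrects
  this. In its summand \<open>l\<close> the \<open>l\<close>-th entry has the tail \<open>u ^ (- m l)\<close> instead of \<open>\<theta> ^ (- m l)\<close>; then the
  growth in \<open>n\<close> is slower, with the exponent \<open>k - 1 + \<alpha>\<close> instead of \<open>k\<close>, where \<open>\<alpha> < 1\<close>. Outside
  the good event the number of tuples is replaced by the upper bound \<open>N ^ k\<close>, which absorbs the
  loss in \<open>good_mean_step_lower\<close>.
\<close>

lemma tuples_lower:
  fixes I :: "'i set" and b n0 N :: nat and u \<delta> :: real
  defines "y \<equiv> \<theta> / u" and "\<alpha> \<equiv> (u - 1) / mw"
  assumes \<delta>: "0 < \<delta>" "\<delta> < q" and u: "1 < u" "u < \<theta>"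
    and n0: "b + 2 \<le> n0" and I: "finite I" "card I \<le> b" "real (card I) \<le> (mw + \<delta>) * real n0"
    and n: "n0 \<le> n" "n \<le> N"
  shows "((q - \<delta>) * (real n + real b) powr (mw / (mw + \<delta>))) ^ card I * (\<Prod>l\<in>I. (1 / \<theta>) ^ m l)
      - 2 ^ card I * (2 * real b + real n0) * (real n - 1) powr (real (card I) - 1 + \<alpha>)
          * (\<Prod>l\<in>I. (1 / \<theta>) ^ m l) * (\<Sum>l\<in>I. y ^ m l)
    \<le> good_mean {1} n0 \<delta> n I m + real N ^ card I * (1 - prob (good {1} n0 \<delta> n))"
proof -
  define z where "z = 1 / \<theta>"
  define g where "g = mw / (mw + \<delta>)"
  define C where "C = q - \<delta>"
  \<comment> \<open>At a zero threshold, \<open>2 * b + n0\<close> bounds the candidates that the main term counts in excess; the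
    factor 2 per entry leaves room for the error term of the shorter tuples.\<close>
  define D where "D k = 2 ^ k * (2 * real b + real n0)" for k
  define X where "X n = C * (real n + real b) powr g" for n :: nat
  define P where "P I m = (\<Prod>l\<in>I. z ^ m l)" for I :: "'i set" and m :: "'i \<Rightarrow> nat"
  define Main where "Main n I m = X n ^ card I * P I m" for n and I :: "'i set" and m
  define Y where "Y k n = (real n - 1) powr (real k - 1 + \<alpha>)" for k n
  define Err where "Err n I m = D (card I) * Y (card I) n * P I m * (\<Sum>l\<in>I. y ^ m l)" for n and I :: "'i set" and m
  define F where "F n I m = good_mean {1} n0 \<delta> n I m" for n and I :: "'i set" and m
  \<comment> \<open>With the penalty for leaving the good event, \<open>U\<close> satisfies the recursion inequality without loss.\<close>
  define U where "U n I m = F n I m + real N ^ card I * (1 - prob (good {1} n0 \<delta> n))" for n and I :: "'i set" and m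
  have th: "\<theta> = 1 + mw" "1 < \<theta>" using mw_bounds by (auto simp: theta_eq)
  have z: "0 < z" "1 / z = \<theta>" using th by (auto simp: z_def)
  have y: "1 < y" "\<theta> / y = u" using u th by (auto simp: y_def)
  have \<alpha>: "0 < \<alpha>" using u mw_bounds by (simp add: \<alpha>_def)
  have g: "0 < g" "g \<le> 1" using \<delta> mw_bounds by (auto simp: g_def)
  have C: "0 < C" "C \<le> 1" using \<delta> q_le_1 unfolding C_def by linarith+
  have X0: "0 \<le> X n" for n using C by (simp add: X_def)
  have Xle: "X n \<le> real n + real b" if "n0 \<le> n" for n
  proof -
    have "1 \<le> real n + real b" using n0 that by auto
    then have "(real n + real b) powr g \<le> real n + real b" using g powr_mono[of g 1 "real n + real b"] by auto
    then have "C * (real n + real b) powr g \<le> 1 * (real n + real b)" using C by (intro mult_mono) auto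
    then show ?thesis by (simp add: X_def)
  qed
  have P0: "0 \<le> P I m" for I m unfolding P_def using z by (intro prod_nonneg) auto
  have D0: "0 \<le> D k" for k by (simp add: D_def)
  have Y0: "0 \<le> Y k n" for k n by (simp add: Y_def)
  have XY: "X n ^ k \<le> 2 ^ k * Y (Suc k) n" if "n0 \<le> n" for n k
  proof -
    have n1: "1 \<le> real n - 1" "real n + real b \<le> 2 * (real n - 1)" using n0 that by auto
    have "X n ^ k \<le> (2 * (real n - 1)) ^ k"
      using X0 Xle[OF that] n1 by (intro power_mono) auto
    also have "\<dots> = 2 ^ k * (real n - 1) powr real k"
      using n1 powr_realpow[of "real n - 1" k] unfolding power_mult_distrib by auto
    also have "\<dots> \<le> 2 ^ k * (real n - 1) powr (real (Suc k) - 1 + \<alpha>)"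
      using n1 \<alpha> by (intro mult_left_mono powr_mono) auto
    finally show ?thesis by (simp add: Y_def)
  qed
  have F0: "0 \<le> F n I m" for n I m
    unfolding F_def by (rule good_mean_nonneg)
  have U0: "0 \<le> U n I m" for n I m
    unfolding U_def using F0 prob_le_1 by (intro add_nonneg_nonneg mult_nonneg_nonneg) auto
  have "Main n I m - Err n I m \<le> U n I m" if "n0 \<le> n" "n \<le> N" for n
    using I that
  proof (induction I arbitrary: m n rule: finite_psubset_induct)
    case (psubset I)
    show ?case
    proof (cases "I = {}")
      case True
      have "F n {} m = prob (good {1} n0 \<delta> n)" by (simp add: F_def good_mean_empty)
      then show ?thesis using True by (simp add: Main_def Err_def U_def P_def)
    next
      case ne: False
      then have k1: "1 \<le> card I" using psubset.hyps by (simp add: Suc_le_eq card_gt_0_iff)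
      have boundary: "Main n I m - Err n I m \<le> U n I m" if nn: "n0 \<le> n" "n \<le> N" and l: "l \<in> I" "m l = 0" for n m l
      proof -
        define I' where "I' = I - {l}"
        have I': "insert l I' = I" "l \<notin> I'" "finite I'" "I' \<subset> I" "card I = Suc (card I')"
          using l psubset.hyps card_Suc_Diff1[OF psubset.hyps(1) l(1)] unfolding I'_def by (auto simp del: card_Diff_singleton)
        have card': "card I' \<le> b" "real (card I') \<le> (mw + \<delta>) * real n0"
          using psubset.prems(1,2) I'(5) by auto
        define c where "c = C * real n - real n0 - real b"
        have cn: "c \<le> real n" using C mult_right_mono[of C 1 "real n"] by (simp add: c_def)
        have n1: "1 \<le> real n - 1" "real n \<le> 2 * (real n - 1)" using n0 nn by auto
        have PI: "P I m = P I' m" using I' l unfolding P_def by (metis (no_types, lifting) mult.left_neutral power_0 prod.insert)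
        have MI: "Main n I m = X n * Main n I' m" by (simp add: Main_def I'(5) PI)
        have M'0: "0 \<le> Main n I' m" using X0 P0 by (simp add: Main_def)
        have sI: "(\<Sum>l\<in>I. y ^ m l) = 1 + (\<Sum>l\<in>I'. y ^ m l)" using I' l by (metis power_0 sum.insert)
        have s0: "0 \<le> (\<Sum>l\<in>I'. y ^ m l)" using y by (intro sum_nonneg) auto
        have E'0: "0 \<le> Err n I' m" unfolding Err_def by (intro mult_nonneg_nonneg D0 Y0 P0 s0)
        have Uc: "c * U n I' m \<le> U n I m"
        proof -
          have "c * F n I' m \<le> F n I m"
            unfolding F_def I'_def
            by (rule good_mean_boundary(2)[where m=m, OF _ psubset.hyps(1) l nn(1)])
              (use card' in \<open>simp_all add: c_def C_def I'_def\<close>)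
          moreover have "c * (real N ^ card I' * (1 - prob (good {1} n0 \<delta> n))) \<le> real N * (real N ^ card I' * (1 - prob (good {1} n0 \<delta> n)))"
            using cn nn by (intro mult_right_mono) auto
          ultimately show ?thesis by (simp add: U_def I'(5) distrib_left mult.assoc)
        qed
        have e1: "Main n I m \<le> c * Main n I' m + (2 * real b + real n0) * Main n I' m"
        proof -
          have "X n \<le> C * (real n + real b)"
          proof -
            have "1 \<le> real n + real b" using n0 nn by auto
            then have "(real n + real b) powr g \<le> real n + real b" using g powr_mono[of g 1 "real n + real b"] by auto
            then show ?thesis using C by (simp add: X_def)
          qed
          also have "\<dots> \<le> c + (2 * real b + real n0)" using C mult_right_mono[of C 1 "real b"] by (simp add: c_def algebra_simps)
          finally show ?thesis unfolding MI using mult_right_mono[OF _ M'0] by (simp add: distrib_right[symmetric])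
        qed
        have e2: "(2 * real b + real n0) * Main n I' m \<le> D (card I) * Y (card I) n * P I m"
        proof -
          have "(2 * real b + real n0) * Main n I' m \<le> (2 * real b + real n0) * ((2 ^ card I' * Y (card I) n) * P I' m)"
            unfolding Main_def I'(5) by (intro mult_left_mono mult_right_mono XY nn P0) auto
          also have "\<dots> \<le> (2 * real b + real n0) * ((2 ^ card I * Y (card I) n) * P I' m)"
            unfolding I'(5) by (intro mult_left_mono mult_right_mono Y0 P0) auto
          finally show ?thesis by (simp add: D_def PI mult_ac)
        qed
        have e3: "max c 0 * Err n I' m \<le> D (card I) * Y (card I) n * P I m * (\<Sum>l\<in>I'. y ^ m l)"
        proof -
          have y1: "Y (card I) n = (real n - 1) * Y (card I') n"
          proof -
            have "Y (card I) n = (real n - 1) powr (1 + (real (card I') - 1 + \<alpha>))" by (simp add: Y_def I'(5))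
            also have "\<dots> = (real n - 1) * Y (card I') n" using n1 by (subst powr_add) (simp add: Y_def)
            finally show ?thesis .
          qed
          have y0: "max c 0 * (D (card I') * Y (card I') n * P I' m * (\<Sum>l\<in>I'. y ^ m l)) \<le>
            (2 * (real n - 1)) * (D (card I') * Y (card I') n * P I' m * (\<Sum>l\<in>I'. y ^ m l))"
            using cn n1 by (intro mult_right_mono mult_nonneg_nonneg D0 Y0 P0 s0) auto
          have y2: "D (card I) = 2 * D (card I')" by (simp add: D_def I'(5))
          show ?thesis using y0 unfolding y1 y2 Err_def PI by (simp only: mult_ac)
        qed
        have ErrI: "Err n I m = D (card I) * Y (card I) n * P I m + D (card I) * Y (card I) n * P I m * (\<Sum>l\<in>I'. y ^ m l)"
          by (simp add: Err_def sI distrib_left)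
        show ?thesis
        proof (cases "0 \<le> c")
          case True
          have "c * (Main n I' m - Err n I' m) \<le> c * U n I' m"
            by (intro mult_left_mono psubset.IH[OF I'(4) card' nn] True)
          then show ?thesis using Uc e1 e2 e3 True ErrI by (simp add: right_diff_distrib)
        next
          case False
          then have "c * Main n I' m \<le> 0" using M'0 by (simp add: mult_nonpos_nonneg)
          moreover have "0 \<le> D (card I) * Y (card I) n * P I m * (\<Sum>l\<in>I'. y ^ m l)" by (intro mult_nonneg_nonneg D0 Y0 P0 s0)
          ultimately show ?thesis using e1 e2 ErrI U0[of n I m] by linarith
        qed
      qed
      show ?thesis using psubset.prems(3,4)
      proof (induction n arbitrary: m rule: dec_induct)
        case base
        have "Main n0 I m \<le> Err n0 I m"
        proof -
          obtain l where l: "l \<in> I" using ne by blast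
          obtain k where k: "card I = Suc k" using k1 by (cases "card I") auto
          have "1 \<le> y ^ m l" using y by simp
          also have "\<dots> \<le> (\<Sum>l\<in>I. y ^ m l)" using l psubset.hyps y by (intro member_le_sum) auto
          finally have s1: "1 \<le> (\<Sum>l\<in>I. y ^ m l)" .
          have "X n0 \<le> 2 * (2 * real b + real n0)" using Xle[of n0] by simp
          then have "X n0 * X n0 ^ k \<le> 2 * (2 * real b + real n0) * (2 ^ k * Y (Suc k) n0)"
            using X0 XY[of n0 k] by (intro mult_mono) auto
          then have "X n0 ^ card I * P I m \<le> D (card I) * Y (card I) n0 * P I m"
            unfolding k D_def power_Suc by (intro mult_right_mono P0) (simp only: mult_ac)
          also have "\<dots> \<le> D (card I) * Y (card I) n0 * P I m * (\<Sum>l\<in>I. y ^ m l)"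
            using mult_left_mono[OF s1, of "D (card I) * Y (card I) n0 * P I m"] D0 Y0 P0 by simp
          finally show ?thesis by (simp add: Main_def Err_def)
        qed
        then show ?case using U0[of n0 I m] by linarith
      next
        case (step n)
        show ?case
        proof (cases "\<exists>l\<in>I. m l = 0")
          case True
          then show ?thesis using boundary[of "Suc n"] step.hyps step.prems by auto
        next
          case False
          then have m1: "1 \<le> m l" if "l \<in> I" for l using that by (metis One_nat_def Suc_leI neq0_conv)
          define p where "p = 1 / ((mw + \<delta>) * real n)"
          have npos: "0 < real n" "n0 \<le> n" "1 \<le> n" "1 < real n" "n \<le> N" using n0 step by auto
          have p0: "0 \<le> p" using \<delta> npos mw_bounds by (simp add: p_def)
          have kp: "real (card I) * p \<le> 1"
          proof -
            have "real (card I) \<le> (mw + \<delta>) * real n0" by (rule psubset.prems(2))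
            also have "\<dots> \<le> (mw + \<delta>) * real n" using \<delta> npos mw_bounds by simp
            finally show ?thesis using \<delta> npos mw_bounds by (simp add: p_def)
          qed
          have step': "(1 - card I * p) * F n I m + p * (\<Sum>l\<in>I. F n I (m(l := m l - 1)))
             \<le> F (Suc n) I m + real N ^ card I * (prob (good {1} n0 \<delta> n) - prob (good {1} n0 \<delta> (Suc n)))"
            unfolding F_def p_def
            by (rule good_mean_step_lower[OF \<delta>(1) _ psubset.hyps(1) ne npos(2,3) step.prems m1])
              (use \<delta> mw_bounds in linarith)
          have rec: "(1 - card I * p) * U n I m + p * (\<Sum>l\<in>I. U n I (m(l := m l - 1))) \<le> U (Suc n) I m"
          proof -
            define A where "A = real N ^ card I * (1 - prob (good {1} n0 \<delta> n))"
            have UA: "U n I m' = F n I m' + A" for m' by (simp add: U_def A_def)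
            have "(1 - card I * p) * U n I m + p * (\<Sum>l\<in>I. U n I (m(l := m l - 1))) =
               (1 - card I * p) * F n I m + p * (\<Sum>l\<in>I. F n I (m(l := m l - 1))) + A"
              unfolding UA sum.distrib by (simp add: algebra_simps)
            also have "\<dots> \<le> F (Suc n) I m + real N ^ card I * (prob (good {1} n0 \<delta> n) - prob (good {1} n0 \<delta> (Suc n))) + A"
              using step' by (rule add_right_mono)
            also have "\<dots> = U (Suc n) I m" by (simp add: U_def A_def algebra_simps)
            finally show ?thesis .
          qed
          define s where "s = (\<Sum>i\<in>I. y ^ m i)"
          have dec: "P I (m(l := m l - 1)) = \<theta> * P I m" if l: "l \<in> I" for l
            using prod_decrement[where m=m, OF psubset.hyps(1) l m1[OF l], of z] z th by (simp add: P_def z_def field_simps)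
          have decs: "(\<Sum>i\<in>I. y ^ ((m(l := m l - 1)) i)) = s - y ^ m l + y ^ m l / y" if l: "l \<in> I" for l
          proof -
            have "s = y ^ m l + (\<Sum>i\<in>I - {l}. y ^ m i)" unfolding s_def by (rule sum.remove[OF psubset.hyps(1) l])
            moreover have "(\<Sum>i\<in>I. y ^ ((m(l := m l - 1)) i)) = y ^ (m l - 1) + (\<Sum>i\<in>I - {l}. y ^ m i)"
              using psubset.hyps(1) l by (subst sum.remove[of I l]) (auto intro!: sum.cong)
            moreover have "y ^ (m l - 1) = y ^ m l / y" using y m1[OF l] by (simp add: power_diff)
            ultimately show ?thesis by simp
          qed
          have "(1 - card I * p) * (Main n I m - Err n I m) + p * (\<Sum>l\<in>I. Main n I (m(l := m l - 1)) - Err n I (m(l := m l - 1)))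
             \<le> (1 - card I * p) * U n I m + p * (\<Sum>l\<in>I. U n I (m(l := m l - 1)))"
            by (intro add_mono mult_left_mono sum_mono step.IH npos) (use kp p0 in auto)
          also have "\<dots> \<le> U (Suc n) I m" by (rule rec)
          finally have low: "(1 - card I * p) * (Main n I m - Err n I m) + p * (\<Sum>l\<in>I. Main n I (m(l := m l - 1)) - Err n I (m(l := m l - 1)))
             \<le> U (Suc n) I m" .
          have sM: "(\<Sum>l\<in>I. Main n I (m(l := m l - 1))) = card I * (\<theta> * Main n I m)"
            using dec by (simp add: Main_def mult_ac)
          have sE: "(\<Sum>l\<in>I. Err n I (m(l := m l - 1))) = ((real (card I) - 1) * \<theta> + u) * Err n I m"
          proof -
            define E where "E = D (card I) * Y (card I) n * P I m"
            have "(\<Sum>l\<in>I. Err n I (m(l := m l - 1))) = (\<Sum>l\<in>I. E * \<theta> * (s - y ^ m l + y ^ m l / y))"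
            proof (rule sum.cong[OF refl])
              fix l assume l: "l \<in> I"
              show "Err n I (m(l := m l - 1)) = E * \<theta> * (s - y ^ m l + y ^ m l / y)"
                unfolding Err_def E_def dec[OF l] decs[OF l] by (simp only: mult_ac)
            qed
            also have "\<dots> = E * \<theta> * (\<Sum>l\<in>I. s - y ^ m l + y ^ m l / y)" by (simp add: sum_distrib_left)
            also have "(\<Sum>l\<in>I. s - y ^ m l + y ^ m l / y) = card I * s - s + s / y"
              by (simp add: sum.distrib sum_subtractf s_def sum_divide_distrib)
            also have "E * \<theta> * (card I * s - s + s / y) = ((real (card I) - 1) * \<theta> + \<theta> / y) * (E * s)"
              by (simp add: algebra_simps)
            finally show ?thesis unfolding y(2) E_def s_def Err_def .
          qed
          have pm: "p * mw = g / real n" using \<delta> mw_bounds npos by (simp add: p_def g_def)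
          have M1: "Main (Suc n) I m \<le> Main n I m * (1 + card I * g / real n)"
          proof -
            have "g * real (card I) \<le> 1 * real (card I)" using g by (intro mult_right_mono) auto
            then have gb: "g * real (card I) \<le> real b" using psubset.prems(1) by simp
            have "(real n + 1 + real b) powr (g * card I) \<le> (1 + g * card I / real n) * (real n + real b) powr (g * card I)"
              by (rule powr_step_le) (use npos g gb in auto)
            then have "((real (Suc n) + real b) powr g) ^ card I \<le> (1 + g * card I / real n) * ((real n + real b) powr g) ^ card I"
              using npos by (simp add: powr_realpow[symmetric] powr_powr add_ac)
            then have "C ^ card I * ((real (Suc n) + real b) powr g) ^ card I * P I m \<le> C ^ card I * ((1 + g * card I / real n) * ((real n + real b) powr g) ^ card I) * P I m"
              using C P0 by (intro mult_left_mono mult_right_mono) auto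
            then show ?thesis by (simp add: Main_def X_def power_mult_distrib mult_ac)
          qed
          have E1: "Err n I m * (1 + (real (card I) - 1 + \<alpha>) / real n) \<le> Err (Suc n) I m"
          proof -
            have "Y (card I) n * (1 + (real (card I) - 1 + \<alpha>) / real n) \<le> Y (card I) (Suc n)"
              unfolding Y_def using powr_step_ge[of "real n" "real (card I) - 1 + \<alpha>"] npos \<alpha> k1 by simp
            then have "D (card I) * (Y (card I) n * (1 + (real (card I) - 1 + \<alpha>) / real n)) * P I m * s \<le> D (card I) * Y (card I) (Suc n) * P I m * s"
              using D0 P0 y unfolding s_def by (intro mult_left_mono mult_right_mono sum_nonneg) auto
            then show ?thesis by (simp add: Err_def s_def mult_ac)
          qed
          have Err0: "0 \<le> Err n I m" unfolding Err_def using y by (intro mult_nonneg_nonneg D0 Y0 P0 sum_nonneg) auto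
          have "(1 - card I * p) * (Main n I m - Err n I m) + p * (\<Sum>l\<in>I. Main n I (m(l := m l - 1)) - Err n I (m(l := m l - 1)))
            = Main n I m * (1 + card I * (p * mw)) - Err n I m * (1 + p * mw * (real (card I) - 1 + \<alpha>))"
          proof -
            have um: "u = 1 + mw * \<alpha>" using mw_bounds by (simp add: \<alpha>_def)
            show ?thesis unfolding sum_subtractf sM sE th(1) um by (simp add: algebra_simps)
          qed
          also have "\<dots> \<ge> Main n I m * (1 + card I * g / real n) - Err n I m * (1 + (real (card I) - 1 + \<alpha>) / real n)"
          proof -
            have "p * mw * (real (card I) - 1 + \<alpha>) \<le> (real (card I) - 1 + \<alpha>) / real n"
              unfolding pm using g \<alpha> k1 npos mult_right_mono[of g 1 "real (card I) - 1 + \<alpha>"] by (simp add: divide_right_mono)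
            then have "Err n I m * (1 + p * mw * (real (card I) - 1 + \<alpha>)) \<le> Err n I m * (1 + (real (card I) - 1 + \<alpha>) / real n)"
              using Err0 by (intro mult_left_mono) auto
            then show ?thesis by (simp add: pm)
          qed
          finally have "Main n I m * (1 + card I * g / real n) - Err n I m * (1 + (real (card I) - 1 + \<alpha>) / real n)
             \<le> (1 - card I * p) * (Main n I m - Err n I m) + p * (\<Sum>l\<in>I. Main n I (m(l := m l - 1)) - Err n I (m(l := m l - 1)))" .
          then show ?thesis using low M1 E1 by linarith
        qed
      qed
    qed
  qed
  from this[OF n] show ?thesis
    by (simp add: F_def U_def X_def C_def g_def z_def Main_def Err_def D_def Y_def P_def mult_ac)
qed

section \<open>Concentration of the weights and exponential moments of the degrees\<close>

lemma W_indep: "indep_vars (\<lambda>_. borel) W {1..j}"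
  by (rule indep_vars_subset[OF weights_indep]) auto

lemma expectation_W:
  fixes h :: "real \<Rightarrow> real"
  assumes "h \<in> borel_measurable borel" "1 \<le> k"
  shows "(\<integral>\<omega>. h (W k \<omega>) \<partial>M) = (\<integral>x. h x \<partial>\<mu>)"
  using integral_distr[OF W_measurable[OF assms(2)] assms(1)] weights_law[OF assms(2)] by simp

lemma weight_sum_concentration:
  fixes h :: "real \<Rightarrow> real"
  assumes h: "h \<in> borel_measurable borel" "AE x in \<mu>. h x \<in> {0..1}" and j: "1 \<le> j" and e: "0 \<le> e"
  shows "prob {\<omega> \<in> space M. \<bar>(\<Sum>k=1..j. h (W k \<omega>)) - real j * (\<integral>x. h x \<partial>\<mu>)\<bar> \<ge> e} \<le> 2 * exp (- 2 * e\<^sup>2 / real j)"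
proof -
  interpret H: Hoeffding_ineq M "{1..j}" "\<lambda>k \<omega>. h (W k \<omega>)" "\<lambda>_. 0" "\<lambda>_. 1" "\<Sum>k\<in>{1..j}. expectation (\<lambda>\<omega>. h (W k \<omega>))"
  proof (unfold_locales)
    show "indep_vars (\<lambda>_. borel) (\<lambda>k \<omega>. h (W k \<omega>)) {1..j}"
      by (rule indep_vars_compose2[OF W_indep]) (use h in auto)
    fix k assume k: "k \<in> {1..j}"
    then have k1: "1 \<le> k" by simp
    have "AE x in distr M borel (W k). h x \<in> {0..1}" unfolding weights_law[OF k1] by (rule h(2))
    then show "AE \<omega> in M. h (W k \<omega>) \<in> {0..1}" using k by (intro AE_distrD[OF W_measurable]) auto
  qed auto
  have "(\<Sum>k\<in>{1..j}. expectation (\<lambda>\<omega>. h (W k \<omega>))) = (\<Sum>k\<in>{1..j}. (\<integral>x. h x \<partial>\<mu>))"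
    by (rule sum.cong) (auto intro!: expectation_W h(1))
  also have "\<dots> = real j * (\<integral>x. h x \<partial>\<mu>)" by simp
  finally show ?thesis using H.Hoeffding_ineq_abs_ge[OF e] j by simp
qed

lemma good_complement:
  assumes B: "B \<in> sets borel" and \<delta>: "0 < \<delta>" and n0: "1 \<le> n0"
  shows "prob (space M - good B n0 \<delta> n) \<le> 4 * real n * exp (- 2 * \<delta>\<^sup>2 * real n0)"
proof -
  define E1 where "E1 j = {\<omega> \<in> space M. \<bar>(\<Sum>k=1..j. W k \<omega>) - real j * (\<integral>x. x \<partial>\<mu>)\<bar> \<ge> \<delta> * real j}" for j :: nat
  define E2 where "E2 j = {\<omega> \<in> space M. \<bar>(\<Sum>k=1..j. indicator B (W k \<omega>)) - real j * (\<integral>x. indicator B x \<partial>\<mu>)\<bar> \<ge> \<delta> * real j}" for j :: nat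
  have [measurable]: "W k \<in> borel_measurable M" if "k \<in> {1..j}" for k j using that by auto
  note B[measurable]
  have s: "E1 j \<in> sets M" "E2 j \<in> sets M" for j
  proof -
    have [measurable]: "(\<lambda>\<omega>. \<Sum>k=1..j. W k \<omega>) \<in> borel_measurable M" "(\<lambda>\<omega>. \<Sum>k=1..j. indicator B (W k \<omega>) :: real) \<in> borel_measurable M"
      by measurable
    show "E1 j \<in> sets M" "E2 j \<in> sets M" unfolding E1_def E2_def by measurable
  qed
  have b: "prob (E1 j) \<le> 2 * exp (- 2 * \<delta>\<^sup>2 * real n0)" "prob (E2 j) \<le> 2 * exp (- 2 * \<delta>\<^sup>2 * real n0)" if j: "j \<in> {n0..n}" for j
  proof -
    have j1: "1 \<le> j" "real n0 \<le> real j" using j n0 by auto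
    have e: "2 * exp (- 2 * (\<delta> * real j)\<^sup>2 / real j) \<le> 2 * exp (- 2 * \<delta>\<^sup>2 * real n0)"
      using j1 \<delta> by (simp add: power2_eq_square)
    have ej: "0 \<le> \<delta> * real j" using \<delta> by simp
    have "prob (E1 j) \<le> 2 * exp (- 2 * (\<delta> * real j)\<^sup>2 / real j)" unfolding E1_def
      by (rule weight_sum_concentration[OF _ _ j1(1) ej]) (use weight_unit in auto)
    then show "prob (E1 j) \<le> 2 * exp (- 2 * \<delta>\<^sup>2 * real n0)" using e by linarith
    have "prob (E2 j) \<le> 2 * exp (- 2 * (\<delta> * real j)\<^sup>2 / real j)" unfolding E2_def
      by (rule weight_sum_concentration[OF _ _ j1(1) ej]) (use B in \<open>auto simp: indicator_def\<close>)
    then show "prob (E2 j) \<le> 2 * exp (- 2 * \<delta>\<^sup>2 * real n0)" using e by linarith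
  qed
  have "space M - good B n0 \<delta> n \<subseteq> (\<Union>j\<in>{n0..n}. E1 j \<union> E2 j)"
    unfolding good_def E1_def E2_def S_def cnt_def using B by (auto simp: mult.commute not_le intro: less_imp_le)
  then have "prob (space M - good B n0 \<delta> n) \<le> prob (\<Union>j\<in>{n0..n}. E1 j \<union> E2 j)"
    using s by (intro finite_measure_mono) auto
  also have "\<dots> \<le> (\<Sum>j\<in>{n0..n}. prob (E1 j \<union> E2 j))"
    using s by (intro finite_measure_subadditive_finite) auto
  also have "\<dots> \<le> (\<Sum>j\<in>{n0..n}. 4 * exp (- 2 * \<delta>\<^sup>2 * real n0))"
  proof (rule sum_mono)
    fix j assume j: "j \<in> {n0..n}"
    have "prob (E1 j \<union> E2 j) \<le> prob (E1 j) + prob (E2 j)" using s by (intro measure_Un_le) auto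
    then show "prob (E1 j \<union> E2 j) \<le> 4 * exp (- 2 * \<delta>\<^sup>2 * real n0)" using b[OF j] by linarith
  qed
  also have "\<dots> = real (card {n0..n}) * (4 * exp (- 2 * \<delta>\<^sup>2 * real n0))" by simp
  also have "\<dots> \<le> real n * (4 * exp (- 2 * \<delta>\<^sup>2 * real n0))" using n0 by (intro mult_right_mono) auto
  finally show ?thesis by (simp add: mult_ac)
qed

text \<open>
  As \<open>W > 0\<close>, the expectation of \<open>exp (- t * W)\<close> tends to zero as \<open>t\<close> grows, so Chernoff's bound gives any
  exponential rate \<open>A\<close> at a sufficiently small slope \<open>s\<close>. This is used from times of order \<open>ln N\<close> on,
  where Hoeffding's inequality yields only a small negative power of \<open>N\<close>.
\<close>

lemma weight_sum_small_ball:
  shows "\<exists>s>0. \<forall>j. prob {\<omega> \<in> space M. S j \<omega> < s * real j} \<le> exp (- (A * real j))"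
proof -
  have meas: "(\<lambda>x. exp (- (real i * x))) \<in> borel_measurable \<mu>" for i by simp
  have "(\<lambda>i. \<integral>x. exp (- (real i * x)) \<partial>\<mu>) \<longlonglongrightarrow> (\<integral>x. 0 \<partial>\<mu>)"
  proof (rule integral_dominated_convergence[where w="\<lambda>_. 1"])
    show "AE x in \<mu>. (\<lambda>i. exp (- (real i * x))) \<longlonglongrightarrow> 0"
      using weight_unit
    proof eventually_elim
      case (elim x)
      then have "0 < x" by simp
      then show ?case by real_asymp
    qed
    show "AE x in \<mu>. norm (exp (- (real i * x))) \<le> 1" for i
      using weight_unit by eventually_elim auto
  qed (use meas in auto)
  then have "\<forall>\<^sub>F i in sequentially. (\<integral>x. exp (- (real i * x)) \<partial>\<mu>) < exp (- A - 1)"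
    by (intro order_tendstoD) auto
  then have "\<forall>\<^sub>F i in sequentially. (\<integral>x. exp (- (real i * x)) \<partial>\<mu>) < exp (- A - 1) \<and> 1 \<le> i"
    using eventually_ge_at_top by (rule eventually_conj)
  from eventually_happens'[OF sequentially_bot this]
  obtain i where i: "(\<integral>x. exp (- (real i * x)) \<partial>\<mu>) < exp (- A - 1)" "1 \<le> i" by auto
  let ?c = "\<integral>x. exp (- (real i * x)) \<partial>\<mu>"
  have "prob {\<omega> \<in> space M. S j \<omega> < 1 / real i * real j} \<le> exp (- (A * real j))" for j
  proof -
    have [measurable]: "S j \<in> borel_measurable M" by (rule hist_measurable_M[OF S_hist[OF order_refl]])
    let ?E = "{\<omega> \<in> space M. S j \<omega> < 1 / real i * real j}"
    have ind: "indep_vars (\<lambda>_. borel) (\<lambda>k \<omega>. exp (- (real i * W k \<omega>))) {1..j}"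
      by (rule indep_vars_compose2[OF W_indep, where Y="\<lambda>k x. exp (- (real i * x))"]) auto
    have int: "integrable M (\<lambda>\<omega>. exp (- (real i * W k \<omega>)))" if k: "k \<in> {1..j}" for k
    proof (rule integrable_const_bound[where B=1])
      show "AE \<omega> in M. norm (exp (- (real i * W k \<omega>))) \<le> 1"
        using AE_weights
      proof eventually_elim
        case (elim \<omega>)
        then have "0 < W k \<omega>" using k by auto
        then show ?case by simp
      qed
      have [measurable]: "W k \<in> borel_measurable M" using k by auto
      show "(\<lambda>\<omega>. exp (- (real i * W k \<omega>))) \<in> borel_measurable M" by measurable
    qed
    have prodS: "(\<Prod>k\<in>{1..j}. exp (- (real i * W k \<omega>))) = exp (- (real i * S j \<omega>))" for \<omega>
      by (simp add: exp_sum[symmetric] S_def sum_distrib_left sum_negf)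
    have E: "(\<integral>\<omega>. exp (- (real i * S j \<omega>)) \<partial>M) = ?c ^ j"
    proof -
      have "(\<integral>\<omega>. (\<Prod>k\<in>{1..j}. exp (- (real i * W k \<omega>))) \<partial>M) = (\<Prod>k\<in>{1..j}. \<integral>\<omega>. exp (- (real i * W k \<omega>)) \<partial>M)"
        by (rule indep_vars_lebesgue_integral) (use ind int in auto)
      also have "\<dots> = (\<Prod>k\<in>{1..j}. ?c)" by (intro prod.cong refl expectation_W) auto
      finally show ?thesis unfolding prodS by simp
    qed
    have intS: "integrable M (\<lambda>\<omega>. exp (- (real i * S j \<omega>)))"
      using indep_vars_integrable[OF _ ind int] unfolding prodS by simp
    have "exp (- real j) * prob ?E = (\<integral>\<omega>. exp (- real j) * indicator ?E \<omega> \<partial>M)" by simp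
    also have "\<dots> \<le> (\<integral>\<omega>. exp (- (real i * S j \<omega>)) \<partial>M)"
    proof (rule integral_mono)
      show "integrable M (\<lambda>\<omega>. exp (- real j) * indicator ?E \<omega>)"
        by (intro integrable_mult_right integrable_real_indicator) (auto simp: less_top[symmetric])
      show "exp (- real j) * indicator ?E \<omega> \<le> exp (- (real i * S j \<omega>))" for \<omega>
        using i(2) by (auto simp: indicator_def field_simps)
    qed (rule intS)
    also have "\<dots> = ?c ^ j" by (rule E)
    also have "\<dots> \<le> exp (- A - 1) ^ j" using i by (intro power_mono integral_nonneg_AE) auto
    also have "\<dots> = exp (- real j) * exp (- (A * real j))"
      by (simp add: exp_of_nat_mult[symmetric] exp_add[symmetric] algebra_simps)
    finally show ?thesis by simp
  qed
  then show ?thesis using i(2) by (intro exI[of _ "1 / real i"]) auto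
qed

text \<open>
  Large weight sums keep the degrees small; only lower bounds are required here.
\<close>

definition heavy :: "(nat \<Rightarrow> real) \<Rightarrow> nat \<Rightarrow> nat \<Rightarrow> 'a set" where
  "heavy f t0 n = {\<omega> \<in> space M. \<forall>j\<in>{t0..n}. f j \<le> S j \<omega>}"

lemma heavy_hist: "heavy f t0 n \<in> sets (hist n)"
proof -
  have "{\<omega> \<in> space (hist n). \<forall>j\<in>{t0..n}. f j \<le> S j \<omega>} \<in> sets (hist n)"
  proof (rule sets.sets_Collect_finite_All)
    fix j assume "j \<in> {t0..n}"
    then have [measurable]: "S j \<in> borel_measurable (hist n)" by auto
    show "{\<omega> \<in> space (hist n). f j \<le> S j \<omega>} \<in> sets (hist n)" by measurable
  qed simp
  then show ?thesis unfolding heavy_def space_hist .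
qed

text \<open>
  A step of the tree multiplies the conditional expectation of \<open>u ^ deg\<close> by
  \<open>1 + (u - 1) * W v / S n\<close>, and weights are at most one. At time \<open>t0\<close> the degree is at most \<open>t0\<close>.
\<close>

lemma deg_exponential_moment:
  assumes u: "1 \<le> u" and t0: "1 \<le> t0" and f: "\<And>j. t0 \<le> j \<Longrightarrow> 0 < f j" and n: "t0 \<le> n"
  shows "(\<integral>\<omega>. indicator (heavy f t0 n) \<omega> * u ^ deg n v \<omega> \<partial>M) \<le> u ^ t0 * (\<Prod>j\<in>{t0..<n}. 1 + (u - 1) / f j)"
  using n
proof (induction n rule: dec_induct)
  case base
  have "(\<integral>\<omega>. indicator (heavy f t0 t0) \<omega> * u ^ deg t0 v \<omega> \<partial>M) \<le> (\<integral>\<omega>. u ^ t0 \<partial>M)"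
  proof (rule integral_mono')
    show "indicator (heavy f t0 t0) \<omega> * u ^ deg t0 v \<omega> \<le> u ^ t0" for \<omega>
      using power_increasing[OF deg_le u, of t0 v \<omega>] u by (auto simp: indicator_def)
  qed (use u in auto)
  then show ?case by (simp add: prob_space)
next
  case (step n)
  have n1: "1 \<le> n" using step.hyps t0 by simp
  let ?g = "\<lambda>\<omega>. indicator (heavy f t0 n) \<omega> * u ^ deg n v \<omega> :: real"
  have ghist: "?g \<in> borel_measurable (hist n)"
  proof -
    note heavy_hist[measurable]
    show ?thesis by measurable
  qed
  have gb: "\<bar>?g \<omega>\<bar> \<le> u ^ n" for \<omega>
    using power_increasing[OF deg_le u, of n v \<omega>] u by (auto simp: indicator_def)
  have g0: "0 \<le> ?g \<omega>" for \<omega> using u by auto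
  have [measurable]: "?g \<in> borel_measurable M" by (rule hist_measurable_M[OF ghist])
  have [measurable]: "J (Suc n) \<in> measurable M (count_space UNIV)" using n1 by (intro J_measurable) auto
  have gi: "integrable M ?g" by (rule integrable_bounded_M[OF _ gb]) measurable
  have gJ: "integrable M (\<lambda>\<omega>. ?g \<omega> * of_bool (J (Suc n) \<omega> = v))"
  proof (rule integrable_bounded_M)
    show "(\<lambda>\<omega>. ?g \<omega> * of_bool (J (Suc n) \<omega> = v)) \<in> borel_measurable M" by measurable
    show "\<bar>?g \<omega> * of_bool (J (Suc n) \<omega> = v)\<bar> \<le> u ^ n" for \<omega> using gb[of \<omega>] u by (auto simp: of_bool_def)
  qed
  have fn: "0 < f n" using f step.hyps by simp
  have att: "(\<integral>\<omega>. ?g \<omega> * of_bool (J (Suc n) \<omega> = v) \<partial>M) \<le> (\<integral>\<omega>. ?g \<omega> \<partial>M) / f n"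
  proof (cases "v \<in> {1..n}")
    case True
    have "(\<integral>\<omega>. ?g \<omega> * of_bool (J (Suc n) \<omega> = v) \<partial>M) = (\<integral>\<omega>. ?g \<omega> * (W v \<omega> / S n \<omega>) \<partial>M)"
      by (rule attach_integral[OF n1 True ghist gb])
    also have "\<dots> \<le> (\<integral>\<omega>. ?g \<omega> * (1 / f n) \<partial>M)"
    proof (rule integral_mono_AE)
      show "integrable M (\<lambda>\<omega>. ?g \<omega> * (W v \<omega> / S n \<omega>))" by (rule integrable_weight_ratio[OF _ gb True]) measurable
      show "integrable M (\<lambda>\<omega>. ?g \<omega> * (1 / f n))" using gi by (rule integrable_mult_left)
      show "AE \<omega> in M. ?g \<omega> * (W v \<omega> / S n \<omega>) \<le> ?g \<omega> * (1 / f n)"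
        using AE_weights
      proof eventually_elim
        case (elim \<omega>)
        show ?case
        proof (cases "\<omega> \<in> heavy f t0 n")
          case True2: True
          then have s: "f n \<le> S n \<omega>" using step.hyps by (auto simp: heavy_def)
          have "W v \<omega> \<le> 1" using elim True by auto
          then have "W v \<omega> / S n \<omega> \<le> 1 / f n" using s fn by (intro frac_le) auto
          then show ?thesis using g0 by (rule mult_left_mono)
        qed simp
      qed
    qed
    also have "\<dots> = (\<integral>\<omega>. ?g \<omega> \<partial>M) / f n" by (subst Bochner_Integration.integral_mult_left_zero) simp
    finally show ?thesis .
  next
    case False
    have "(\<integral>\<omega>. ?g \<omega> * of_bool (J (Suc n) \<omega> = v) \<partial>M) = (\<integral>\<omega>. 0 \<partial>M)"
    proof (rule Bochner_Integration.integral_cong[OF refl])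
      fix \<omega> assume "\<omega> \<in> space M"
      then have "J (Suc n) \<omega> \<in> {1..n}" by (rule attach_range[OF n1])
      then show "?g \<omega> * of_bool (J (Suc n) \<omega> = v) = 0" using False by auto
    qed
    moreover have "0 \<le> (\<integral>\<omega>. ?g \<omega> \<partial>M) / f n" using fn g0 by (intro divide_nonneg_pos integral_nonneg_AE) auto
    ultimately show ?thesis by simp
  qed
  have "(\<integral>\<omega>. indicator (heavy f t0 (Suc n)) \<omega> * u ^ deg (Suc n) v \<omega> \<partial>M) \<le> (\<integral>\<omega>. ?g \<omega> + (u - 1) * (?g \<omega> * of_bool (J (Suc n) \<omega> = v)) \<partial>M)"
  proof (rule integral_mono')
    show "integrable M (\<lambda>\<omega>. ?g \<omega> + (u - 1) * (?g \<omega> * of_bool (J (Suc n) \<omega> = v)))"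
      by (intro Bochner_Integration.integrable_add gi integrable_mult_right gJ)
    fix \<omega>
    have sub: "heavy f t0 (Suc n) \<subseteq> heavy f t0 n" by (auto simp: heavy_def)
    have "indicator (heavy f t0 (Suc n)) \<omega> * u ^ deg (Suc n) v \<omega> \<le> indicator (heavy f t0 n) \<omega> * u ^ deg (Suc n) v \<omega>"
      using sub u by (auto simp: indicator_def)
    also have "\<dots> = ?g \<omega> + (u - 1) * (?g \<omega> * of_bool (J (Suc n) \<omega> = v))"
      by (cases "J (Suc n) \<omega> = v") (auto simp: deg_Suc[OF n1] algebra_simps)
    finally show "indicator (heavy f t0 (Suc n)) \<omega> * u ^ deg (Suc n) v \<omega> \<le> ?g \<omega> + (u - 1) * (?g \<omega> * of_bool (J (Suc n) \<omega> = v))" .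
    show "0 \<le> ?g \<omega> + (u - 1) * (?g \<omega> * of_bool (J (Suc n) \<omega> = v))" using u by auto
  qed
  also have "\<dots> = (\<integral>\<omega>. ?g \<omega> \<partial>M) + (u - 1) * (\<integral>\<omega>. ?g \<omega> * of_bool (J (Suc n) \<omega> = v) \<partial>M)"
    by (subst Bochner_Integration.integral_add[OF gi integrable_mult_right[OF gJ]]) simp
  also have "\<dots> \<le> (\<integral>\<omega>. ?g \<omega> \<partial>M) + (u - 1) * ((\<integral>\<omega>. ?g \<omega> \<partial>M) / f n)"
    using att u by (intro add_left_mono mult_left_mono) auto
  also have "\<dots> = (\<integral>\<omega>. ?g \<omega> \<partial>M) * (1 + (u - 1) / f n)" by (simp add: algebra_simps)
  also have "\<dots> \<le> (u ^ t0 * (\<Prod>j\<in>{t0..<n}. 1 + (u - 1) / f j)) * (1 + (u - 1) / f n)"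
    using step.IH u fn by (intro mult_right_mono) auto
  also have "\<dots> = u ^ t0 * (\<Prod>j\<in>{t0..<Suc n}. 1 + (u - 1) / f j)"
    using step.hyps by (simp add: atLeastLessThanSuc)
  finally show ?case .
qed

text \<open>
  Markov's inequality for \<open>u ^ deg\<close>, with three phases: up to time \<open>t0\<close> the trivial bound on the degree, up
  to time \<open>n0\<close> a lower bound \<open>s * j\<close> on the weight sums with a very small slope, and then the nearly
  optimal slope \<open>mw - \<delta>\<close>.
\<close>

lemma early_vertices_bound:
  assumes u: "1 \<le> u" and s: "0 < s" and small: "\<And>j. prob {\<omega> \<in> space M. S j \<omega> < s * real j} \<le> exp (- (A * real j))"
    and A: "0 \<le> A" and \<delta>: "0 < \<delta>" "\<delta> < mw" and t0: "2 \<le> t0" "t0 \<le> n0" "n0 \<le> N"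
  shows "prob {\<omega> \<in> space M. \<exists>v\<in>{1..n0}. d \<le> deg N v \<omega>} \<le>
    real n0 * exp (- (A * real t0)) + 4 * real N * exp (- 2 * \<delta>\<^sup>2 * real n0)
      + real n0 * (u ^ t0 * (real n0 powr ((u - 1) / s) * real N powr ((u - 1) / (mw - \<delta>))) / u ^ d)"
proof -
  define f where "f j = (if j < n0 then s * real j else (mw - \<delta>) * real j)" for j
  have f0: "0 < f j" if "t0 \<le> j" for j using that t0 s \<delta> by (auto simp: f_def)
  let ?H = "heavy f t0 N"
  have Hs: "?H \<in> sets M" using heavy_hist subalgebra_hist unfolding subalgebra_def by blast
  have pr: "(\<Prod>j\<in>{t0..<N}. 1 + (u - 1) / f j) \<le> real n0 powr ((u - 1) / s) * real N powr ((u - 1) / (mw - \<delta>))"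
  proof -
    have "{t0..<N} = {t0..<n0} \<union> {n0..<N}" using t0 by auto
    then have "(\<Prod>j\<in>{t0..<N}. 1 + (u - 1) / f j) = (\<Prod>j\<in>{t0..<n0}. 1 + (u - 1) / f j) * (\<Prod>j\<in>{n0..<N}. 1 + (u - 1) / f j)"
      by (simp only:) (rule prod.union_disjoint, auto)
    also have "\<dots> = (\<Prod>j\<in>{t0..<n0}. 1 + ((u - 1) / s) / real j) * (\<Prod>j\<in>{n0..<N}. 1 + ((u - 1) / (mw - \<delta>)) / real j)"
      by (intro arg_cong2[where f="(*)"] prod.cong) (auto simp: f_def)
    also have "\<dots> \<le> (real n0 - 1) powr ((u - 1) / s) * (real N - 1) powr ((u - 1) / (mw - \<delta>))"
      using t0 u s \<delta> by (intro mult_mono prod_one_plus_le prod_nonneg) (auto intro!: add_nonneg_nonneg divide_nonneg_nonneg)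
    also have "\<dots> \<le> real n0 powr ((u - 1) / s) * real N powr ((u - 1) / (mw - \<delta>))"
      using t0 u s \<delta> by (intro mult_mono powr_mono2) auto
    finally show ?thesis .
  qed
  have moment: "prob (?H \<inter> {\<omega> \<in> space M. d \<le> deg N v \<omega>}) \<le> u ^ t0 * (real n0 powr ((u - 1) / s) * real N powr ((u - 1) / (mw - \<delta>))) / u ^ d" for v
  proof -
    have E: "?H \<inter> {\<omega> \<in> space M. d \<le> deg N v \<omega>} \<in> sets M" using Hs by measurable
    have int: "integrable M (\<lambda>\<omega>. indicator ?H \<omega> * u ^ deg N v \<omega>)"
    proof (rule integrable_bounded_M)
      show "(\<lambda>\<omega>. indicator ?H \<omega> * u ^ deg N v \<omega>) \<in> borel_measurable M" using Hs by measurable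
      show "\<bar>indicator ?H \<omega> * u ^ deg N v \<omega>\<bar> \<le> u ^ N" for \<omega>
        using power_increasing[OF deg_le u, of N v \<omega>] u by (auto simp: indicator_def)
    qed
    have "u ^ d * prob (?H \<inter> {\<omega> \<in> space M. d \<le> deg N v \<omega>}) = (\<integral>\<omega>. u ^ d * indicator (?H \<inter> {\<omega> \<in> space M. d \<le> deg N v \<omega>}) \<omega> \<partial>M)"
      using E by simp
    also have "\<dots> \<le> (\<integral>\<omega>. indicator ?H \<omega> * u ^ deg N v \<omega> \<partial>M)"
    proof (rule integral_mono'[OF int])
      show "u ^ d * indicator (?H \<inter> {\<omega> \<in> space M. d \<le> deg N v \<omega>}) \<omega> \<le> indicator ?H \<omega> * u ^ deg N v \<omega>" for \<omega>
        using u by (auto simp: indicator_def power_increasing)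
    qed (use u in auto)
    also have "\<dots> \<le> u ^ t0 * (\<Prod>j\<in>{t0..<N}. 1 + (u - 1) / f j)"
      by (rule deg_exponential_moment[OF u _ f0]) (use t0 in auto)
    also have "\<dots> \<le> u ^ t0 * (real n0 powr ((u - 1) / s) * real N powr ((u - 1) / (mw - \<delta>)))"
      using pr u by (intro mult_left_mono) auto
    finally show ?thesis using u by (simp add: pos_le_divide_eq mult.commute)
  qed
  have bad: "prob (space M - ?H) \<le> real n0 * exp (- (A * real t0)) + 4 * real N * exp (- 2 * \<delta>\<^sup>2 * real n0)"
  proof -
    have [measurable]: "S j \<in> borel_measurable M" for j by (rule hist_measurable_M[OF S_hist[OF order_refl]])
    have "space M - ?H \<subseteq> (\<Union>j\<in>{t0..<n0}. {\<omega> \<in> space M. S j \<omega> < s * real j}) \<union> (space M - good UNIV n0 \<delta> N)"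
    proof
      fix \<omega> assume "\<omega> \<in> space M - ?H"
      then obtain j where w: "\<omega> \<in> space M" and j: "j \<in> {t0..N}" "S j \<omega> < f j" by (auto simp: heavy_def not_le)
      show "\<omega> \<in> (\<Union>j\<in>{t0..<n0}. {\<omega> \<in> space M. S j \<omega> < s * real j}) \<union> (space M - good UNIV n0 \<delta> N)"
      proof (cases "j < n0")
        case True
        then show ?thesis using w j by (auto simp: f_def)
      next
        case False
        have "\<omega> \<notin> good UNIV n0 \<delta> N"
        proof
          assume "\<omega> \<in> good UNIV n0 \<delta> N"
          then have "\<omega> \<in> good UNIV n0 \<delta> j" using good_antimono[of j N UNIV n0 \<delta>] j by auto
          then have "(mw - \<delta>) * real j \<le> S j \<omega>" using good_S(1) False by auto
          then show False using j False by (simp add: f_def)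
        qed
        then show ?thesis using w by simp
      qed
    qed
    then have "prob (space M - ?H) \<le> prob ((\<Union>j\<in>{t0..<n0}. {\<omega> \<in> space M. S j \<omega> < s * real j}) \<union> (space M - good UNIV n0 \<delta> N))"
      by (intro finite_measure_mono) auto
    also have "\<dots> \<le> prob (\<Union>j\<in>{t0..<n0}. {\<omega> \<in> space M. S j \<omega> < s * real j}) + prob (space M - good UNIV n0 \<delta> N)"
      by (intro measure_Un_le) auto
    also have "\<dots> \<le> (\<Sum>j\<in>{t0..<n0}. prob {\<omega> \<in> space M. S j \<omega> < s * real j}) + 4 * real N * exp (- 2 * \<delta>\<^sup>2 * real n0)"
      using t0 by (intro add_mono finite_measure_subadditive_finite good_complement \<delta>) auto
    also have "(\<Sum>j\<in>{t0..<n0}. prob {\<omega> \<in> space M. S j \<omega> < s * real j}) \<le> (\<Sum>j\<in>{t0..<n0}. exp (- (A * real t0)))"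
    proof (rule sum_mono)
      fix j assume "j \<in> {t0..<n0}"
      then have "exp (- (A * real j)) \<le> exp (- (A * real t0))" using A by (simp add: mult_left_mono)
      then show "prob {\<omega> \<in> space M. S j \<omega> < s * real j} \<le> exp (- (A * real t0))" using small[of j] by linarith
    qed
    also have "\<dots> \<le> real n0 * exp (- (A * real t0))" by (simp add: mult_right_mono)
    finally show ?thesis by simp
  qed
  have "{\<omega> \<in> space M. \<exists>v\<in>{1..n0}. d \<le> deg N v \<omega>} \<subseteq> (space M - ?H) \<union> (\<Union>v\<in>{1..n0}. ?H \<inter> {\<omega> \<in> space M. d \<le> deg N v \<omega>})"
    by auto
  then have "prob {\<omega> \<in> space M. \<exists>v\<in>{1..n0}. d \<le> deg N v \<omega>} \<le> prob ((space M - ?H) \<union> (\<Union>v\<in>{1..n0}. ?H \<inter> {\<omega> \<in> space M. d \<le> deg N v \<omega>}))"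
    using Hs by (intro finite_measure_mono) (auto intro!: sets.finite_UN)
  also have "\<dots> \<le> prob (space M - ?H) + prob (\<Union>v\<in>{1..n0}. ?H \<inter> {\<omega> \<in> space M. d \<le> deg N v \<omega>})"
    using Hs by (intro measure_Un_le) auto
  also have "\<dots> \<le> prob (space M - ?H) + (\<Sum>v\<in>{1..n0}. prob (?H \<inter> {\<omega> \<in> space M. d \<le> deg N v \<omega>}))"
    using Hs by (intro add_left_mono finite_measure_subadditive_finite) auto
  also have "\<dots> \<le> (real n0 * exp (- (A * real t0)) + 4 * real N * exp (- 2 * \<delta>\<^sup>2 * real n0)) + 
     (\<Sum>v\<in>{1..n0}. u ^ t0 * (real n0 powr ((u - 1) / s) * real N powr ((u - 1) / (mw - \<delta>))) / u ^ d)"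
    by (intro add_mono bad sum_mono moment)
  finally show ?thesis by simp
qed

section \<open>Asymptotics of the tuple means\<close>

abbreviation typical :: "real set \<Rightarrow> real \<Rightarrow> nat \<Rightarrow> 'a set" where
  "typical B \<eta> N \<equiv> good B (cutoff \<eta> N) (tolerance \<eta> N) N"

definition tuple_mean :: "real set \<Rightarrow> real \<Rightarrow> nat \<Rightarrow> 'i set \<Rightarrow> ('i \<Rightarrow> nat) \<Rightarrow> real" where
  "tuple_mean B \<eta> N I m = good_mean B (cutoff \<eta> N) (tolerance \<eta> N) N I m"

lemma theta_gt_1: "1 < \<theta>" using mw_bounds by (simp add: theta_eq)

lemma eventually_tolerance: "0 < \<eta> \<Longrightarrow> 0 < e \<Longrightarrow> \<forall>\<^sub>F N in sequentially. 0 < tolerance \<eta> N \<and> tolerance \<eta> N < e"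
proof (rule eventually_conj)
  assume "0 < \<eta>" "0 < e"
  then show "\<forall>\<^sub>F N in sequentially. tolerance \<eta> N < e" using tolerance_tendsto by (intro order_tendstoD) auto
  show "\<forall>\<^sub>F N in sequentially. 0 < tolerance \<eta> N"
    using eventually_gt_at_top[of 0] by eventually_elim (simp add: tolerance_def)
qed

lemma concentration_cutoff:
  assumes "0 < \<eta>" "\<eta> < 1"
  shows "\<forall>\<^sub>F N in sequentially. 4 * real N * exp (- 2 * (tolerance \<eta> N)\<^sup>2 * real (cutoff \<eta> N))
     \<le> 4 * real N * exp (- 2 * real N powr (\<eta> / 2))"
  using eventually_gt_at_top[of 0]
proof eventually_elim
  case (elim N)
  have "(tolerance \<eta> N)\<^sup>2 = real N powr (-\<eta>/2)"
    using elim by (simp add: tolerance_def power2_eq_square powr_add[symmetric])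
  moreover have "real N powr \<eta> \<le> real (cutoff \<eta> N)" by (simp add: cutoff_def real_nat_ceiling_ge)
  ultimately have "real N powr (-\<eta>/2) * real N powr \<eta> \<le> (tolerance \<eta> N)\<^sup>2 * real (cutoff \<eta> N)"
    by (intro mult_mono) auto
  also have "real N powr (-\<eta>/2) * real N powr \<eta> = real N powr (\<eta>/2)" by (simp add: powr_add[symmetric])
  finally show ?case by (intro mult_left_mono iffD2[OF exp_le_cancel_iff]) (auto simp: mult.assoc)
qed

lemma atypical_negligible:
  assumes B: "B \<in> sets borel" and \<eta>: "0 < \<eta>" "\<eta> < 1"
  shows "(\<lambda>N. real N powr K * prob (space M - typical B \<eta> N)) \<longlonglongrightarrow> 0"
proof (rule tendsto_sandwich[OF _ _ tendsto_const])
  show "\<forall>\<^sub>F N in sequentially. real N powr K * prob (space M - typical B \<eta> N) \<le> real N powr K * (4 * real N * exp (- 2 * real N powr (\<eta> / 2)))"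
    using concentration_cutoff[OF \<eta>] eventually_tolerance[OF \<eta>(1) zero_less_one] eventually_cutoff_ge[OF \<eta>(1), of 1]
  proof eventually_elim
    case (elim N)
    have "prob (space M - typical B \<eta> N) \<le> 4 * real N * exp (- 2 * (tolerance \<eta> N)\<^sup>2 * real (cutoff \<eta> N))"
      by (rule good_complement[OF B]) (use elim in auto)
    then show ?case using elim(1) by (intro mult_left_mono) auto
  qed
  show "(\<lambda>N. real N powr K * (4 * real N * exp (- 2 * real N powr (\<eta> / 2)))) \<longlonglongrightarrow> 0"
    using \<eta> by real_asymp
qed (auto intro!: always_eventually)

text \<open>
  The supersolution at the chosen scales; \<open>X N\<close> is the factor contributed by each entry of the tuple.
\<close>

lemma tuple_mean_upper:
  assumes B: "B \<in> sets borel" "\<And>x. x \<in> B \<Longrightarrow> x \<le> r" and r: "0 < r" and \<eta>: "0 < \<eta>" "\<eta> < 1"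
  shows "\<exists>X. (\<lambda>N. X N / real N) \<longlonglongrightarrow> measure \<mu> B \<and>
     (\<forall>(I :: 'i set) m. finite I \<longrightarrow> (\<forall>\<^sub>F N in sequentially. tuple_mean B \<eta> N I (m N) \<le> X N ^ card I * (\<Prod>l\<in>I. (r / (r + mw)) ^ m N l)))"
proof -
  have mw2: "0 < mw / 2" using mw_bounds by simp
  define X where "X N = (measure \<mu> B + tolerance \<eta> N) * (real (cutoff \<eta> N) / (real (cutoff \<eta> N) - 1)) * (real N - 1) powr (mw / (mw - tolerance \<eta> N))" for N
  have "(\<lambda>N. (measure \<mu> B + tolerance \<eta> N) * (real (cutoff \<eta> N) / (real (cutoff \<eta> N) - 1)) * ((real N - 1) powr (mw / (mw - tolerance \<eta> N)) / real N)) \<longlonglongrightarrow> (measure \<mu> B + 0) * 1 * 1"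
    by (intro tendsto_intros tolerance_tendsto cutoff_ratio \<eta> powr_upper_factor_limit[OF \<eta>(1), folded tolerance_def] mw_bounds)
  then have X: "(\<lambda>N. X N / real N) \<longlonglongrightarrow> measure \<mu> B" by (simp add: X_def)
  moreover have "\<forall>\<^sub>F N in sequentially. tuple_mean B \<eta> N I (m N) \<le> X N ^ card I * (\<Prod>l\<in>I. (r / (r + mw)) ^ m N l)" 
    if I: "finite I" for I :: "'i set" and m
    using eventually_tolerance[OF \<eta>(1) mw2] eventually_cutoff_ge[OF \<eta>(1), of "max 2 (real (card I) * r / (mw / 2))"] cutoff_le[OF \<eta>]
  proof eventually_elim
    case (elim N)
    have t: "0 < tolerance \<eta> N" "tolerance \<eta> N < mw" "mw / 2 \<le> mw - tolerance \<eta> N" using elim by (auto simp: field_simps)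
    have "real (card I) * r = (mw / 2) * (real (card I) * r / (mw / 2))" using mw_bounds by simp
    also have "\<dots> \<le> (mw - tolerance \<eta> N) * real (cutoff \<eta> N)" using elim t mw_bounds r by (intro mult_mono) auto
    finally have c: "real (card I) * r \<le> (mw - tolerance \<eta> N) * real (cutoff \<eta> N)" .
    show ?case unfolding tuple_mean_def X_def
      by (rule tuples_upper[OF B r t(1,2) _ I c]) (use elim in auto)
  qed
  ultimately show ?thesis by blast
qed

text \<open>
  Counting with the tail \<open>u\<close> instead of \<open>\<theta>\<close> costs a factor \<open>(\<theta> / u) ^ d \<le> n powr (c * ln (\<theta> / u))\<close>, and
  it gains \<open>n powr (1 - (u - 1) / mw)\<close>, because \<open>n powr ((u - 1) / mw)\<close> takes the place of a factor \<open>n\<close> in the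
  mean. Both exponents vanish at \<open>u = \<theta>\<close>, and just below \<open>\<theta>\<close> the gain wins since \<open>c < \<theta> / mw\<close>.
\<close>

lemma saddle_point:
  assumes c: "0 < c" "c < \<theta> / mw"
  obtains u where "1 < u" "u < \<theta>" "c * ln (\<theta> / u) < 1 - (u - 1) / mw"
proof -
  have "max 1 (c * mw) < \<theta>" using c theta_gt_1 mw_bounds by (simp add: field_simps)
  then obtain u where u: "max 1 (c * mw) < u" "u < \<theta>" using dense by blast
  then have u0: "0 < u" by simp
  have "ln (\<theta> / u) \<le> \<theta> / u - 1" using u0 u by (intro ln_le_minus_one) auto
  then have "c * ln (\<theta> / u) \<le> c * ((\<theta> - u) / u)" using c u0 by (intro mult_left_mono) (auto simp: field_simps)
  also have "\<dots> < (\<theta> - u) / mw"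
  proof -
    have "c * mw * (\<theta> - u) < u * (\<theta> - u)" using u by (intro mult_strict_right_mono) auto
    then show ?thesis using u0 mw_bounds by (simp add: field_simps)
  qed
  also have "\<dots> = 1 - (u - 1) / mw" using mw_bounds by (simp add: theta_eq field_simps)
  finally show ?thesis using that[of u] u by simp
qed

lemma power_le_powr_N:
  assumes "1 \<le> y" "real d \<le> c * ln (real N)" "1 \<le> N"
  shows "y ^ d \<le> real N powr (c * ln y)"
proof -
  have "y ^ d = exp (real d * ln y)" using assms by (simp add: exp_of_nat_mult)
  also have "\<dots> \<le> exp (c * ln (real N) * ln y)" using assms by (simp add: mult_right_mono)
  also have "\<dots> = real N powr (c * ln y)" using assms by (simp add: powr_def mult_ac)
  finally show ?thesis .
qed

text \<open>
  For \<open>\<eta>\<close> below the gap in \<open>saddle_point\<close>, the error term of the subsolution, which contains a factor of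
  order \<open>cutoff \<eta> N\<close>, is of smaller order than its main term. The atypical event is negligible even after
  division by the main term, which is bounded below by some power of \<open>N\<close>, possibly a negative one.
\<close>

lemma tuple_mean_asymp:
  assumes c: "0 < c" "c < \<theta> / mw"
  shows "\<exists>\<eta>1>0. \<forall>\<eta>. 0 < \<eta> \<and> \<eta> < \<eta>1 \<and> \<eta> < 1 \<longrightarrow> (\<forall>(I :: 'i set) m. finite I \<longrightarrow> (\<forall>l\<in>I. \<forall>\<^sub>F N in sequentially. real (m N l) \<le> c * ln (real N))
     \<longrightarrow> (\<lambda>N. tuple_mean {1} \<eta> N I (m N) / (\<Prod>l\<in>I. q * real N * (1 / \<theta>) ^ m N l)) \<longlonglongrightarrow> 1)"
proof -
  obtain u where u: "1 < u" "u < \<theta>" "c * ln (\<theta> / u) < 1 - (u - 1) / mw" using saddle_point[OF c] .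
  define y where "y = \<theta> / u"
  define \<alpha> where "\<alpha> = (u - 1) / mw"
  define \<eta>1 where "\<eta>1 = 1 - \<alpha> - c * ln y"
  have y1: "1 \<le> y" using u by (simp add: y_def)
  have e1: "0 < \<eta>1" using u by (simp add: \<eta>1_def \<alpha>_def y_def)
  have q0: "0 < q" by (rule atom_pos)
  show ?thesis
  proof (intro exI[of _ \<eta>1] conjI allI impI e1)
    fix \<eta> and I :: "'i set" and m :: "nat \<Rightarrow> 'i \<Rightarrow> nat"
    assume \<eta>: "0 < \<eta> \<and> \<eta> < \<eta>1 \<and> \<eta> < 1" and I: "finite I" and "\<forall>l\<in>I. \<forall>\<^sub>F N in sequentially. real (m N l) \<le> c * ln (real N)"
    then have m: "\<forall>\<^sub>F N in sequentially. \<forall>l\<in>I. real (m N l) \<le> c * ln (real N)" by (simp add: eventually_ball_finite)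
    have \<eta>': "0 < \<eta>" "\<eta> < 1" using \<eta> by auto
    define k where "k = card I"
    define P where "P N = (\<Prod>l\<in>I. (1 / \<theta>) ^ m N l)" for N
    have P0: "0 < P N" for N unfolding P_def using theta_gt_1 by (intro prod_pos) auto
    have den: "(\<Prod>l\<in>I. q * real N * (1 / \<theta>) ^ m N l) = (q * real N) ^ k * P N" for N
      by (simp add: P_def k_def prod.distrib)
    obtain X where X: "(\<lambda>N. X N / real N) \<longlonglongrightarrow> q"
       "\<forall>\<^sub>F N in sequentially. tuple_mean {1} \<eta> N I (m N) \<le> X N ^ card I * (\<Prod>l\<in>I. (1 / (1 + mw)) ^ m N l)"
      using tuple_mean_upper[of "{1}" 1 \<eta>, where 'i='i] \<eta>' I by fastforce
    define Z where "Z N = (q - tolerance \<eta> N) * (real N + real k) powr (mw / (mw + tolerance \<eta> N))" for N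
    have "(\<lambda>N. (q - tolerance \<eta> N) * ((real N + real k) powr (mw / (mw + tolerance \<eta> N)) / real N)) \<longlonglongrightarrow> (q - 0) * 1"
      by (intro tendsto_intros tolerance_tendsto \<eta>' powr_lower_factor_limit[OF \<eta>'(1), folded tolerance_def] mw_bounds) simp
    then have Z: "(\<lambda>N. Z N / real N) \<longlonglongrightarrow> q" by (simp add: Z_def)
    define E1 where "E1 N = (2 ^ k * real k / q ^ k) * ((2 * real k + 2 * real N powr \<eta>) * real N powr (\<alpha> + c * ln y - 1))" for N
    define E2 where "E2 N = (1 / q ^ k) * (real N powr (real k * (c * ln \<theta>)) * prob (space M - typical {1} \<eta> N))" for N
    have E1: "E1 \<longlonglongrightarrow> 0"
    proof -
      have "(\<lambda>N. (2 * real k + 2 * real N powr \<eta>) * real N powr (\<alpha> + c * ln y - 1)) \<longlonglongrightarrow> 0"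
        using \<eta> e1 unfolding \<eta>1_def by real_asymp
      then show ?thesis unfolding E1_def[abs_def] by (rule tendsto_mult_right_zero)
    qed
    have E2: "E2 \<longlonglongrightarrow> 0"
      unfolding E2_def[abs_def] by (intro tendsto_mult_right_zero atypical_negligible \<eta>') simp
    have up: "\<forall>\<^sub>F N in sequentially. tuple_mean {1} \<eta> N I (m N) / (\<Prod>l\<in>I. q * real N * (1 / \<theta>) ^ m N l) \<le> (X N / real N / q) ^ k"
      using X(2) eventually_gt_at_top[of 0]
    proof eventually_elim
      case (elim N)
      have "tuple_mean {1} \<eta> N I (m N) \<le> X N ^ k * P N" using elim by (simp add: k_def P_def theta_eq)
      then have "tuple_mean {1} \<eta> N I (m N) / ((q * real N) ^ k * P N) \<le> X N ^ k * P N / ((q * real N) ^ k * P N)"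
        using P0[of N] q0 elim by (intro divide_right_mono) auto
      also have "\<dots> = (X N / real N / q) ^ k" using P0[of N] q0 elim by (simp add: power_divide power_mult_distrib)
      finally show ?case by (simp add: den)
    qed
    have lo: "\<forall>\<^sub>F N in sequentially. (Z N / real N / q) ^ k - E1 N - E2 N \<le> tuple_mean {1} \<eta> N I (m N) / (\<Prod>l\<in>I. q * real N * (1 / \<theta>) ^ m N l)"
      using eventually_tolerance[OF \<eta>'(1) q0] eventually_cutoff_ge[OF \<eta>'(1), of "max (real k + 2) (real k / mw)"] cutoff_le[OF \<eta>'] cutoff_le_powr[OF \<eta>'(1)] m eventually_gt_at_top[of 1]
    proof eventually_elim
      case (elim N)
      define n0 where "n0 = cutoff \<eta> N"
      define t where "t = tolerance \<eta> N"
      have t: "0 < t" "t < q" using elim by (auto simp: t_def)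
      have n0: "real k + 2 \<le> real n0" "real k / mw \<le> real n0" "n0 \<le> N" "real n0 \<le> 2 * real N powr \<eta>" using elim by (auto simp: n0_def)
      have N: "1 < N" "1 < real N" using elim by auto
      have kc: "real k \<le> (mw + t) * real n0"
      proof -
        have "real k = mw * (real k / mw)" using mw_bounds by simp
        also have "\<dots> \<le> (mw + t) * real n0" using n0 t mw_bounds by (intro mult_mono) auto
        finally show ?thesis .
      qed
      have low: "Z N ^ k * P N - 2 ^ k * (2 * real k + real n0) * (real N - 1) powr (real k - 1 + \<alpha>) * P N * (\<Sum>l\<in>I. y ^ m N l)
         \<le> tuple_mean {1} \<eta> N I (m N) + real N ^ k * (1 - prob (typical {1} \<eta> N))"
        using tuples_lower[OF t u(1,2) _ I, of k n0 N N "m N"] n0 kc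
        unfolding Z_def k_def[symmetric] y_def \<alpha>_def P_def tuple_mean_def n0_def t_def by simp
      have "(\<Sum>l\<in>I. y ^ m N l) \<le> (\<Sum>l\<in>I. real N powr (c * ln y))"
        using elim N by (intro sum_mono power_le_powr_N y1) auto
      then have sy: "(\<Sum>l\<in>I. y ^ m N l) \<le> real k * real N powr (c * ln y)" by (simp add: k_def)
      have err: "2 ^ k * (2 * real k + real n0) * (real N - 1) powr (real k - 1 + \<alpha>) * P N * (\<Sum>l\<in>I. y ^ m N l) \<le> E1 N * ((q * real N) ^ k * P N)"
      proof (cases "k = 0")
        case True
        then show ?thesis using I by (simp add: k_def E1_def)
      next
        case False
        then have ex: "0 \<le> real k - 1 + \<alpha>" using u mw_bounds by (simp add: \<alpha>_def)
        have "2 ^ k * (2 * real k + real n0) * (real N - 1) powr (real k - 1 + \<alpha>) * P N * (\<Sum>l\<in>I. y ^ m N l)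
           \<le> 2 ^ k * (2 * real k + 2 * real N powr \<eta>) * real N powr (real k - 1 + \<alpha>) * P N * (real k * real N powr (c * ln y))"
          using n0 N P0[of N] sy ex y1 by (intro mult_mono powr_mono2 mult_nonneg_nonneg sum_nonneg) (auto intro: less_imp_le)
        also have "\<dots> = 2 ^ k * (2 * real k + 2 * real N powr \<eta>) * real k * P N * (real N powr (real k - 1 + \<alpha>) * real N powr (c * ln y))" by simp
        also have "real N powr (real k - 1 + \<alpha>) * real N powr (c * ln y) = real N powr (real k + (\<alpha> + c * ln y - 1))"
          by (simp add: powr_add[symmetric] algebra_simps)
        also have "\<dots> = real N ^ k * real N powr (\<alpha> + c * ln y - 1)" using N by (simp add: powr_add powr_realpow)
        also have "2 ^ k * (2 * real k + 2 * real N powr \<eta>) * real k * P N * (real N ^ k * real N powr (\<alpha> + c * ln y - 1)) = E1 N * ((q * real N) ^ k * P N)"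
          using q0 by (simp add: E1_def power_mult_distrib)
        finally show ?thesis .
      qed
      have bad: "real N ^ k * (1 - prob (typical {1} \<eta> N)) \<le> E2 N * ((q * real N) ^ k * P N)"
      proof -
        have "P N * (\<Prod>l\<in>I. \<theta> ^ m N l) = (\<Prod>l\<in>I. (1 / \<theta> * \<theta>) ^ m N l)"
          unfolding P_def prod.distrib[symmetric] power_mult_distrib ..
        also have "\<dots> = 1" using theta_gt_1 by simp
        finally have "1 / P N = (\<Prod>l\<in>I. \<theta> ^ m N l)" using P0[of N] by (simp add: field_simps)
        also have "\<dots> \<le> (\<Prod>l\<in>I. real N powr (c * ln \<theta>))"
          using elim N theta_gt_1 by (intro prod_mono conjI power_le_powr_N) auto
        also have "\<dots> = (real N powr (c * ln \<theta>)) powr real k" using N by (subst powr_realpow) (auto simp: k_def)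
        also have "\<dots> = real N powr (real k * (c * ln \<theta>))" by (simp only: powr_powr mult.commute)
        finally have iP: "1 \<le> real N powr (real k * (c * ln \<theta>)) * P N" using P0[of N] by (simp add: field_simps)
        have pc: "1 - prob (typical {1} \<eta> N) = prob (space M - typical {1} \<eta> N)" by (subst prob_compl) auto
        have "real N ^ k * prob (space M - typical {1} \<eta> N) * 1 \<le> real N ^ k * prob (space M - typical {1} \<eta> N) * (real N powr (real k * (c * ln \<theta>)) * P N)"
          by (intro mult_left_mono iP) auto
        also have "\<dots> = E2 N * ((q * real N) ^ k * P N)" using q0 by (simp add: E2_def power_mult_distrib)
        finally show ?thesis unfolding pc by simp
      qed
      have D0: "0 < (q * real N) ^ k * P N" using q0 N P0[of N] by simp
      have "((Z N / real N / q) ^ k - E1 N - E2 N) * ((q * real N) ^ k * P N) = Z N ^ k * P N - E1 N * ((q * real N) ^ k * P N) - E2 N * ((q * real N) ^ k * P N)"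
      proof -
        have "(Z N / real N / q) ^ k * ((q * real N) ^ k * P N) = Z N ^ k * P N" using q0 N by (simp add: power_divide power_mult_distrib)
        then show ?thesis by (simp add: left_diff_distrib)
      qed
      also have "\<dots> \<le> tuple_mean {1} \<eta> N I (m N)" using low err bad by linarith
      finally show ?case unfolding den using D0 by (simp add: pos_le_divide_eq)
    qed
    show "(\<lambda>N. tuple_mean {1} \<eta> N I (m N) / (\<Prod>l\<in>I. q * real N * (1 / \<theta>) ^ m N l)) \<longlonglongrightarrow> 1"
    proof (rule tendsto_sandwich[OF lo up])
      have "(\<lambda>N. (Z N / real N / q) ^ k - E1 N - E2 N) \<longlonglongrightarrow> (q / q) ^ k - 0 - 0"
        by (intro tendsto_intros Z E1 E2) (use q0 in auto)
      then show "(\<lambda>N. (Z N / real N / q) ^ k - E1 N - E2 N) \<longlonglongrightarrow> 1" using q0 by simp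
      have "(\<lambda>N. (X N / real N / q) ^ k) \<longlonglongrightarrow> (q / q) ^ k" by (intro tendsto_intros X) (use q0 in auto)
      then show "(\<lambda>N. (X N / real N / q) ^ k) \<longlonglongrightarrow> 1" using q0 by simp
    qed
  qed
qed

section \<open>Early and light vertices\<close>

text \<open>
  With \<open>d \<le> c * ln N\<close>, the bound in \<open>early_vertices_bound\<close> times \<open>\<theta> ^ d / N\<close> consists of powers of \<open>N\<close>
  and a superpolynomially small term. Let \<open>f > 0\<close> be the gap in \<open>saddle_point\<close>. The constants distribute it:
  \<open>t0\<close> is \<open>h * ln N\<close> with \<open>u powr (h * ln N) = N powr (f / 8)\<close>, the rate \<open>A\<close> makes \<open>exp (- A * t0)\<close> as small
  as \<open>N powr (- (c * ln \<theta> + 1))\<close>, and \<open>\<eta>\<close> is so small that the powers of \<open>cutoff \<eta> N\<close> contribute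
  less than \<open>N powr (f / 8)\<close>.
\<close>

lemma early_vertices_negligible:
  assumes c: "0 < c" "c < \<theta> / mw"
  shows "\<exists>\<eta>2>0. \<forall>\<eta> d. 0 < \<eta> \<and> \<eta> < \<eta>2 \<and> \<eta> < 1 \<and> (\<forall>\<^sub>F N in sequentially. real (d N) \<le> c * ln (real N))
     \<longrightarrow> (\<lambda>N. prob {\<omega> \<in> space M. \<exists>v\<in>{1..cutoff \<eta> N}. d N \<le> deg N v \<omega>} * (\<theta> ^ d N / real N)) \<longlonglongrightarrow> 0"
proof -
  obtain u where u: "1 < u" "u < \<theta>" "c * ln (\<theta> / u) < 1 - (u - 1) / mw" using saddle_point[OF c] .
  define \<alpha> where "\<alpha> = (u - 1) / mw"
  define f where "f = 1 - \<alpha> - c * ln (\<theta> / u)"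
  have f0: "0 < f" using u by (simp add: f_def \<alpha>_def)
  define h where "h = f / (8 * ln u)"
  have h0: "0 < h" using f0 u by (simp add: h_def)
  \<comment> \<open>The probability of small weight sums before \<open>cutoff \<eta> N\<close> must stay negligible after multiplication by \<open>\<theta> ^ d\<close>, which can be as
    large as \<open>N powr (c * ln \<theta>)\<close>.\<close>
  define A where "A = (c * ln \<theta> + 1) / h"
  have A0: "0 \<le> A" using c theta_gt_1 h0 by (simp add: A_def)
  obtain s where s: "0 < s" "\<And>j. prob {\<omega> \<in> space M. S j \<omega> < s * real j} \<le> exp (- (A * real j))"
    using weight_sum_small_ball[of A] by blast
  define b where "b = (u - 1) / s"
  have b0: "0 < b" using u s by (simp add: b_def)
  define \<eta>2 where "\<eta>2 = f / (8 * (1 + b))"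
  have e2: "0 < \<eta>2" using f0 b0 by (simp add: \<eta>2_def)
  show ?thesis
  proof (intro exI[of _ \<eta>2] conjI allI impI e2)
    fix \<eta> and d :: "nat \<Rightarrow> nat"
    assume as: "0 < \<eta> \<and> \<eta> < \<eta>2 \<and> \<eta> < 1 \<and> (\<forall>\<^sub>F N in sequentially. real (d N) \<le> c * ln (real N))"
    then have \<eta>: "0 < \<eta>" "\<eta> < 1" "\<eta> < \<eta>2" and d: "\<forall>\<^sub>F N in sequentially. real (d N) \<le> c * ln (real N)" by auto
    have eb: "\<eta> + \<eta> * b < f / 8"
    proof -
      have "\<eta> * (1 + b) < \<eta>2 * (1 + b)" using \<eta> b0 by simp
      also have "\<dots> = f / 8" using b0 by (simp add: \<eta>2_def field_simps)
      finally show ?thesis by (simp add: algebra_simps)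
    qed
    define t0 where "t0 N = nat \<lceil>h * ln (real N)\<rceil>" for N :: nat
    define Y1 where "Y1 N = 2 * real N powr \<eta> * real N powr (- (c * ln \<theta> + 1)) * (real N powr (c * ln \<theta>) / real N)" for N :: nat
    define Y2 where "Y2 N = 4 * real N * exp (- 2 * real N powr (\<eta> / 2)) * (real N powr (c * ln \<theta>) / real N)" for N :: nat
    define Y3 where "Y3 N = (2 * real N powr \<eta>) * ((u * real N powr (h * ln u)) * ((2 * real N powr \<eta>) powr b * real N powr (\<alpha> + f / 8))) * (real N powr (c * ln (\<theta> / u)) / real N)" for N :: nat
    have Y1: "Y1 \<longlonglongrightarrow> 0"
    proof -
      have "(\<lambda>N. 2 * real N powr (\<eta> - 2)) \<longlonglongrightarrow> 0" using \<eta> by real_asymp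
      moreover have "\<forall>\<^sub>F N in sequentially. 2 * real N powr (\<eta> - 2) = Y1 N"
        using eventually_gt_at_top[of 0]
      proof eventually_elim
        case (elim N)
        have "Y1 N = 2 * (real N powr \<eta> * real N powr (- (c * ln \<theta> + 1)) * real N powr (c * ln \<theta>) * real N powr (-1))"
          using elim by (simp add: Y1_def powr_minus field_simps)
        also have "\<dots> = 2 * real N powr (\<eta> + - (c * ln \<theta> + 1) + c * ln \<theta> + -1)" by (simp only: powr_add)
        finally show ?case by simp
      qed
      ultimately show ?thesis by (rule Lim_transform_eventually)
    qed
    have Y2: "Y2 \<longlonglongrightarrow> 0"
      unfolding Y2_def[abs_def] using \<eta> by real_asymp
    have Y3: "Y3 \<longlonglongrightarrow> 0"
    proof -
      define e where "e = \<eta> + h * ln u + \<eta> * b + \<alpha> + f / 8 + c * ln (\<theta> / u) - 1"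
      have hu: "h * ln u = f / 8" using u by (simp add: h_def)
      have "c * ln (\<theta> / u) = 1 - \<alpha> - f" by (simp add: f_def)
      then have "e < 0" unfolding e_def using eb f0 hu by linarith
      then have "(\<lambda>N. (2 * u * 2 powr b) * real N powr e) \<longlonglongrightarrow> 0" by real_asymp
      moreover have "\<forall>\<^sub>F N in sequentially. (2 * u * 2 powr b) * real N powr e = Y3 N"
        using eventually_gt_at_top[of 0]
      proof eventually_elim
        case (elim N)
        have "Y3 N = (2 * u * 2 powr b) * (real N powr \<eta> * real N powr (h * ln u) * real N powr (\<eta> * b) * real N powr (\<alpha> + f / 8) * real N powr (c * ln (\<theta> / u)) * real N powr (-1))"
          using elim by (simp add: Y3_def powr_minus powr_mult powr_powr field_simps)
        also have "\<dots> = (2 * u * 2 powr b) * real N powr (\<eta> + h * ln u + \<eta> * b + (\<alpha> + f / 8) + c * ln (\<theta> / u) + -1)" by (simp only: powr_add)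
        finally show ?case by (simp add: e_def algebra_simps)
      qed
      ultimately show ?thesis by (rule Lim_transform_eventually)
    qed
    have ex: "\<forall>\<^sub>F N in sequentially. (u - 1) / (mw - tolerance \<eta> N) < \<alpha> + f / 8"
    proof -
      have "(\<lambda>N. (u - 1) / (mw - tolerance \<eta> N)) \<longlonglongrightarrow> (u - 1) / (mw - 0)"
        by (intro tendsto_intros tolerance_tendsto \<eta>) (use mw_bounds in auto)
      then show ?thesis using f0 by (intro order_tendstoD) (auto simp: \<alpha>_def)
    qed
    have t2: "\<forall>\<^sub>F N in sequentially. 2 \<le> t0 N" unfolding t0_def using h0 by real_asymp
    have tc: "\<forall>\<^sub>F N in sequentially. t0 N \<le> cutoff \<eta> N" unfolding t0_def cutoff_def using h0 \<eta> by real_asymp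
    have ub: "\<forall>\<^sub>F N in sequentially. prob {\<omega> \<in> space M. \<exists>v\<in>{1..cutoff \<eta> N}. d N \<le> deg N v \<omega>} * (\<theta> ^ d N / real N) \<le> Y1 N + Y2 N + Y3 N"
      using ex t2 tc d eventually_tolerance[OF \<eta>(1) mw_bounds(2)] cutoff_le[OF \<eta>(1,2)] cutoff_le_powr[OF \<eta>(1)] concentration_cutoff[OF \<eta>(1,2)] eventually_gt_at_top[of 1]
    proof eventually_elim
      case (elim N)
      define n0 where "n0 = cutoff \<eta> N"
      define t where "t = tolerance \<eta> N"
      have N: "1 < real N" "1 \<le> N" using elim by auto
      have n0: "real n0 \<le> 2 * real N powr \<eta>" "1 \<le> n0" using elim by (auto simp: n0_def)
      have thd: "\<theta> ^ d N \<le> real N powr (c * ln \<theta>)" using elim theta_gt_1 by (intro power_le_powr_N) auto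
      have "(\<theta> / u) ^ d N \<le> real N powr (c * ln (\<theta> / u))" using elim u by (intro power_le_powr_N) auto
      then have tud: "\<theta> ^ d N / u ^ d N \<le> real N powr (c * ln (\<theta> / u))" by (simp add: power_divide)
      have ht: "h * ln (real N) \<le> real (t0 N)" "real (t0 N) \<le> h * ln (real N) + 1"
      proof -
        have x0: "0 \<le> h * ln (real N)" using N h0 by simp
        show "h * ln (real N) \<le> real (t0 N)" by (simp add: t0_def real_nat_ceiling_ge)
        have "real (t0 N) = real_of_int \<lceil>h * ln (real N)\<rceil>" unfolding t0_def using x0 by (intro of_nat_nat) simp
        then show "real (t0 N) \<le> h * ln (real N) + 1" by linarith
      qed
      have eA: "exp (- (A * real (t0 N))) \<le> real N powr (- (c * ln \<theta> + 1))"
      proof -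
        have "(c * ln \<theta> + 1) * ln (real N) = A * (h * ln (real N))" using h0 by (simp add: A_def)
        also have "\<dots> \<le> A * real (t0 N)" using ht A0 by (intro mult_left_mono) auto
        finally have le: "(c * ln \<theta> + 1) * ln (real N) \<le> A * real (t0 N)" .
        have "real N powr (- (c * ln \<theta> + 1)) = exp (- ((c * ln \<theta> + 1) * ln (real N)))"
          using N by (simp only: powr_def mult_minus_left) simp
        then show ?thesis using le by (simp only: exp_le_cancel_iff neg_le_iff_le)
      qed
      have ut: "u ^ t0 N \<le> u * real N powr (h * ln u)"
      proof -
        have "u ^ t0 N = exp (real (t0 N) * ln u)" using u by (simp add: exp_of_nat_mult)
        also have "\<dots> \<le> exp ((h * ln (real N) + 1) * ln u)" using ht u by (simp add: mult_right_mono)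
        also have "(h * ln (real N) + 1) * ln u = h * ln u * ln (real N) + ln u" by (simp add: algebra_simps)
        also have "exp \<dots> = u * real N powr (h * ln u)" using u N by (simp add: powr_def exp_add)
        finally show ?thesis .
      qed
      have main: "prob {\<omega> \<in> space M. \<exists>v\<in>{1..n0}. d N \<le> deg N v \<omega>} \<le>
         real n0 * exp (- (A * real (t0 N))) + 4 * real N * exp (- 2 * t\<^sup>2 * real n0)
          + real n0 * (u ^ t0 N * (real n0 powr b * real N powr ((u - 1) / (mw - t))) / u ^ d N)"
        unfolding b_def by (rule early_vertices_bound[OF _ s A0]) (use elim u in \<open>auto simp: n0_def t_def\<close>)
      have p1: "real n0 * exp (- (A * real (t0 N))) \<le> 2 * real N powr \<eta> * real N powr (- (c * ln \<theta> + 1))"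
        using n0 eA by (intro mult_mono) auto
      have p2: "4 * real N * exp (- 2 * t\<^sup>2 * real n0) \<le> 4 * real N * exp (- 2 * real N powr (\<eta> / 2))"
        using elim by (simp add: t_def n0_def)
      have p3: "real n0 * (u ^ t0 N * (real n0 powr b * real N powr ((u - 1) / (mw - t)))) \<le>
         (2 * real N powr \<eta>) * ((u * real N powr (h * ln u)) * ((2 * real N powr \<eta>) powr b * real N powr (\<alpha> + f / 8)))"
      proof (intro mult_mono n0(1) ut powr_mono2 powr_mono)
        show "(u - 1) / (mw - t) \<le> \<alpha> + f / 8" using elim by (simp add: t_def)
      qed (use b0 u N n0 in auto)
      let ?T = "\<theta> ^ d N / real N"
      have T0: "0 \<le> ?T" "?T \<le> real N powr (c * ln \<theta>) / real N" using theta_gt_1 N thd by (auto intro: divide_right_mono)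
      have alg: "(a + b' + w * (c' / x)) * (t' / n) = a * (t' / n) + b' * (t' / n) + (w * c') * ((t' / x) / n)" for a b' c' w x t' n :: real
        unfolding distrib_right by simp
      have "prob {\<omega> \<in> space M. \<exists>v\<in>{1..n0}. d N \<le> deg N v \<omega>} * ?T \<le>
        (real n0 * exp (- (A * real (t0 N))) + 4 * real N * exp (- 2 * t\<^sup>2 * real n0)
          + real n0 * (u ^ t0 N * (real n0 powr b * real N powr ((u - 1) / (mw - t))) / u ^ d N)) * ?T"
        by (rule mult_right_mono[OF main T0(1)])
      also have "\<dots> = (real n0 * exp (- (A * real (t0 N)))) * ?T + (4 * real N * exp (- 2 * t\<^sup>2 * real n0)) * ?T
         + (real n0 * (u ^ t0 N * (real n0 powr b * real N powr ((u - 1) / (mw - t))))) * ((\<theta> ^ d N / u ^ d N) / real N)"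
        by (rule alg)
      also have "\<dots> \<le> Y1 N + Y2 N + Y3 N"
        unfolding Y1_def Y2_def Y3_def
        by (intro add_mono mult_mono p1 p2 p3 T0 divide_right_mono tud) (use T0 u theta_gt_1 in auto)
      finally show ?case by (simp add: n0_def)
    qed
    show "(\<lambda>N. prob {\<omega> \<in> space M. \<exists>v\<in>{1..cutoff \<eta> N}. d N \<le> deg N v \<omega>} * (\<theta> ^ d N / real N)) \<longlonglongrightarrow> 0"
    proof (rule tendsto_sandwich[OF _ ub tendsto_const])
      have "(\<lambda>N. Y1 N + Y2 N + Y3 N) \<longlonglongrightarrow> 0 + 0 + 0" by (intro tendsto_intros Y1 Y2 Y3)
      then show "(\<lambda>N. Y1 N + Y2 N + Y3 N) \<longlonglongrightarrow> 0" by simp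
    qed (use theta_gt_1 in \<open>auto intro!: always_eventually\<close>)
  qed
qed

text \<open>
  Markov's inequality for the number of vertices of the class on the typical event.
\<close>

lemma class_bound:
  assumes B: "B \<in> sets borel" "0 < tolerance \<eta> N" "1 \<le> cutoff \<eta> N"
  shows "prob {\<omega> \<in> space M. \<exists>v\<in>{cutoff \<eta> N<..N}. W v \<omega> \<in> B \<and> d \<le> deg N v \<omega>} \<le>
    prob (space M - typical B \<eta> N) + tuple_mean B \<eta> N {()} (\<lambda>_. d)"
proof -
  let ?U = "{cutoff \<eta> N<..N}"
  let ?E = "{\<omega> \<in> space M. \<exists>v\<in>?U. W v \<omega> \<in> B \<and> d \<le> deg N v \<omega>}"
  note B(1)[measurable]
  have E: "?E \<in> sets M"
  proof (rule sets.sets_Collect_finite_Ex)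
    fix v assume "v \<in> ?U"
    then have [measurable]: "W v \<in> borel_measurable M" using W_measurable[of v] by auto
    show "{\<omega> \<in> space M. W v \<omega> \<in> B \<and> d \<le> deg N v \<omega>} \<in> sets M" by measurable
  qed simp
  have "prob ?E \<le> prob ((space M - typical B \<eta> N) \<union> (typical B \<eta> N \<inter> ?E))"
    using E good_sets[OF B(1)] by (intro finite_measure_mono) auto
  also have "\<dots> \<le> prob (space M - typical B \<eta> N) + prob (typical B \<eta> N \<inter> ?E)"
    using E good_sets[OF B(1)] by (intro measure_Un_le) auto
  also have "prob (typical B \<eta> N \<inter> ?E) = (\<integral>\<omega>. indicator (typical B \<eta> N \<inter> ?E) \<omega> \<partial>M)"
    using E good_sets[OF B(1)] by simp
  also have "\<dots> \<le> tuple_mean B \<eta> N {()} (\<lambda>_. d)"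
    unfolding tuple_mean_def good_mean_def
  proof (rule integral_mono)
    show "integrable M (indicat_real (typical B \<eta> N \<inter> ?E))"
      using E good_sets[OF B(1)] by (intro integrable_real_indicator) (auto simp: less_top[symmetric])
    show "integrable M (\<lambda>\<omega>. indicator (typical B \<eta> N) \<omega> * tuples B (cutoff \<eta> N) N {()} (\<lambda>_. d) \<omega>)"
      by (rule integrable_good_tuples[OF B(1)]) simp
    fix \<omega>
    have t: "tuples B (cutoff \<eta> N) N {()} (\<lambda>_. d) \<omega> = (\<Sum>x\<in>?U. hit B N d \<omega> x)"
      unfolding tuples_def by (rule distinct_sum_single) simp
    have "1 \<le> (\<Sum>x\<in>?U. hit B N d \<omega> x)" if "\<omega> \<in> ?E"
    proof -
      from that obtain v where v: "v \<in> ?U" "W v \<omega> \<in> B" "d \<le> deg N v \<omega>" by blast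
      then have "1 = hit B N d \<omega> v" by (simp add: hit_def)
      also have "\<dots> \<le> (\<Sum>x\<in>?U. hit B N d \<omega> x)" by (rule member_le_sum) (use v in \<open>auto simp: hit_def\<close>)
      finally show ?thesis .
    qed
    then show "indicat_real (typical B \<eta> N \<inter> ?E) \<omega> \<le> indicator (typical B \<eta> N) \<omega> * tuples B (cutoff \<eta> N) N {()} (\<lambda>_. d) \<omega>"
      using tuples_nonneg[of B "cutoff \<eta> N" N "{()}" "\<lambda>_. d" \<omega>] by (auto simp: t indicator_def)
  qed
  finally show ?thesis by simp
qed

text \<open>
  Relative to \<open>N / \<theta> ^ d\<close>, the tail of vertices of weight at most \<open>r\<close> is geometric with ratio
  \<open>\<theta> * r / (r + mw)\<close>, which is below one for \<open>r < 1\<close> and equals one for \<open>r = 1\<close>.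
\<close>

lemma class_limsup:
  assumes B: "B \<in> sets borel" "\<And>x. x \<in> B \<Longrightarrow> x \<le> r" and r: "0 < r" and \<eta>: "0 < \<eta>" "\<eta> < 1"
    and d: "\<forall>\<^sub>F N in sequentially. real (d N) \<le> c * ln (real N)" and e: "0 < e"
  shows "\<forall>\<^sub>F N in sequentially. prob {\<omega> \<in> space M. \<exists>v\<in>{cutoff \<eta> N<..N}. W v \<omega> \<in> B \<and> d N \<le> deg N v \<omega>} * (\<theta> ^ d N / real N)
     \<le> e + (measure \<mu> B + e) * (\<theta> * r / (r + mw)) ^ d N"
proof -
  obtain X where X: "(\<lambda>N. X N / real N) \<longlonglongrightarrow> measure \<mu> B"
    "\<forall>\<^sub>F N in sequentially. tuple_mean B \<eta> N {()} (\<lambda>_. d N) \<le> X N ^ card {()} * (\<Prod>l\<in>{()}. (r / (r + mw)) ^ d N)"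
    using tuple_mean_upper[OF B r \<eta>, where 'i=unit] by fastforce
  have "\<forall>\<^sub>F N in sequentially. real N powr (c * ln \<theta>) * prob (space M - typical B \<eta> N) < e"
    using atypical_negligible[OF B(1) \<eta>] e by (intro order_tendstoD) auto
  moreover have "\<forall>\<^sub>F N in sequentially. X N / real N < measure \<mu> B + e"
    using X(1) e by (intro order_tendstoD) auto
  ultimately show ?thesis
    using X(2) d eventually_tolerance[OF \<eta>(1) zero_less_one] eventually_cutoff_ge[OF \<eta>(1), of 1] eventually_gt_at_top[of 1]
  proof eventually_elim
    case (elim N)
    let ?p = "prob {\<omega> \<in> space M. \<exists>v\<in>{cutoff \<eta> N<..N}. W v \<omega> \<in> B \<and> d N \<le> deg N v \<omega>}"
    have N: "1 < real N" "1 \<le> N" using elim by auto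
    have T0: "0 \<le> \<theta> ^ d N / real N" using theta_gt_1 by simp
    have "?p \<le> prob (space M - typical B \<eta> N) + X N * (r / (r + mw)) ^ d N"
      using class_bound[OF B(1), of \<eta> N "d N"] elim by auto
    then have "?p * (\<theta> ^ d N / real N) \<le> (prob (space M - typical B \<eta> N) + X N * (r / (r + mw)) ^ d N) * (\<theta> ^ d N / real N)"
      using T0 by (rule mult_right_mono)
    also have "\<dots> = \<theta> ^ d N / real N * prob (space M - typical B \<eta> N) + X N / real N * (\<theta> * r / (r + mw)) ^ d N"
      by (simp add: distrib_left distrib_right power_mult_distrib power_divide add_divide_distrib mult_ac)
    also have "\<dots> \<le> real N powr (c * ln \<theta>) * prob (space M - typical B \<eta> N) + (measure \<mu> B + e) * (\<theta> * r / (r + mw)) ^ d N"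
    proof (intro add_mono mult_right_mono)
      have "\<theta> ^ d N / real N \<le> \<theta> ^ d N / 1" using N theta_gt_1 by (intro divide_left_mono) auto
      also have "\<dots> \<le> real N powr (c * ln \<theta>)" using power_le_powr_N[of \<theta> "d N" c N] elim theta_gt_1 by simp
      finally show "\<theta> ^ d N / real N \<le> real N powr (c * ln \<theta>)" .
    qed (use elim r mw_bounds theta_gt_1 in auto)
    also have "\<dots> \<le> e + (measure \<mu> B + e) * (\<theta> * r / (r + mw)) ^ d N" using elim by simp
    finally show ?case .
  qed
qed

text \<open>
  Weights up to some \<open>r < 1\<close> have a tail that is smaller by a geometric factor. Weights strictly
  between \<open>r\<close> and 1 are bounded as if they were 1, but their probability vanishes as \<open>r\<close> tends to 1.
\<close>

lemma light_vertices_negligible: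
  assumes \<eta>: "0 < \<eta>" "\<eta> < 1" and d: "\<forall>\<^sub>F N in sequentially. real (d N) \<le> c * ln (real N)"
    and d': "filterlim d at_top sequentially"
  shows "(\<lambda>N. prob {\<omega> \<in> space M. \<exists>v\<in>{cutoff \<eta> N<..N}. W v \<omega> \<noteq> 1 \<and> d N \<le> deg N v \<omega>} * (\<theta> ^ d N / real N)) \<longlonglongrightarrow> 0"
proof (rule LIMSEQ_I)
  fix e :: real assume e: "0 < e"
  define e' where "e' = e / 8"
  have e': "0 < e'" using e by (simp add: e'_def)
  have "(\<lambda>i. measure \<mu> {1 - 1 / real (Suc i)<..<1}) \<longlonglongrightarrow> measure \<mu> (\<Inter>i. {1 - 1 / real (Suc i)<..<1})"
  proof (rule law.finite_Lim_measure_decseq)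
    show "decseq (\<lambda>i. {1 - 1 / real (Suc i)<..<(1::real)})"
      unfolding decseq_def
    proof (intro allI impI)
      fix m n :: nat assume "m \<le> n"
      then have "1 / real (Suc n) \<le> 1 / real (Suc m)" by (intro divide_left_mono) auto
      then show "{1 - 1 / real (Suc n)<..<(1::real)} \<subseteq> {1 - 1 / real (Suc m)<..<1}" by fastforce
    qed
    show "range (\<lambda>i. {1 - 1 / real (Suc i)<..<(1::real)}) \<subseteq> sets \<mu>" by auto
  qed
  also have "(\<Inter>i. {1 - 1 / real (Suc i)<..<(1::real)}) = {}"
  proof (rule ccontr)
    assume "(\<Inter>i. {1 - 1 / real (Suc i)<..<(1::real)}) \<noteq> {}"
    then obtain x where x0: "x \<in> (\<Inter>i. {1 - 1 / real (Suc i)<..<(1::real)})" by blast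
    have x: "1 - 1 / real (Suc i) < x" "x < 1" for i using INT_D[OF x0, of i] by auto
    obtain i where "1 / real (Suc i) < 1 - x" using x(2) nat_approx_posE[of "1 - x"] by auto
    then show False using x(1)[of i] by simp
  qed
  finally have "\<forall>\<^sub>F i in sequentially. measure \<mu> {1 - 1 / real (Suc i)<..<1} < e'" using e' by (intro order_tendstoD) auto
  then have "\<forall>\<^sub>F i in sequentially. measure \<mu> {1 - 1 / real (Suc i)<..<1} < e' \<and> 1 \<le> i" using eventually_ge_at_top by (rule eventually_conj)
  from eventually_happens'[OF sequentially_bot this] obtain i where i: "measure \<mu> {1 - 1 / real (Suc i)<..<1} < e'" "1 \<le> i" by auto
  define r where "r = 1 - 1 / real (Suc i)"
  have r: "0 < r" "r < 1" using i(2) by (auto simp: r_def)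
  define z where "z = \<theta> * r / (r + mw)"
  have z: "0 \<le> z" "z < 1"
  proof -
    show "0 \<le> z" using r mw_bounds theta_gt_1 by (simp add: z_def)
    have "r * mw < 1 * mw" using r mw_bounds by (intro mult_strict_right_mono) auto
    then show "z < 1" using r mw_bounds by (simp add: z_def theta_eq field_simps)
  qed
  have "(\<lambda>N. (measure \<mu> {0<..r} + e') * z ^ d N) \<longlonglongrightarrow> (measure \<mu> {0<..r} + e') * 0"
    using filterlim_compose[OF LIMSEQ_realpow_zero[OF z] d'] by (intro tendsto_intros)
  then have ev: "\<forall>\<^sub>F N in sequentially. (measure \<mu> {0<..r} + e') * z ^ d N < e'" using e' by (intro order_tendstoD) auto
  have c1: "\<forall>\<^sub>F N in sequentially. prob {\<omega> \<in> space M. \<exists>v\<in>{cutoff \<eta> N<..N}. W v \<omega> \<in> {r<..<1} \<and> d N \<le> deg N v \<omega>} * (\<theta> ^ d N / real N)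
     \<le> e' + (measure \<mu> {r<..<1} + e') * (\<theta> * 1 / (1 + mw)) ^ d N"
    by (rule class_limsup[OF _ _ _ \<eta> d e']) auto
  have c2: "\<forall>\<^sub>F N in sequentially. prob {\<omega> \<in> space M. \<exists>v\<in>{cutoff \<eta> N<..N}. W v \<omega> \<in> {0<..r} \<and> d N \<le> deg N v \<omega>} * (\<theta> ^ d N / real N)
     \<le> e' + (measure \<mu> {0<..r} + e') * (\<theta> * r / (r + mw)) ^ d N"
    by (rule class_limsup[OF _ _ r(1) \<eta> d e']) auto
  have "\<forall>\<^sub>F N in sequentially. norm (prob {\<omega> \<in> space M. \<exists>v\<in>{cutoff \<eta> N<..N}. W v \<omega> \<noteq> 1 \<and> d N \<le> deg N v \<omega>} * (\<theta> ^ d N / real N) - 0) < e"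
    using c1 c2 ev eventually_gt_at_top[of 0]
  proof eventually_elim
    case (elim N)
    let ?E = "\<lambda>P. {\<omega> \<in> space M. \<exists>v\<in>{cutoff \<eta> N<..N}. P (W v \<omega>) \<and> d N \<le> deg N v \<omega>}"
    have E: "?E P \<in> sets M" if [measurable]: "Measurable.pred borel P" for P :: "real \<Rightarrow> bool"
    proof (rule sets.sets_Collect_finite_Ex)
      fix v assume "v \<in> {cutoff \<eta> N<..N}"
      then have [measurable]: "W v \<in> borel_measurable M" using W_measurable[of v] by auto
      show "{\<omega> \<in> space M. P (W v \<omega>) \<and> d N \<le> deg N v \<omega>} \<in> sets M" by measurable
    qed simp
    have "prob (?E (\<lambda>w. w \<noteq> 1)) \<le> prob (?E (\<lambda>w. w \<in> {r<..<1}) \<union> ?E (\<lambda>w. w \<in> {0<..r}))"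
    proof (rule finite_measure_mono_AE)
      show "AE \<omega> in M. \<omega> \<in> ?E (\<lambda>w. w \<noteq> 1) \<longrightarrow> \<omega> \<in> ?E (\<lambda>w. w \<in> {r<..<1}) \<union> ?E (\<lambda>w. w \<in> {0<..r})"
        using AE_weights
      proof eventually_elim
        case (elim \<omega>)
        show ?case
        proof
          assume "\<omega> \<in> ?E (\<lambda>w. w \<noteq> 1)"
          then obtain v where v: "\<omega> \<in> space M" "v \<in> {cutoff \<eta> N<..N}" "W v \<omega> \<noteq> 1" "d N \<le> deg N v \<omega>" by blast
          then have "W v \<omega> \<in> {0<..1}" using elim by auto
          then have "W v \<omega> \<in> {r<..<1} \<or> W v \<omega> \<in> {0<..r}" using v(3) by auto
          then show "\<omega> \<in> ?E (\<lambda>w. w \<in> {r<..<1}) \<union> ?E (\<lambda>w. w \<in> {0<..r})" using v by blast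
        qed
      qed
    qed (intro sets.Un E; measurable)
    also have "\<dots> \<le> prob (?E (\<lambda>w. w \<in> {r<..<1})) + prob (?E (\<lambda>w. w \<in> {0<..r}))"
      by (intro measure_Un_le E; measurable)
    finally have le: "prob (?E (\<lambda>w. w \<noteq> 1)) \<le> prob (?E (\<lambda>w. w \<in> {r<..<1})) + prob (?E (\<lambda>w. w \<in> {0<..r}))" .
    have T0: "0 \<le> \<theta> ^ d N / real N" using theta_gt_1 by simp
    have th1: "\<theta> * 1 / (1 + mw) = 1" using theta_gt_1 by (simp add: theta_eq)
    have "prob (?E (\<lambda>w. w \<noteq> 1)) * (\<theta> ^ d N / real N) \<le> (prob (?E (\<lambda>w. w \<in> {r<..<1})) + prob (?E (\<lambda>w. w \<in> {0<..r}))) * (\<theta> ^ d N / real N)"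
      using le T0 by (rule mult_right_mono)
    also have "\<dots> = prob (?E (\<lambda>w. w \<in> {r<..<1})) * (\<theta> ^ d N / real N) + prob (?E (\<lambda>w. w \<in> {0<..r})) * (\<theta> ^ d N / real N)"
      by (rule distrib_right)
    also have "\<dots> \<le> (e' + (measure \<mu> {r<..<1} + e') * 1) + (e' + (measure \<mu> {0<..r} + e') * z ^ d N)"
      by (rule add_mono[OF elim(1)[unfolded th1 power_one] elim(2)[folded z_def]])
    also have "\<dots> < e" using elim(3) i(1) e by (simp add: r_def e'_def)
    finally show ?case
      by (simp only: diff_zero real_norm_def abs_of_nonneg[OF mult_nonneg_nonneg[OF measure_nonneg T0]])
  qed
  then show "\<exists>no. \<forall>N\<ge>no. norm (prob {\<omega> \<in> space M. \<exists>v\<in>{cutoff \<eta> N<..N}. W v \<omega> \<noteq> 1 \<and> d N \<le> deg N v \<omega>} * (\<theta> ^ d N / real N) - 0) < e"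
    by (simp add: eventually_sequentially)
qed

section \<open>Factorial moments and their consequences\<close>

definition above :: "nat \<Rightarrow> nat \<Rightarrow> 'a \<Rightarrow> nat set" where
  "above N d \<omega> = {x \<in> {1..N}. d \<le> deg N x \<omega>}"

definition late_heavy :: "real \<Rightarrow> nat \<Rightarrow> nat \<Rightarrow> 'a \<Rightarrow> nat set" where
  "late_heavy \<eta> N d \<omega> = {x \<in> {cutoff \<eta> N<..N}. W x \<omega> = 1 \<and> d \<le> deg N x \<omega>}"

text \<open>
  Outside this event the vertices of degree at least \<open>d\<close> are late and have weight one
  (\<open>above_eq_late_heavy\<close>), and the weights are concentrated.
\<close>

definition atypical :: "real \<Rightarrow> nat \<Rightarrow> nat \<Rightarrow> 'a set" where
  "atypical \<eta> N d = (space M - typical {1} \<eta> N) \<union> {\<omega> \<in> space M. \<exists>v\<in>{1..cutoff \<eta> N}. d \<le> deg N v \<omega>}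
     \<union> {\<omega> \<in> space M. \<exists>v\<in>{cutoff \<eta> N<..N}. W v \<omega> \<noteq> 1 \<and> d \<le> deg N v \<omega>}"

text \<open>
  The approximate mean of the number of vertices of degree at least \<open>d\<close>.
\<close>

definition mean_above :: "nat \<Rightarrow> nat \<Rightarrow> real" where
  "mean_above N d = q * real N * (1 / \<theta>) ^ d"

lemma mean_above_pos: "0 < N \<Longrightarrow> 0 < mean_above N d"
  using atom_pos theta_gt_1 by (simp add: mean_above_def)

lemma finite_above [simp]: "finite (above N d \<omega>)" by (simp add: above_def)
lemma finite_late_heavy [simp]: "finite (late_heavy \<eta> N d \<omega>)" by (simp add: late_heavy_def)

lemma card_measurable:
  assumes "finite U" "\<And>x. x \<in> U \<Longrightarrow> {\<omega> \<in> space M. P x \<omega>} \<in> sets M"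
  shows "(\<lambda>\<omega>. card {x \<in> U. P x \<omega>}) \<in> measurable M (count_space UNIV)"
proof -
  have "(\<lambda>\<omega>. \<Sum>x\<in>U. of_bool (P x \<omega>) :: nat) \<in> measurable M (count_space UNIV)"
  proof (rule measurable_sum_nat)
    fix x assume "x \<in> U"
    then have [measurable]: "Measurable.pred M (P x)" using assms(2) by (simp add: pred_def)
    show "(\<lambda>\<omega>. of_bool (P x \<omega>) :: nat) \<in> measurable M (count_space UNIV)" by measurable
  qed
  then show ?thesis using assms(1) by (simp add: of_bool_def sum.If_cases Int_def)
qed

lemma card_above_measurable [measurable]: "(\<lambda>\<omega>. card (above N d \<omega>)) \<in> measurable M (count_space UNIV)"
  unfolding above_def by (rule card_measurable) auto

lemma W_eq_event:
  assumes "1 \<le> x" shows "{\<omega> \<in> space M. W x \<omega> = 1 \<and> d \<le> deg N x \<omega>} \<in> sets M"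
    "{\<omega> \<in> space M. W x \<omega> \<noteq> 1 \<and> d \<le> deg N x \<omega>} \<in> sets M"
    "{\<omega> \<in> space M. W x \<omega> = 1 \<and> deg N x \<omega> = d} \<in> sets M"
proof -
  note W_measurable[OF assms, measurable]
  show "{\<omega> \<in> space M. W x \<omega> = 1 \<and> d \<le> deg N x \<omega>} \<in> sets M"
    "{\<omega> \<in> space M. W x \<omega> \<noteq> 1 \<and> d \<le> deg N x \<omega>} \<in> sets M"
    "{\<omega> \<in> space M. W x \<omega> = 1 \<and> deg N x \<omega> = d} \<in> sets M" by measurable
qed

lemma card_late_heavy_measurable [measurable]: "(\<lambda>\<omega>. card (late_heavy \<eta> N d \<omega>)) \<in> measurable M (count_space UNIV)"
  unfolding late_heavy_def by (rule card_measurable) (auto intro!: W_eq_event)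

lemma late_heavy_exact:
  "late_heavy \<eta> N d \<omega> - late_heavy \<eta> N (Suc d) \<omega> = {x \<in> {cutoff \<eta> N<..N}. W x \<omega> = 1 \<and> deg N x \<omega> = d}"
  by (auto simp: late_heavy_def)

lemma card_late_exact_measurable [measurable]:
  "(\<lambda>\<omega>. card (late_heavy \<eta> N d \<omega> - late_heavy \<eta> N (Suc d) \<omega>)) \<in> measurable M (count_space UNIV)"
  unfolding late_heavy_exact by (rule card_measurable) (auto intro!: W_eq_event)

lemma atypical_sets [measurable]: "atypical \<eta> N d \<in> sets M"
  unfolding atypical_def
  by (intro sets.Un sets.compl_sets good_sets sets.sets_Collect_finite_Ex W_eq_event; auto)

lemma above_eq_late_heavy:
  assumes "\<omega> \<in> space M" "\<omega> \<notin> atypical \<eta> N d" "cutoff \<eta> N \<le> N" "d \<le> e"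
  shows "above N e \<omega> = late_heavy \<eta> N e \<omega>"
proof
  show "late_heavy \<eta> N e \<omega> \<subseteq> above N e \<omega>" by (auto simp: late_heavy_def above_def)
  show "above N e \<omega> \<subseteq> late_heavy \<eta> N e \<omega>"
  proof
    fix x assume "x \<in> above N e \<omega>"
    then have x: "1 \<le> x" "x \<le> N" "e \<le> deg N x \<omega>" "d \<le> deg N x \<omega>" using assms(4) by (auto simp: above_def)
    then have "cutoff \<eta> N < x" using assms(1,2) by (auto simp: atypical_def not_less)
    then show "x \<in> late_heavy \<eta> N e \<omega>" using assms(1,2) x by (auto simp: atypical_def late_heavy_def)
  qed
qed

lemma prob_diff_le:
  assumes "A \<in> sets M" "B \<in> sets M" "C \<in> sets M" "A - B \<subseteq> C" "B - A \<subseteq> C"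
  shows "\<bar>prob A - prob B\<bar> \<le> prob C"
proof -
  have "prob A \<le> prob (B \<union> C)" "prob B \<le> prob (A \<union> C)" using assms by (auto intro!: finite_measure_mono)
  moreover have "prob (B \<union> C) \<le> prob B + prob C" "prob (A \<union> C) \<le> prob A + prob C" using assms by (auto intro!: measure_Un_le)
  ultimately show ?thesis by linarith
qed

lemma mean_above_inverse: "0 < N \<Longrightarrow> 1 / mean_above N d = (\<theta> ^ d / real N) / q"
  using theta_gt_1 atom_pos by (simp add: mean_above_def power_one_over field_simps)

lemma atypical_over_mean:
  assumes \<eta>: "0 < \<eta>" "\<eta> < 1" and d: "\<forall>\<^sub>F N in sequentially. real (d N) \<le> c * ln (real N)"
    and d': "filterlim d at_top sequentially"
    and early: "(\<lambda>N. prob {\<omega> \<in> space M. \<exists>v\<in>{1..cutoff \<eta> N}. d N \<le> deg N v \<omega>} * (\<theta> ^ d N / real N)) \<longlonglongrightarrow> 0"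
  shows "(\<lambda>N. prob (atypical \<eta> N (d N)) / mean_above N (d N)) \<longlonglongrightarrow> 0"
proof -
  let ?E1 = "\<lambda>N. {\<omega> \<in> space M. \<exists>v\<in>{1..cutoff \<eta> N}. d N \<le> deg N v \<omega>}"
  let ?E2 = "\<lambda>N. {\<omega> \<in> space M. \<exists>v\<in>{cutoff \<eta> N<..N}. W v \<omega> \<noteq> 1 \<and> d N \<le> deg N v \<omega>}"
  have E: "?E1 N \<in> sets M" "?E2 N \<in> sets M" for N
    by (intro sets.sets_Collect_finite_Ex W_eq_event; auto)+
  have lim: "(\<lambda>N. (real N powr (c * ln \<theta>) * prob (space M - typical {1} \<eta> N) + prob (?E1 N) * (\<theta> ^ d N / real N) + prob (?E2 N) * (\<theta> ^ d N / real N)) / q) \<longlonglongrightarrow> (0 + 0 + 0) / q"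
    by (intro tendsto_intros atypical_negligible early light_vertices_negligible[OF \<eta> d d'] \<eta>) (use atom_pos in auto)
  show ?thesis
  proof (rule tendsto_sandwich[OF _ _ tendsto_const])
    show "\<forall>\<^sub>F N in sequentially. 0 \<le> prob (atypical \<eta> N (d N)) / mean_above N (d N)"
      using eventually_gt_at_top[of 0] by eventually_elim (auto intro!: divide_nonneg_pos mean_above_pos)
    show "\<forall>\<^sub>F N in sequentially. prob (atypical \<eta> N (d N)) / mean_above N (d N) \<le>
       (real N powr (c * ln \<theta>) * prob (space M - typical {1} \<eta> N) + prob (?E1 N) * (\<theta> ^ d N / real N) + prob (?E2 N) * (\<theta> ^ d N / real N)) / q"
      using eventually_gt_at_top[of 0] d
    proof eventually_elim
      case (elim N)
      have N: "1 \<le> real N" "0 < N" using elim by auto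
      have T0: "0 \<le> \<theta> ^ d N / real N" using theta_gt_1 by simp
      have T1: "\<theta> ^ d N / real N \<le> real N powr (c * ln \<theta>)"
      proof -
        have "\<theta> ^ d N / real N \<le> \<theta> ^ d N / 1" using N theta_gt_1 by (intro divide_left_mono) auto
        also have "\<dots> \<le> real N powr (c * ln \<theta>)" using power_le_powr_N[of \<theta> "d N" c N] elim theta_gt_1 by simp
        finally show ?thesis .
      qed
      have "prob (atypical \<eta> N (d N)) \<le> prob ((space M - typical {1} \<eta> N) \<union> ?E1 N) + prob (?E2 N)"
        unfolding atypical_def by (intro measure_Un_le sets.Un sets.compl_sets good_sets E) simp
      also have "prob ((space M - typical {1} \<eta> N) \<union> ?E1 N) \<le> prob (space M - typical {1} \<eta> N) + prob (?E1 N)"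
        by (intro measure_Un_le sets.compl_sets good_sets E) simp
      finally have "prob (atypical \<eta> N (d N)) \<le> prob (space M - typical {1} \<eta> N) + prob (?E1 N) + prob (?E2 N)" by simp
      then have "prob (atypical \<eta> N (d N)) * (\<theta> ^ d N / real N) \<le> (prob (space M - typical {1} \<eta> N) + prob (?E1 N) + prob (?E2 N)) * (\<theta> ^ d N / real N)"
        using T0 by (rule mult_right_mono)
      also have "\<dots> = (\<theta> ^ d N / real N) * prob (space M - typical {1} \<eta> N) + prob (?E1 N) * (\<theta> ^ d N / real N) + prob (?E2 N) * (\<theta> ^ d N / real N)"
        unfolding distrib_right by simp
      also have "\<dots> \<le> real N powr (c * ln \<theta>) * prob (space M - typical {1} \<eta> N) + prob (?E1 N) * (\<theta> ^ d N / real N) + prob (?E2 N) * (\<theta> ^ d N / real N)"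
        by (intro add_right_mono mult_right_mono T1) auto
      finally have "prob (atypical \<eta> N (d N)) * (\<theta> ^ d N / real N) / q \<le> (real N powr (c * ln \<theta>) * prob (space M - typical {1} \<eta> N) + prob (?E1 N) * (\<theta> ^ d N / real N) + prob (?E2 N) * (\<theta> ^ d N / real N)) / q"
        using atom_pos by (intro divide_right_mono) auto
      moreover have "prob (atypical \<eta> N (d N)) / mean_above N (d N) = prob (atypical \<eta> N (d N)) * (\<theta> ^ d N / real N) / q"
        using mean_above_inverse[OF N(2), of "d N"] by (metis mult.right_neutral times_divide_eq_right)
      ultimately show ?case by simp
    qed
  qed (use lim in simp)
qed

text \<open>
  Up to the factor \<open>fact k * fact r\<close>, the expected number of tuples of distinct vertices with \<open>k\<close> entries of
  degree exactly \<open>d\<close> and \<open>r\<close> further entries of degree at least \<open>d\<close>.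
\<close>

definition factorial_moment :: "real \<Rightarrow> nat \<Rightarrow> nat \<Rightarrow> nat \<Rightarrow> nat \<Rightarrow> real" where
  "factorial_moment \<eta> N d k r = (\<integral>\<omega>. indicator (typical {1} \<eta> N) \<omega> *
     (real (card (late_heavy \<eta> N d \<omega> - late_heavy \<eta> N (Suc d) \<omega>) choose k) *
      real ((card (late_heavy \<eta> N d \<omega>) - k) choose r)) \<partial>M)"

text \<open>
  The indicator of degree exactly \<open>d\<close> is the difference of those of degree at least \<open>d\<close> and at least
  \<open>d + 1\<close>. Expanding the product over the first \<open>k\<close> entries leaves tuples that have only lower thresholds;
  \<open>Bs\<close> is the set of entries with threshold \<open>d + 1\<close>, and \<open>s\<close> vanishes unless \<open>Bs\<close> lies in the
  first \<open>k\<close> entries.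
\<close>

lemma factorial_moment_expand:
  defines "s \<equiv> \<lambda>k Bs. \<Prod>l\<in>Bs. if l < k then -1 else (0::real)"
  shows "fact k * fact r * factorial_moment \<eta> N d k r =
    (\<Sum>Bs\<in>Pow {..<k + r}. s k Bs * tuple_mean {1} \<eta> N {..<k + r} (\<lambda>l. d + of_bool (l \<in> Bs)))"
proof -
  let ?U = "{cutoff \<eta> N<..N}" and ?I = "{..<k + r}"
  have point: "fact k * fact r * (real (card (late_heavy \<eta> N d \<omega> - late_heavy \<eta> N (Suc d) \<omega>) choose k) *
      real ((card (late_heavy \<eta> N d \<omega>) - k) choose r)) =
     (\<Sum>Bs\<in>Pow ?I. s k Bs * tuples {1} (cutoff \<eta> N) N ?I (\<lambda>l. d + of_bool (l \<in> Bs)) \<omega>)" for \<omega>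
  proof -
    let ?Z = "late_heavy \<eta> N d \<omega>" and ?X = "late_heavy \<eta> N d \<omega> - late_heavy \<eta> N (Suc d) \<omega>"
    let ?h = "\<lambda>d x. hit {1} N d \<omega> x"
    let ?f = "\<lambda>l x. - (if l < k then ?h (Suc d) x else 0)"
    have I: "?I = {..<k} \<union> {k..<k + r}" by auto
    have "fact k * fact r * (real (card ?X choose k) * real ((card ?Z - k) choose r)) =
       distinct_sum ?U ({..<k} \<union> {k..<k + r}) (\<lambda>l x. of_bool (x \<in> (if l \<in> {..<k} then ?X else ?Z)))"
      by (subst distinct_sum_two_levels) (auto simp: late_heavy_def)
    also have "\<dots> = distinct_sum ?U ?I (\<lambda>l x. ?f l x + ?h d x)"
      unfolding I by (rule distinct_sum_cong) (auto simp: late_heavy_def hit_def)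
    also have "\<dots> = (\<Sum>v\<in>inj_maps ?I ?U. \<Sum>Bs\<in>Pow ?I. (\<Prod>l\<in>Bs. ?f l (v l)) * (\<Prod>l\<in>?I - Bs. ?h d (v l)))"
      unfolding distinct_sum_def by (intro sum.cong refl prod_add) simp
    also have "\<dots> = (\<Sum>v\<in>inj_maps ?I ?U. \<Sum>Bs\<in>Pow ?I. s k Bs * (\<Prod>l\<in>?I. ?h (d + of_bool (l \<in> Bs)) (v l)))"
    proof (intro sum.cong refl)
      fix v Bs assume Bs: "Bs \<in> Pow ?I"
      have fin: "finite Bs" using Bs finite_subset[of Bs ?I] by auto
      have "(\<Prod>l\<in>?I. ?h (d + of_bool (l \<in> Bs)) (v l)) = (\<Prod>l\<in>?I - Bs. ?h (d + of_bool (l \<in> Bs)) (v l)) * (\<Prod>l\<in>Bs. ?h (d + of_bool (l \<in> Bs)) (v l))"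
        using Bs by (intro prod.subset_diff) auto
      also have "(\<Prod>l\<in>?I - Bs. ?h (d + of_bool (l \<in> Bs)) (v l)) = (\<Prod>l\<in>?I - Bs. ?h d (v l))" by (rule prod.cong) auto
      also have "(\<Prod>l\<in>Bs. ?h (d + of_bool (l \<in> Bs)) (v l)) = (\<Prod>l\<in>Bs. ?h (Suc d) (v l))" by (rule prod.cong) auto
      finally have e1: "(\<Prod>l\<in>?I. ?h (d + of_bool (l \<in> Bs)) (v l)) = (\<Prod>l\<in>?I - Bs. ?h d (v l)) * (\<Prod>l\<in>Bs. ?h (Suc d) (v l))" .
      have e2: "(\<Prod>l\<in>Bs. ?f l (v l)) = s k Bs * (\<Prod>l\<in>Bs. ?h (Suc d) (v l))"
        unfolding s_def prod.distrib[symmetric] by (rule prod.cong) auto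
      show "(\<Prod>l\<in>Bs. ?f l (v l)) * (\<Prod>l\<in>?I - Bs. ?h d (v l)) = s k Bs * (\<Prod>l\<in>?I. ?h (d + of_bool (l \<in> Bs)) (v l))"
        unfolding e1 e2 by (simp only: mult_ac)
    qed
    also have "\<dots> = (\<Sum>Bs\<in>Pow ?I. s k Bs * tuples {1} (cutoff \<eta> N) N ?I (\<lambda>l. d + of_bool (l \<in> Bs)) \<omega>)"
      by (subst sum.swap) (simp add: tuples_def distinct_sum_def sum_distrib_left)
    finally show ?thesis .
  qed
  have "fact k * fact r * factorial_moment \<eta> N d k r = (\<integral>\<omega>. indicator (typical {1} \<eta> N) \<omega> *
     (fact k * fact r * (real (card (late_heavy \<eta> N d \<omega> - late_heavy \<eta> N (Suc d) \<omega>) choose k) *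
      real ((card (late_heavy \<eta> N d \<omega>) - k) choose r))) \<partial>M)"
    unfolding factorial_moment_def
    by (subst Bochner_Integration.integral_mult_right_zero[symmetric]) (simp only: mult_ac)
  also have "\<dots> = (\<integral>\<omega>. (\<Sum>Bs\<in>Pow ?I. s k Bs * (indicator (typical {1} \<eta> N) \<omega> * tuples {1} (cutoff \<eta> N) N ?I (\<lambda>l. d + of_bool (l \<in> Bs)) \<omega>)) \<partial>M)"
    unfolding point sum_distrib_left by (simp only: mult_ac)
  also have "\<dots> = (\<Sum>Bs\<in>Pow ?I. s k Bs * tuple_mean {1} \<eta> N ?I (\<lambda>l. d + of_bool (l \<in> Bs)))"
    unfolding tuple_mean_def good_mean_def
    by (subst Bochner_Integration.integral_sum) (auto intro!: integrable_mult_right integrable_good_tuples)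
  finally show ?thesis .
qed

text \<open>
  The asymptotics of \<open>tuple_mean_asymp\<close> at one fixed \<open>\<eta>\<close>.
\<close>

definition tuple_regime :: "real \<Rightarrow> real \<Rightarrow> bool" where
  "tuple_regime c \<eta> \<longleftrightarrow> (\<forall>(I :: nat set) m. finite I \<longrightarrow> (\<forall>l\<in>I. \<forall>\<^sub>F N in sequentially. real (m N l) \<le> c * ln (real N))
     \<longrightarrow> (\<lambda>N. tuple_mean {1} \<eta> N I (m N) / (\<Prod>l\<in>I. q * real N * (1 / \<theta>) ^ m N l)) \<longlonglongrightarrow> 1)"

text \<open>
  Each raised threshold contributes a factor \<open>1 / \<theta>\<close>, so the alternating sum over \<open>Bs\<close> is the expansion of
  \<open>(1 - 1 / \<theta>) ^ k\<close>.
\<close>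

lemma factorial_moment_asymp:
  assumes reg: "tuple_regime c \<eta>" and d: "\<forall>\<^sub>F N in sequentially. real (Suc (d N)) \<le> c * ln (real N)"
  shows "(\<lambda>N. fact k * fact r * factorial_moment \<eta> N (d N) k r / mean_above N (d N) ^ (k + r)) \<longlonglongrightarrow> (1 - 1 / \<theta>) ^ k"
proof -
  let ?I = "{..<k + r}"
  define s where "s Bs = (\<Prod>l\<in>Bs. if l < k then -1 else (0::real))" for Bs :: "nat set"
  define m where "m Bs N l = d N + of_bool (l \<in> Bs)" for Bs :: "nat set" and N l
  have lim: "(\<lambda>N. tuple_mean {1} \<eta> N ?I (m Bs N) / mean_above N (d N) ^ (k + r)) \<longlonglongrightarrow> (1 / \<theta>) ^ card Bs" if Bs: "Bs \<in> Pow ?I" for Bs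
  proof -
    have "\<forall>l\<in>?I. \<forall>\<^sub>F N in sequentially. real (m Bs N l) \<le> c * ln (real N)"
    proof
      fix l
      show "\<forall>\<^sub>F N in sequentially. real (m Bs N l) \<le> c * ln (real N)"
        using d by eventually_elim (auto simp: m_def of_bool_def)
    qed
    then have "(\<lambda>N. tuple_mean {1} \<eta> N ?I (m Bs N) / (\<Prod>l\<in>?I. q * real N * (1 / \<theta>) ^ m Bs N l)) \<longlonglongrightarrow> 1"
      using reg unfolding tuple_regime_def by blast
    then have "(\<lambda>N. (1 / \<theta>) ^ card Bs * (tuple_mean {1} \<eta> N ?I (m Bs N) / (\<Prod>l\<in>?I. q * real N * (1 / \<theta>) ^ m Bs N l))) \<longlonglongrightarrow> (1 / \<theta>) ^ card Bs * 1"
      by (intro tendsto_intros)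
    moreover have "\<forall>\<^sub>F N in sequentially. (1 / \<theta>) ^ card Bs * (tuple_mean {1} \<eta> N ?I (m Bs N) / (\<Prod>l\<in>?I. q * real N * (1 / \<theta>) ^ m Bs N l)) =
       tuple_mean {1} \<eta> N ?I (m Bs N) / mean_above N (d N) ^ (k + r)"
    proof (rule always_eventually, rule allI)
      fix N
      have "(\<Prod>l\<in>?I. q * real N * (1 / \<theta>) ^ m Bs N l) = (\<Prod>l\<in>?I. mean_above N (d N) * (if l \<in> Bs then 1 / \<theta> else 1))"
        by (rule prod.cong) (auto simp: m_def mean_above_def)
      also have "\<dots> = mean_above N (d N) ^ (k + r) * (1 / \<theta>) ^ card Bs"
      proof -
        have "?I \<inter> Bs = Bs" using Bs by auto
        then show ?thesis unfolding prod.distrib by (simp add: prod.If_cases)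
      qed
      finally have e: "(\<Prod>l\<in>?I. q * real N * (1 / \<theta>) ^ m Bs N l) = mean_above N (d N) ^ (k + r) * (1 / \<theta>) ^ card Bs" .
      show "(1 / \<theta>) ^ card Bs * (tuple_mean {1} \<eta> N ?I (m Bs N) / (\<Prod>l\<in>?I. q * real N * (1 / \<theta>) ^ m Bs N l)) =
       tuple_mean {1} \<eta> N ?I (m Bs N) / mean_above N (d N) ^ (k + r)"
        unfolding e using theta_gt_1 by (simp add: power_one_over)
    qed
    ultimately have "(\<lambda>N. tuple_mean {1} \<eta> N ?I (m Bs N) / mean_above N (d N) ^ (k + r)) \<longlonglongrightarrow> (1 / \<theta>) ^ card Bs * 1"
      by (rule Lim_transform_eventually)
    then show ?thesis by simp
  qed
  have "(\<lambda>N. \<Sum>Bs\<in>Pow ?I. s Bs * (tuple_mean {1} \<eta> N ?I (m Bs N) / mean_above N (d N) ^ (k + r))) \<longlonglongrightarrow> (\<Sum>Bs\<in>Pow ?I. s Bs * (1 / \<theta>) ^ card Bs)"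
    by (intro tendsto_sum tendsto_mult tendsto_const lim)
  also have "(\<Sum>Bs\<in>Pow ?I. s Bs * (1 / \<theta>) ^ card Bs) = (\<Prod>l\<in>?I. (if l < k then - 1 else 0) * (1 / \<theta>) + 1)"
    by (simp only: s_def prod_add[OF finite_lessThan] prod.distrib prod_constant power_one mult_1_right)
  also have "\<dots> = (\<Prod>l\<in>{..<k}. 1 - 1 / \<theta>)"
    by (rule prod.mono_neutral_cong_right) auto
  also have "\<dots> = (1 - 1 / \<theta>) ^ k" by simp
  also have "(\<lambda>N. \<Sum>Bs\<in>Pow ?I. s Bs * (tuple_mean {1} \<eta> N ?I (m Bs N) / mean_above N (d N) ^ (k + r))) =
     (\<lambda>N. fact k * fact r * factorial_moment \<eta> N (d N) k r / mean_above N (d N) ^ (k + r))"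
    unfolding factorial_moment_expand sum_divide_distrib s_def m_def by simp
  finally show ?thesis .
qed

lemma card_late_heavy_le: "card (late_heavy \<eta> N d \<omega>) \<le> N"
proof -
  have "card (late_heavy \<eta> N d \<omega>) \<le> card {1..N}" by (rule card_mono) (auto simp: late_heavy_def)
  then show ?thesis by simp
qed

lemma integrable_moment:
  "integrable M (\<lambda>\<omega>. indicator (typical {1} \<eta> N) \<omega> *
     (real (card (late_heavy \<eta> N d \<omega> - late_heavy \<eta> N (Suc d) \<omega>) choose k) *
      real ((card (late_heavy \<eta> N d \<omega>) - k) choose r)))"
proof (rule integrable_bounded_M)
  show "(\<lambda>\<omega>. indicator (typical {1} \<eta> N) \<omega> *
     (real (card (late_heavy \<eta> N d \<omega> - late_heavy \<eta> N (Suc d) \<omega>) choose k) *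
      real ((card (late_heavy \<eta> N d \<omega>) - k) choose r))) \<in> borel_measurable M" by measurable
  fix \<omega>
  have b: "real (n choose j) \<le> 2 ^ N" if "n \<le> N" for n j
  proof -
    have "n choose j \<le> 2 ^ n" by (rule binomial_le_pow2)
    also have "(2::nat) ^ n \<le> 2 ^ N" using that by (rule power_increasing) simp
    finally show ?thesis by (metis of_nat_le_iff of_nat_numeral of_nat_power)
  qed
  have "card (late_heavy \<eta> N d \<omega> - late_heavy \<eta> N (Suc d) \<omega>) \<le> card (late_heavy \<eta> N d \<omega>)" by (rule card_mono) auto
  then have "real (card (late_heavy \<eta> N d \<omega> - late_heavy \<eta> N (Suc d) \<omega>) choose k) * real ((card (late_heavy \<eta> N d \<omega>) - k) choose r) \<le> 2 ^ N * 2 ^ N"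
    using card_late_heavy_le[of \<eta> N d \<omega>] by (intro mult_mono b) auto
  then show "\<bar>indicator (typical {1} \<eta> N) \<omega> *
     (real (card (late_heavy \<eta> N d \<omega> - late_heavy \<eta> N (Suc d) \<omega>) choose k) *
      real ((card (late_heavy \<eta> N d \<omega>) - k) choose r))\<bar> \<le> 2 ^ N * 2 ^ N"
    by (auto simp: indicator_def abs_mult)
qed

lemma integral_alternating_bound:
  fixes b :: "'a \<Rightarrow> real" and t :: "nat \<Rightarrow> 'a \<Rightarrow> real"
  assumes b: "integrable M b" and t: "\<And>r. integrable M (t r)"
    and le: "\<And>\<omega>. \<bar>b \<omega> - (\<Sum>r<R. (-1) ^ r * t r \<omega>)\<bar> \<le> t R \<omega>"
  shows "\<bar>(\<integral>\<omega>. b \<omega> \<partial>M) - (\<Sum>r<R. (-1) ^ r * (\<integral>\<omega>. t r \<omega> \<partial>M))\<bar> \<le> (\<integral>\<omega>. t R \<omega> \<partial>M)"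
proof -
  have "(\<integral>\<omega>. b \<omega> \<partial>M) - (\<Sum>r<R. (-1) ^ r * (\<integral>\<omega>. t r \<omega> \<partial>M)) = (\<integral>\<omega>. b \<omega> - (\<Sum>r<R. (-1) ^ r * t r \<omega>) \<partial>M)"
    using b t by (simp add: Bochner_Integration.integral_diff Bochner_Integration.integral_sum)
  also have "\<bar>\<dots>\<bar> \<le> (\<integral>\<omega>. \<bar>b \<omega> - (\<Sum>r<R. (-1) ^ r * t r \<omega>)\<bar> \<partial>M)" by (rule integral_abs_bound)
  also have "\<dots> \<le> (\<integral>\<omega>. t R \<omega> \<partial>M)"
    using b t le by (intro integral_mono) auto
  finally show ?thesis .
qed

text \<open>
  If \<open>x\<close> vertices have degree exactly \<open>d\<close> and \<open>z \<ge> x\<close> vertices degree at least \<open>d\<close>, then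
  \<open>(x choose k) * of_bool (z - k = 0)\<close> is the indicator of \<open>x = z = k\<close>: if the first factor does not vanish,
  then \<open>z \<ge> x \<ge> k\<close>.
\<close>

lemma moment_bonferroni_exact:
  "\<bar>prob (typical {1} \<eta> N \<inter> {\<omega> \<in> space M. card (late_heavy \<eta> N d \<omega>) = k \<and> card (late_heavy \<eta> N d \<omega> - late_heavy \<eta> N (Suc d) \<omega>) = k})
    - (\<Sum>r<R. (-1) ^ r * factorial_moment \<eta> N d k r)\<bar> \<le> factorial_moment \<eta> N d k R"
proof -
  let ?E = "typical {1} \<eta> N \<inter> {\<omega> \<in> space M. card (late_heavy \<eta> N d \<omega>) = k \<and> card (late_heavy \<eta> N d \<omega> - late_heavy \<eta> N (Suc d) \<omega>) = k}"
  have E: "?E \<in> sets M" by (intro sets.Int good_sets) measurable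
  have "\<bar>(\<integral>\<omega>. indicator ?E \<omega> \<partial>M) - (\<Sum>r<R. (-1) ^ r * factorial_moment \<eta> N d k r)\<bar> \<le> factorial_moment \<eta> N d k R"
    unfolding factorial_moment_def
  proof (rule integral_alternating_bound[OF _ integrable_moment])
    show "integrable M (indicat_real ?E)" using E by (intro integrable_real_indicator) (auto simp: less_top[symmetric])
    fix \<omega>
    let ?x = "card (late_heavy \<eta> N d \<omega> - late_heavy \<eta> N (Suc d) \<omega>)" and ?z = "card (late_heavy \<eta> N d \<omega>)"
    have xz: "?x \<le> ?z" by (rule card_mono) auto
    show "\<bar>indicat_real ?E \<omega> - (\<Sum>r<R. (-1) ^ r * (indicator (typical {1} \<eta> N) \<omega> * (real (?x choose k) * real ((?z - k) choose r))))\<bar>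
      \<le> indicator (typical {1} \<eta> N) \<omega> * (real (?x choose k) * real ((?z - k) choose R))"
    proof (cases "\<omega> \<in> typical {1} \<eta> N")
      case True
      then have w: "\<omega> \<in> space M" by (simp add: good_def)
      have "indicat_real ?E \<omega> = real (?x choose k) * of_bool (?z - k = 0)"
        using True w xz by (cases "?x < k") (auto simp: indicator_def binomial_eq_0)
      then have "indicat_real ?E \<omega> - (\<Sum>r<R. (-1) ^ r * (indicator (typical {1} \<eta> N) \<omega> * (real (?x choose k) * real ((?z - k) choose r)))) =
         real (?x choose k) * (of_bool (?z - k = 0) - (\<Sum>r<R. (-1) ^ r * real ((?z - k) choose r)))"
        using True by (simp add: right_diff_distrib sum_distrib_left mult_ac)
      then show ?thesis using True mult_left_mono[OF bonferroni[of "?z - k" R], of "real (?x choose k)"] by (simp add: abs_mult)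
    qed simp
  qed
  then show ?thesis using E by simp
qed

lemma moment_bonferroni_positive:
  "\<bar>prob (typical {1} \<eta> N \<inter> {\<omega> \<in> space M. 0 < card (late_heavy \<eta> N d \<omega>)})
    - (\<Sum>r<R. (-1) ^ r * factorial_moment \<eta> N d 0 (Suc r))\<bar> \<le> factorial_moment \<eta> N d 0 (Suc R)"
proof -
  let ?E = "typical {1} \<eta> N \<inter> {\<omega> \<in> space M. 0 < card (late_heavy \<eta> N d \<omega>)}"
  have E: "?E \<in> sets M" by (intro sets.Int good_sets) measurable
  have "\<bar>(\<integral>\<omega>. indicator ?E \<omega> \<partial>M) - (\<Sum>r<R. (-1) ^ r * factorial_moment \<eta> N d 0 (Suc r))\<bar> \<le> factorial_moment \<eta> N d 0 (Suc R)"
    unfolding factorial_moment_def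
  proof (rule integral_alternating_bound[OF _ integrable_moment])
    show "integrable M (indicat_real ?E)" using E by (intro integrable_real_indicator) (auto simp: less_top[symmetric])
    fix \<omega>
    let ?x = "card (late_heavy \<eta> N d \<omega> - late_heavy \<eta> N (Suc d) \<omega>)" and ?z = "card (late_heavy \<eta> N d \<omega>)"
    show "\<bar>indicat_real ?E \<omega> - (\<Sum>r<R. (-1) ^ r * (indicator (typical {1} \<eta> N) \<omega> * (real (?x choose 0) * real ((?z - 0) choose Suc r))))\<bar>
      \<le> indicator (typical {1} \<eta> N) \<omega> * (real (?x choose 0) * real ((?z - 0) choose Suc R))"
    proof (cases "\<omega> \<in> typical {1} \<eta> N")
      case True
      then have "\<omega> \<in> space M" by (simp add: good_def)
      then have "indicat_real ?E \<omega> = of_bool (0 < ?z)" using True by (simp add: indicator_def)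
      then show ?thesis using True bonferroni_positive[of ?z R] by simp
    qed simp
  qed
  then show ?thesis using E by simp
qed

lemma moment_nonneg: "0 \<le> factorial_moment \<eta> N d k r"
  unfolding factorial_moment_def by (intro integral_nonneg_AE) auto

text \<open>
  The probability is compared with \<open>1 - exp (- \<lambda>)\<close> after division by \<open>\<lambda> = mean_above N (d N)\<close>, so that the
  statement keeps its content when \<open>\<lambda>\<close> tends to zero. Accordingly the moments start with the first one.
\<close>

lemma exists_above_asymp:
  assumes \<eta>: "0 < \<eta>" "\<eta> < 1" and reg: "tuple_regime c \<eta>" and d: "\<forall>\<^sub>F N in sequentially. real (Suc (d N)) \<le> c * ln (real N)"
    and atyp: "(\<lambda>N. prob (atypical \<eta> N (d N)) / mean_above N (d N)) \<longlonglongrightarrow> 0"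
    and bd: "\<forall>\<^sub>F N in sequentially. mean_above N (d N) \<le> \<Lambda>"
  shows "(\<lambda>N. prob {\<omega> \<in> space M. 0 < card (above N (d N) \<omega>)} / mean_above N (d N)
     - (1 - exp (- mean_above N (d N))) / mean_above N (d N)) \<longlonglongrightarrow> 0"
proof -
  define E where "E N = typical {1} \<eta> N \<inter> {\<omega> \<in> space M. 0 < card (late_heavy \<eta> N (d N) \<omega>)}" for N
  define lam where "lam N = mean_above N (d N)" for N
  \<comment> \<open>One power of \<open>lam\<close> has been divided out, hence the shift of the index.\<close>
  define T where "T r N = fact (Suc r) * factorial_moment \<eta> N (d N) 0 (Suc r) / lam N" for r N
  have pos: "\<forall>\<^sub>F N in sequentially. 0 < lam N \<and> lam N \<le> \<Lambda>"
    using bd eventually_gt_at_top[of 0] by eventually_elim (simp add: lam_def mean_above_pos)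
  have "(\<lambda>N. prob (E N) / lam N - 1 * (\<Sum>r. (-1) ^ r / fact (Suc r) * lam N ^ r)) \<longlonglongrightarrow> 0"
  proof (rule power_series_limit[OF _ pos, where T=T])
    show "\<bar>(-1) ^ r / fact (Suc r)\<bar> \<le> 1 / (fact r :: real)" for r
      by (simp add: abs_mult frac_le)
    show "(\<lambda>N. T r N / lam N ^ r) \<longlonglongrightarrow> 1" for r
      using factorial_moment_asymp[OF reg d, of 0 "Suc r"] by (simp add: T_def lam_def mult_ac)
    show "\<forall>\<^sub>F N in sequentially. \<bar>prob (E N) / lam N - (\<Sum>r<R. (-1) ^ r / fact (Suc r) * T r N)\<bar> \<le> T R N / fact R" for R
      using pos
    proof eventually_elim
      case (elim N)
      have "(\<Sum>r<R. (-1) ^ r / fact (Suc r) * T r N) = (\<Sum>r<R. (-1) ^ r * factorial_moment \<eta> N (d N) 0 (Suc r)) / lam N"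
        by (simp add: T_def sum_divide_distrib del: fact_Suc)
      then have "\<bar>prob (E N) / lam N - (\<Sum>r<R. (-1) ^ r / fact (Suc r) * T r N)\<bar> =
         \<bar>prob (E N) - (\<Sum>r<R. (-1) ^ r * factorial_moment \<eta> N (d N) 0 (Suc r))\<bar> / lam N"
        using elim by (simp add: diff_divide_distrib[symmetric])
      also have "\<dots> \<le> factorial_moment \<eta> N (d N) 0 (Suc R) / lam N"
        using elim moment_bonferroni_positive[of \<eta> N "d N" R] unfolding E_def by (intro divide_right_mono) auto
      also have "\<dots> \<le> T R N / fact R"
      proof -
        have "1 * (factorial_moment \<eta> N (d N) 0 (Suc R) / lam N) \<le> real (Suc R) * (factorial_moment \<eta> N (d N) 0 (Suc R) / lam N)"
          using elim moment_nonneg by (intro mult_right_mono) auto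
        also have "\<dots> = T R N / fact R" by (simp add: T_def)
        finally show ?thesis by simp
      qed
      finally show ?case .
    qed
  qed simp
  then have l1: "(\<lambda>N. prob (E N) / lam N - (\<Sum>r. (-1) ^ r / fact (Suc r) * lam N ^ r)) \<longlonglongrightarrow> 0" by simp
  have l2: "(\<lambda>N. prob {\<omega> \<in> space M. 0 < card (above N (d N) \<omega>)} / lam N - prob (E N) / lam N) \<longlonglongrightarrow> 0"
  proof (rule Lim_null_comparison[OF _ atyp])
    show "\<forall>\<^sub>F N in sequentially. norm (prob {\<omega> \<in> space M. 0 < card (above N (d N) \<omega>)} / lam N - prob (E N) / lam N) \<le> prob (atypical \<eta> N (d N)) / mean_above N (d N)"
      using pos cutoff_le[OF \<eta>]
    proof eventually_elim
      case (elim N)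
      have "\<bar>prob {\<omega> \<in> space M. 0 < card (above N (d N) \<omega>)} - prob (E N)\<bar> \<le> prob (atypical \<eta> N (d N))"
      proof (rule prob_diff_le)
        show "{\<omega> \<in> space M. 0 < card (above N (d N) \<omega>)} \<in> sets M" by measurable
        show "E N \<in> sets M" unfolding E_def by (intro sets.Int good_sets) measurable
        have eq: "above N (d N) \<omega> = late_heavy \<eta> N (d N) \<omega>" if "\<omega> \<in> space M" "\<omega> \<notin> atypical \<eta> N (d N)" for \<omega>
          using above_eq_late_heavy[OF that] elim by simp
        show "{\<omega> \<in> space M. 0 < card (above N (d N) \<omega>)} - E N \<subseteq> atypical \<eta> N (d N)"
        proof
          fix \<omega> assume w: "\<omega> \<in> {\<omega> \<in> space M. 0 < card (above N (d N) \<omega>)} - E N"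
          show "\<omega> \<in> atypical \<eta> N (d N)"
          proof (rule ccontr)
            assume n: "\<omega> \<notin> atypical \<eta> N (d N)"
            then have "\<omega> \<in> typical {1} \<eta> N" using w by (auto simp: atypical_def)
            then show False using w eq[OF _ n] by (auto simp: E_def)
          qed
        qed
        show "E N - {\<omega> \<in> space M. 0 < card (above N (d N) \<omega>)} \<subseteq> atypical \<eta> N (d N)"
          using eq by (auto simp: E_def)
      qed simp
      then show ?case using elim by (simp add: diff_divide_distrib[symmetric] lam_def[symmetric] divide_right_mono)
    qed
  qed
  have "(\<lambda>N. (prob {\<omega> \<in> space M. 0 < card (above N (d N) \<omega>)} / lam N - prob (E N) / lam N) + (prob (E N) / lam N - (\<Sum>r. (-1) ^ r / fact (Suc r) * lam N ^ r))) \<longlonglongrightarrow> 0 + 0"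
    by (intro tendsto_add l1 l2)
  then have "(\<lambda>N. prob {\<omega> \<in> space M. 0 < card (above N (d N) \<omega>)} / lam N - (\<Sum>r. (-1) ^ r / fact (Suc r) * lam N ^ r)) \<longlonglongrightarrow> 0" by simp
  moreover have "\<forall>\<^sub>F N in sequentially. prob {\<omega> \<in> space M. 0 < card (above N (d N) \<omega>)} / lam N - (\<Sum>r. (-1) ^ r / fact (Suc r) * lam N ^ r) =
     prob {\<omega> \<in> space M. 0 < card (above N (d N) \<omega>)} / lam N - (1 - exp (- lam N)) / lam N"
    using pos
  proof eventually_elim
    case (elim N)
    then have nz: "lam N \<noteq> 0" by simp
    show ?case unfolding exp_quotient_series[OF nz] ..
  qed
  ultimately have "(\<lambda>N. prob {\<omega> \<in> space M. 0 < card (above N (d N) \<omega>)} / lam N - (1 - exp (- lam N)) / lam N) \<longlonglongrightarrow> 0"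
    by (rule Lim_transform_eventually)
  then show ?thesis by (simp add: lam_def)
qed

text \<open>
  Moments with \<open>k\<close> exact entries are of the order of the \<open>k\<close>-th power of the mean, so the power series argument
  is applied after division by this power. It is multiplied back at the end, as the mean is bounded.
\<close>

lemma exact_count_asymp:
  assumes \<eta>: "0 < \<eta>" "\<eta> < 1" and reg: "tuple_regime c \<eta>" and d: "\<forall>\<^sub>F N in sequentially. real (Suc (d N)) \<le> c * ln (real N)"
    and atyp: "(\<lambda>N. prob (atypical \<eta> N (d N)) / mean_above N (d N)) \<longlonglongrightarrow> 0"
    and bd: "\<forall>\<^sub>F N in sequentially. mean_above N (d N) \<le> \<Lambda>"
  shows "(\<lambda>N. prob {\<omega> \<in> space M. card (above N (d N) \<omega>) = k \<and> card (above N (Suc (d N)) \<omega>) = 0}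
     - (mean_above N (d N) * (1 - 1 / \<theta>)) ^ k / fact k * exp (- mean_above N (d N))) \<longlonglongrightarrow> 0"
proof -
  let ?F = "\<lambda>N. {\<omega> \<in> space M. card (above N (d N) \<omega>) = k \<and> card (above N (Suc (d N)) \<omega>) = 0}"
  define E where "E N = typical {1} \<eta> N \<inter> {\<omega> \<in> space M. card (late_heavy \<eta> N (d N) \<omega>) = k \<and> card (late_heavy \<eta> N (d N) \<omega> - late_heavy \<eta> N (Suc (d N)) \<omega>) = k}" for N
  define lam where "lam N = mean_above N (d N)" for N
  define T where "T r N = fact r * factorial_moment \<eta> N (d N) k r / lam N ^ k" for r N
  define \<tau> where "\<tau> = (1 - 1 / \<theta>) ^ k / fact k"
  have \<tau>0: "0 \<le> \<tau>" using theta_gt_1 by (simp add: \<tau>_def)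
  have pos: "\<forall>\<^sub>F N in sequentially. 0 < lam N \<and> lam N \<le> \<Lambda>"
    using bd eventually_gt_at_top[of 0] by eventually_elim (simp add: lam_def mean_above_pos)
  have "(\<lambda>N. prob (E N) / lam N ^ k - \<tau> * (\<Sum>r. (-1) ^ r / fact r * lam N ^ r)) \<longlonglongrightarrow> 0"
  proof (rule power_series_limit[OF _ pos _ \<tau>0, where T=T])
    show "\<bar>(-1) ^ r / fact r\<bar> \<le> 1 / (fact r :: real)" for r by (simp add: abs_mult)
    show "(\<lambda>N. T r N / lam N ^ r) \<longlonglongrightarrow> \<tau>" for r
    proof -
      have "(\<lambda>N. fact k * fact r * factorial_moment \<eta> N (d N) k r / lam N ^ (k + r) / fact k) \<longlonglongrightarrow> (1 - 1 / \<theta>) ^ k / fact k"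
        using factorial_moment_asymp[OF reg d, of k r] unfolding lam_def by (intro tendsto_divide tendsto_const) auto
      then show ?thesis by (simp add: T_def \<tau>_def power_add)
    qed
    show "\<forall>\<^sub>F N in sequentially. \<bar>prob (E N) / lam N ^ k - (\<Sum>r<R. (-1) ^ r / fact r * T r N)\<bar> \<le> T R N / fact R" for R
      using pos
    proof eventually_elim
      case (elim N)
      have "(\<Sum>r<R. (-1) ^ r / fact r * T r N) = (\<Sum>r<R. (-1) ^ r * factorial_moment \<eta> N (d N) k r) / lam N ^ k"
        by (simp add: T_def sum_divide_distrib)
      then have "\<bar>prob (E N) / lam N ^ k - (\<Sum>r<R. (-1) ^ r / fact r * T r N)\<bar> =
         \<bar>prob (E N) - (\<Sum>r<R. (-1) ^ r * factorial_moment \<eta> N (d N) k r)\<bar> / lam N ^ k"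
        using elim by (simp add: diff_divide_distrib[symmetric])
      also have "\<dots> \<le> factorial_moment \<eta> N (d N) k R / lam N ^ k"
        using elim moment_bonferroni_exact[of \<eta> N "d N" k R] unfolding E_def by (intro divide_right_mono) auto
      also have "\<dots> = T R N / fact R" by (simp add: T_def)
      finally show ?case .
    qed
  qed
  then have "(\<lambda>N. prob (E N) / lam N ^ k - \<tau> * exp (- lam N)) \<longlonglongrightarrow> 0" unfolding exp_minus_series .
  then have l0: "(\<lambda>N. \<Lambda> ^ k * \<bar>prob (E N) / lam N ^ k - \<tau> * exp (- lam N)\<bar>) \<longlonglongrightarrow> 0"
    by (intro tendsto_mult_right_zero tendsto_rabs_zero)
  have l1: "(\<lambda>N. prob (E N) - (lam N * (1 - 1 / \<theta>)) ^ k / fact k * exp (- lam N)) \<longlonglongrightarrow> 0"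
  proof (rule Lim_null_comparison[OF _ l0])
    show "\<forall>\<^sub>F N in sequentially. norm (prob (E N) - (lam N * (1 - 1 / \<theta>)) ^ k / fact k * exp (- lam N)) \<le> \<Lambda> ^ k * \<bar>prob (E N) / lam N ^ k - \<tau> * exp (- lam N)\<bar>"
      using pos
    proof eventually_elim
      case (elim N)
      have alg: "p - (x * a) ^ k / f * e = x ^ k * (p / x ^ k - a ^ k / f * e)" if "x \<noteq> 0" for p x a f e :: real
        using that by (simp add: power_mult_distrib right_diff_distrib)
      have "prob (E N) - (lam N * (1 - 1 / \<theta>)) ^ k / fact k * exp (- lam N) = lam N ^ k * (prob (E N) / lam N ^ k - \<tau> * exp (- lam N))"
        unfolding \<tau>_def using elim by (intro alg) simp
      then have "norm (prob (E N) - (lam N * (1 - 1 / \<theta>)) ^ k / fact k * exp (- lam N)) = lam N ^ k * \<bar>prob (E N) / lam N ^ k - \<tau> * exp (- lam N)\<bar>"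
        using elim by (simp add: abs_mult)
      also have "\<dots> \<le> \<Lambda> ^ k * \<bar>prob (E N) / lam N ^ k - \<tau> * exp (- lam N)\<bar>"
        using elim by (intro mult_right_mono power_mono) auto
      finally show ?case .
    qed
  qed
  have a0: "(\<lambda>N. \<Lambda> * (prob (atypical \<eta> N (d N)) / mean_above N (d N))) \<longlonglongrightarrow> 0"
    by (rule tendsto_mult_right_zero[OF atyp])
  have l2: "(\<lambda>N. prob (?F N) - prob (E N)) \<longlonglongrightarrow> 0"
  proof (rule Lim_null_comparison[OF _ a0])
    show "\<forall>\<^sub>F N in sequentially. norm (prob (?F N) - prob (E N)) \<le> \<Lambda> * (prob (atypical \<eta> N (d N)) / mean_above N (d N))"
      using pos cutoff_le[OF \<eta>]
    proof eventually_elim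
      case (elim N)
      have "\<bar>prob (?F N) - prob (E N)\<bar> \<le> prob (atypical \<eta> N (d N))"
      proof (rule prob_diff_le)
        show "?F N \<in> sets M" by measurable
        show "E N \<in> sets M" unfolding E_def by (intro sets.Int good_sets) measurable
        have iff: "\<omega> \<in> ?F N \<longleftrightarrow> \<omega> \<in> E N" if w: "\<omega> \<in> space M" "\<omega> \<notin> atypical \<eta> N (d N)" for \<omega>
        proof -
          let ?Z = "late_heavy \<eta> N (d N) \<omega>" and ?Y = "late_heavy \<eta> N (Suc (d N)) \<omega>"
          have e: "above N (d N) \<omega> = ?Z" "above N (Suc (d N)) \<omega> = ?Y"
            using above_eq_late_heavy[OF w] elim by auto
          have Y: "?Y \<subseteq> ?Z" by (auto simp: late_heavy_def)
          then have "card (?Z - ?Y) = card ?Z - card ?Y" "card ?Y \<le> card ?Z" by (auto simp: card_Diff_subset card_mono)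
          then have eq: "card ?Z = k \<and> card ?Y = 0 \<longleftrightarrow> card ?Z = k \<and> card (?Z - ?Y) = k" by arith
          have tw: "\<omega> \<in> typical {1} \<eta> N" using w by (auto simp: atypical_def)
          show ?thesis unfolding E_def mem_Collect_eq Int_iff e using w(1) tw eq by blast
        qed
        show "?F N - E N \<subseteq> atypical \<eta> N (d N)" using iff by blast
        show "E N - ?F N \<subseteq> atypical \<eta> N (d N)"
        proof
          fix \<omega> assume "\<omega> \<in> E N - ?F N"
          moreover then have "\<omega> \<in> space M" by (simp add: E_def)
          ultimately show "\<omega> \<in> atypical \<eta> N (d N)" using iff by blast
        qed
      qed simp
      also have "\<dots> = lam N * (prob (atypical \<eta> N (d N)) / mean_above N (d N))" using elim by (simp add: lam_def)
      also have "\<dots> \<le> \<Lambda> * (prob (atypical \<eta> N (d N)) / mean_above N (d N))"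
        using elim unfolding lam_def by (intro mult_right_mono) auto
      finally show ?case by simp
    qed
  qed
  have "(\<lambda>N. (prob (?F N) - prob (E N)) + (prob (E N) - (lam N * (1 - 1 / \<theta>)) ^ k / fact k * exp (- lam N))) \<longlonglongrightarrow> 0 + 0"
    by (intro tendsto_add l1 l2)
  then show ?thesis by (simp add: lam_def)
qed

section \<open>The maximum and the maximisers\<close>

lemma max_indegree_ge:
  assumes "1 \<le> N" shows "d \<le> max_indegree J N \<omega> \<longleftrightarrow> 0 < card (above N d \<omega>)"
proof -
  have "d \<le> max_indegree J N \<omega> \<longleftrightarrow> (\<exists>x\<in>{1..N}. d \<le> deg N x \<omega>)"
    unfolding max_indegree_def wrt_indegree_eq_deg using assms by (subst Max_ge_iff) auto
  also have "\<dots> \<longleftrightarrow> above N d \<omega> \<noteq> {}" by (auto simp: above_def)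
  finally show ?thesis by (simp add: card_gt_0_iff)
qed

lemma max_indegree_exact:
  assumes "1 \<le> N" "1 \<le> k"
  shows "max_indegree J N \<omega> = d \<and> card (max_vertices J N \<omega>) = k \<longleftrightarrow>
    card (above N d \<omega>) = k \<and> card (above N (Suc d) \<omega>) = 0"
proof -
  have "max_indegree J N \<omega> = d \<longleftrightarrow> d \<le> max_indegree J N \<omega> \<and> \<not> Suc d \<le> max_indegree J N \<omega>" by auto
  also have "\<dots> \<longleftrightarrow> 0 < card (above N d \<omega>) \<and> card (above N (Suc d) \<omega>) = 0"
    unfolding max_indegree_ge[OF assms(1)] by simp
  finally have m: "max_indegree J N \<omega> = d \<longleftrightarrow> 0 < card (above N d \<omega>) \<and> card (above N (Suc d) \<omega>) = 0" .
  have v: "max_vertices J N \<omega> = above N d \<omega>" if "max_indegree J N \<omega> = d"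
  proof -
    have "above N (Suc d) \<omega> = {}" using m that finite_above by (metis card_eq_0_iff)
    then have "deg N x \<omega> \<le> d" if "x \<in> {1..N}" for x using that unfolding above_def by fastforce
    then show ?thesis using that by (auto simp: max_vertices_def above_def wrt_indegree_eq_deg intro: antisym)
  qed
  show ?thesis using m v assms(2) by auto
qed

lemma max_vertices_measurable:
  assumes "1 \<le> N" shows "(\<lambda>\<omega>. card (max_vertices J N \<omega>)) \<in> measurable M (count_space UNIV)"
  unfolding max_vertices_def
proof (rule card_measurable)
  fix x assume x: "x \<in> {1..N}"
  have "wrt_indegree J N x \<omega> = max_indegree J N \<omega> \<longleftrightarrow> (\<forall>y\<in>{1..N}. deg N y \<omega> \<le> deg N x \<omega>)" for \<omega>
  proof -
    have "deg N x \<omega> \<in> (\<lambda>j. deg N j \<omega>) ` {1..N}" using x by blast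
    then show ?thesis unfolding max_indegree_def wrt_indegree_eq_deg
      by (subst eq_commute, subst Max_eq_iff) auto
  qed
  then have "{\<omega> \<in> space M. wrt_indegree J N x \<omega> = max_indegree J N \<omega>} = {\<omega> \<in> space M. \<forall>y\<in>{1..N}. deg N y \<omega> \<le> deg N x \<omega>}" by simp
  also have "\<dots> \<in> sets M" 
  proof (rule sets.sets_Collect_finite_All)
    fix y
    have "{\<omega> \<in> space M. real (deg N y \<omega>) \<le> real (deg N x \<omega>)} \<in> sets M" by measurable
    then show "{\<omega> \<in> space M. deg N y \<omega> \<le> deg N x \<omega>} \<in> sets M" by simp
  qed simp
  finally show "{\<omega> \<in> space M. wrt_indegree J N x \<omega> = max_indegree J N \<omega>} \<in> sets M" .
qed simp

lemma card_max_vertices_pos: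
  assumes "1 \<le> N" shows "0 < card (max_vertices J N \<omega>)"
proof -
  have "max_indegree J N \<omega> \<in> (\<lambda>j. wrt_indegree J N j \<omega>) ` {1..N}"
    unfolding max_indegree_def using assms by (intro Max_in) auto
  then have "max_vertices J N \<omega> \<noteq> {}" by (auto simp: max_vertices_def)
  then show ?thesis by (simp add: card_gt_0_iff max_vertices_def)
qed

definition level :: "(nat \<Rightarrow> int) \<Rightarrow> nat \<Rightarrow> nat" where
  "level i N = nat (\<lfloor>log \<theta> (real N)\<rfloor> + i N)"

lemma log_at_top: "filterlim (\<lambda>N. log \<theta> (real N)) at_top sequentially"
  unfolding log_def using theta_gt_1 by real_asymp

lemma mean_above_level:
  assumes "0 < N" "0 \<le> \<lfloor>log \<theta> (real N)\<rfloor> + i N"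
  shows "mean_above N (level i N) = q * \<theta> powr (- of_int (i N) + wrt_eps \<mu> N)"
proof -
  have "(1 / \<theta>) ^ level i N = \<theta> powr (- real (level i N))"
    using theta_gt_1 by (simp add: powr_minus powr_realpow power_one_over inverse_eq_divide)
  also have "real (level i N) = of_int \<lfloor>log \<theta> (real N)\<rfloor> + of_int (i N)" using assms by (simp add: level_def)
  finally have "real N * (1 / \<theta>) ^ level i N = \<theta> powr log \<theta> (real N) * \<theta> powr (- (of_int \<lfloor>log \<theta> (real N)\<rfloor> + of_int (i N)))"
    using assms theta_gt_1 by simp
  also have "\<dots> = \<theta> powr (log \<theta> (real N) + - (of_int \<lfloor>log \<theta> (real N)\<rfloor> + of_int (i N)))" by (simp only: powr_add)
  also have "log \<theta> (real N) + - (of_int \<lfloor>log \<theta> (real N)\<rfloor> + of_int (i N)) = - of_int (i N) + wrt_eps \<mu> N"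
    by (simp add: wrt_eps_def)
  finally show ?thesis by (simp add: mean_above_def)
qed

text \<open>
  The bound \<open>c * ln N\<close> holds with one unit to spare for the level \<open>Suc d\<close>, because the constant can be
  increased a little.
\<close>

lemma level_conditions:
  assumes thr: "strictly_below_threshold \<mu> i" and inf: "liminf (\<lambda>n. ereal (of_int (i n))) > -\<infinity>"
  shows "\<forall>\<^sub>F N in sequentially. 0 \<le> \<lfloor>log \<theta> (real N)\<rfloor> + i N"
    and "filterlim (level i) at_top sequentially"
    and "\<exists>c. 0 < c \<and> c < \<theta> / mw \<and> (\<forall>\<^sub>F N in sequentially. real (Suc (level i N)) \<le> c * ln (real N))"
    and "\<exists>\<Lambda>. \<forall>\<^sub>F N in sequentially. mean_above N (level i N) \<le> \<Lambda>"
proof -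
  obtain b where "ereal b < liminf (\<lambda>n. ereal (of_int (i n)))" using ereal_dense2[OF inf] by blast
  then have "\<forall>\<^sub>F n in sequentially. ereal b < ereal (of_int (i n))" by (rule less_LiminfD)
  then have ib: "\<forall>\<^sub>F n in sequentially. b < of_int (i n)" by simp
  have lg: "\<forall>\<^sub>F N in sequentially. C \<le> log \<theta> (real N)" for C
    using log_at_top unfolding filterlim_at_top by blast
  show nn: "\<forall>\<^sub>F N in sequentially. 0 \<le> \<lfloor>log \<theta> (real N)\<rfloor> + i N"
    using ib lg[of "1 - b"]
  proof eventually_elim
    case (elim N)
    then have "-1 < real_of_int (\<lfloor>log \<theta> (real N)\<rfloor> + i N)" by linarith
    then show ?case by linarith
  qed
  have "filterlim (\<lambda>N. real (level i N)) at_top sequentially"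
  proof (rule filterlim_at_top_mono)
    show "filterlim (\<lambda>N. (b - 1) + log \<theta> (real N)) at_top sequentially"
      by (rule filterlim_tendsto_add_at_top[OF tendsto_const log_at_top])
    show "\<forall>\<^sub>F N in sequentially. (b - 1) + log \<theta> (real N) \<le> real (level i N)"
      using nn ib
    proof eventually_elim
      case (elim N)
      then have "real (level i N) = of_int \<lfloor>log \<theta> (real N)\<rfloor> + of_int (i N)" by (simp add: level_def)
      then show ?case using elim by linarith
    qed
  qed
  then show "filterlim (level i) at_top sequentially" by (simp add: filterlim_sequentially_iff_filterlim_real)
  have tm: "\<theta> / (\<theta> - 1) = \<theta> / mw" by (simp add: theta_eq)
  obtain c where c: "limsup (\<lambda>n. ereal ((of_int (i n) + log \<theta> (real n)) / ln (real n))) < ereal c" "ereal c < ereal (\<theta> / mw)"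
    using ereal_dense2[OF thr[unfolded strictly_below_threshold_def tm]] by blast
  have ev: "\<forall>\<^sub>F n in sequentially. (of_int (i n) + log \<theta> (real n)) / ln (real n) < c"
    using Limsup_lessD[OF c(1)] by simp
  have "max c 1 < \<theta> / mw" using c(2) mw_bounds by (simp add: theta_eq field_simps)
  then obtain c' where c': "max c 1 < c'" "c' < \<theta> / mw" using dense by blast
  have big: "\<forall>\<^sub>F N in sequentially. 1 / (c' - c) \<le> ln (real N)" by real_asymp
  have "\<forall>\<^sub>F N in sequentially. real (Suc (level i N)) \<le> c' * ln (real N)"
    using ev nn big eventually_gt_at_top[of 1]
  proof eventually_elim
    case (elim N)
    have l: "0 < ln (real N)" using elim by simp
    have "real (level i N) = of_int \<lfloor>log \<theta> (real N)\<rfloor> + of_int (i N)" using elim by (simp add: level_def)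
    also have "\<dots> \<le> of_int (i N) + log \<theta> (real N)" by linarith
    also have "\<dots> \<le> c * ln (real N)" using elim(1) l by (simp add: pos_divide_less_eq)
    finally have "real (Suc (level i N)) \<le> c * ln (real N) + 1" by simp
    also have "1 \<le> (c' - c) * ln (real N)" using elim(3) c' by (simp add: pos_divide_le_eq mult.commute)
    finally show ?case by (simp add: left_diff_distrib)
  qed
  then show "\<exists>c. 0 < c \<and> c < \<theta> / mw \<and> (\<forall>\<^sub>F N in sequentially. real (Suc (level i N)) \<le> c * ln (real N))"
    using c' by (intro exI[of _ c']) auto
  have "\<forall>\<^sub>F N in sequentially. mean_above N (level i N) \<le> q * \<theta> powr (- b + 1)"
    using nn ib eventually_gt_at_top[of 0]
  proof eventually_elim
    case (elim N)
    have "- of_int (i N) + wrt_eps \<mu> N \<le> - b + 1" using elim unfolding wrt_eps_def by linarith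
    then show ?case unfolding mean_above_level[where i=i, OF elim(3,1)] using theta_gt_1 atom_pos
      by (intro mult_left_mono powr_mono) auto
  qed
  then show "\<exists>\<Lambda>. \<forall>\<^sub>F N in sequentially. mean_above N (level i N) \<le> \<Lambda>" by blast
qed

lemma level_asymptotics:
  assumes thr: "strictly_below_threshold \<mu> i" and inf: "liminf (\<lambda>n. ereal (of_int (i n))) > -\<infinity>"
  shows "(\<lambda>N. prob {\<omega> \<in> space M. 0 < card (above N (level i N) \<omega>)} / mean_above N (level i N)
     - (1 - exp (- mean_above N (level i N))) / mean_above N (level i N)) \<longlonglongrightarrow> 0"
    and "(\<lambda>N. prob {\<omega> \<in> space M. card (above N (level i N) \<omega>) = k \<and> card (above N (Suc (level i N)) \<omega>) = 0}
     - (mean_above N (level i N) * (1 - 1 / \<theta>)) ^ k / fact k * exp (- mean_above N (level i N))) \<longlonglongrightarrow> 0"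
proof -
  note cond = level_conditions[OF thr inf]
  obtain c where c: "0 < c" "c < \<theta> / mw" and d: "\<forall>\<^sub>F N in sequentially. real (Suc (level i N)) \<le> c * ln (real N)"
    using cond(3) by blast
  obtain \<Lambda> where \<Lambda>: "\<forall>\<^sub>F N in sequentially. mean_above N (level i N) \<le> \<Lambda>" using cond(4) by blast
  have d': "\<forall>\<^sub>F N in sequentially. real (level i N) \<le> c * ln (real N)" using d by eventually_elim simp
  obtain e1 where e1: "0 < e1" "\<And>\<eta>. 0 < \<eta> \<and> \<eta> < e1 \<and> \<eta> < 1 \<Longrightarrow> tuple_regime c \<eta>"
    using tuple_mean_asymp[OF c, where 'i=nat] unfolding tuple_regime_def by blast
  obtain e2 where e2: "0 < e2" "\<And>\<eta> d. 0 < \<eta> \<and> \<eta> < e2 \<and> \<eta> < 1 \<and> (\<forall>\<^sub>F N in sequentially. real (d N) \<le> c * ln (real N))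
     \<Longrightarrow> (\<lambda>N. prob {\<omega> \<in> space M. \<exists>v\<in>{1..cutoff \<eta> N}. d N \<le> deg N v \<omega>} * (\<theta> ^ d N / real N)) \<longlonglongrightarrow> 0"
    using early_vertices_negligible[OF c] by blast
  obtain \<eta> where "0 < \<eta>" "\<eta> < min e1 (min e2 1)" using dense[of 0 "min e1 (min e2 1)"] e1(1) e2(1) by auto
  then have \<eta>: "0 < \<eta>" "\<eta> < e1" "\<eta> < e2" "\<eta> < 1" by auto
  have reg: "tuple_regime c \<eta>" using e1(2) \<eta> by blast
  have atyp: "(\<lambda>N. prob (atypical \<eta> N (level i N)) / mean_above N (level i N)) \<longlonglongrightarrow> 0"
    by (rule atypical_over_mean[OF \<eta>(1,4) d' cond(2) e2(2)]) (use \<eta> d' in auto)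
  show "(\<lambda>N. prob {\<omega> \<in> space M. 0 < card (above N (level i N) \<omega>)} / mean_above N (level i N)
     - (1 - exp (- mean_above N (level i N))) / mean_above N (level i N)) \<longlonglongrightarrow> 0"
    by (rule exists_above_asymp[OF \<eta>(1,4) reg d atyp \<Lambda>])
  show "(\<lambda>N. prob {\<omega> \<in> space M. card (above N (level i N) \<omega>) = k \<and> card (above N (Suc (level i N)) \<omega>) = 0}
     - (mean_above N (level i N) * (1 - 1 / \<theta>)) ^ k / fact k * exp (- mean_above N (level i N))) \<longlonglongrightarrow> 0"
    by (rule exact_count_asymp[OF \<eta>(1,4) reg d atyp \<Lambda>])
qed

text \<open>
  As \<open>x / (1 - exp (- x)) \<le> 1 + x\<close>, an error that is small relative to the mean \<open>x\<close> is small relative to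
  \<open>1 - exp (- x)\<close> when \<open>x\<close> is bounded.
\<close>

lemma max_indegree_asymp:
  assumes thr: "strictly_below_threshold \<mu> i" and inf: "liminf (\<lambda>n. ereal (of_int (i n))) > -\<infinity>"
  shows "(\<lambda>n. prob {\<omega> \<in> space M. int (max_indegree J n \<omega>) \<ge> \<lfloor>log \<theta> (real n)\<rfloor> + i n})
    \<sim>[sequentially] (\<lambda>n. 1 - exp (- q * \<theta> powr (- of_int (i n) + wrt_eps \<mu> n)))"
proof (rule asymp_equivI')
  note cond = level_conditions[OF thr inf]
  obtain \<Lambda> where \<Lambda>: "\<forall>\<^sub>F N in sequentially. mean_above N (level i N) \<le> \<Lambda>" using cond(4) by blast
  let ?lam = "\<lambda>N. mean_above N (level i N)"
  let ?P = "\<lambda>N. prob {\<omega> \<in> space M. 0 < card (above N (level i N) \<omega>)}"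
  have "(\<lambda>N. (1 + \<Lambda>) * \<bar>?P N / ?lam N - (1 - exp (- ?lam N)) / ?lam N\<bar>) \<longlonglongrightarrow> 0"
    by (intro tendsto_mult_right_zero tendsto_rabs_zero level_asymptotics(1)[OF thr inf])
  then have "(\<lambda>N. ?P N / (1 - exp (- ?lam N)) - 1) \<longlonglongrightarrow> 0"
  proof (rule Lim_null_comparison[rotated])
    show "\<forall>\<^sub>F N in sequentially. norm (?P N / (1 - exp (- ?lam N)) - 1) \<le> (1 + \<Lambda>) * \<bar>?P N / ?lam N - (1 - exp (- ?lam N)) / ?lam N\<bar>"
      using \<Lambda> eventually_gt_at_top[of 0]
    proof eventually_elim
      case (elim N)
      define x where "x = ?lam N"
      define e where "e = 1 - exp (- x)"
      have x: "0 < x" "x \<le> \<Lambda>" using elim mean_above_pos by (auto simp: x_def)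
      have "1 + x \<le> exp x" by (rule exp_ge_add_one_self)
      then have "exp (- x) \<le> 1 / (1 + x)" using x by (simp add: exp_minus divide_simps)
      then have ex: "x / (1 + x) \<le> e" using x unfolding e_def by (simp add: field_simps)
      then have e0: "0 < e" using x by (smt (verit) divide_pos_pos)
      have xe: "x / e \<le> 1 + \<Lambda>"
      proof -
        have "x \<le> (1 + x) * e" using ex x by (simp add: pos_divide_le_eq mult.commute)
        also have "\<dots> \<le> (1 + \<Lambda>) * e" using x e0 by (intro mult_right_mono) auto
        finally show ?thesis using e0 by (simp add: pos_divide_le_eq)
      qed
      have "?P N / e - 1 = (x / e) * (?P N / x - e / x)" using x e0 by (simp add: field_simps)
      then have "\<bar>?P N / e - 1\<bar> = (x / e) * \<bar>?P N / x - e / x\<bar>" using x e0 by (simp add: abs_mult)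
      also have "\<dots> \<le> (1 + \<Lambda>) * \<bar>?P N / x - e / x\<bar>" by (rule mult_right_mono[OF xe]) simp
      finally show ?case by (simp add: x_def e_def)
    qed
  qed
  then have lim: "(\<lambda>N. ?P N / (1 - exp (- ?lam N))) \<longlonglongrightarrow> 1" by (simp add: LIM_zero_iff)
  show "(\<lambda>n. prob {\<omega> \<in> space M. int (max_indegree J n \<omega>) \<ge> \<lfloor>log \<theta> (real n)\<rfloor> + i n} / (1 - exp (- q * \<theta> powr (- of_int (i n) + wrt_eps \<mu> n)))) \<longlonglongrightarrow> 1"
  proof (rule Lim_transform_eventually[OF lim])
    show "\<forall>\<^sub>F N in sequentially. ?P N / (1 - exp (- ?lam N)) = prob {\<omega> \<in> space M. int (max_indegree J N \<omega>) \<ge> \<lfloor>log \<theta> (real N)\<rfloor> + i N} / (1 - exp (- q * \<theta> powr (- of_int (i N) + wrt_eps \<mu> N)))"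
      using cond(1) eventually_gt_at_top[of 0]
    proof eventually_elim
      case (elim N)
      have "int (max_indegree J N \<omega>) \<ge> \<lfloor>log \<theta> (real N)\<rfloor> + i N \<longleftrightarrow> 0 < card (above N (level i N) \<omega>)" for \<omega>
        using max_indegree_ge[of N "level i N" \<omega>] elim by (simp add: level_def nat_le_iff)
      then show ?case using mean_above_level[where i=i, OF elim(2,1)] by simp
    qed
  qed
qed

text \<open>
  Levels at bounded distance from \<open>log \<theta> n\<close> are below the threshold since \<open>1 / ln \<theta> < \<theta> / (\<theta> - 1)\<close>, that
  is, \<open>ln (1 / \<theta>) < 1 / \<theta> - 1\<close>.
\<close>

lemma const_level_admissible:
  "strictly_below_threshold \<mu> (\<lambda>_. j)" "liminf (\<lambda>n. ereal (of_int ((\<lambda>_. j) n))) > -\<infinity>"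
proof -
  have l: "0 < ln \<theta>" using theta_gt_1 by simp
  have "(\<lambda>n. (of_int j + ln (real n) / ln \<theta>) / ln (real n)) \<longlonglongrightarrow> 1 / ln \<theta>"
  proof -
    have "(\<lambda>n. of_int j / ln (real n) + 1 / ln \<theta>) \<longlonglongrightarrow> 0 + 1 / ln \<theta>"
      by (intro tendsto_intros) real_asymp
    moreover have "\<forall>\<^sub>F n in sequentially. of_int j / ln (real n) + 1 / ln \<theta> = (of_int j + ln (real n) / ln \<theta>) / ln (real n)"
      using eventually_gt_at_top[of 1] by eventually_elim (simp add: add_divide_distrib)
    ultimately have "(\<lambda>n. (of_int j + ln (real n) / ln \<theta>) / ln (real n)) \<longlonglongrightarrow> 0 + 1 / ln \<theta>" by (rule Lim_transform_eventually)
    then show ?thesis by simp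
  qed
  then have "limsup (\<lambda>n. ereal ((of_int j + log \<theta> (real n)) / ln (real n))) = ereal (1 / ln \<theta>)"
    unfolding log_def by (intro lim_imp_Limsup) auto
  moreover have "1 / ln \<theta> < \<theta> / (\<theta> - 1)"
  proof -
    have "ln (1 / \<theta>) < 1 / \<theta> - 1"
    proof -
      have "ln (1 / \<theta>) \<le> 1 / \<theta> - 1" using theta_gt_1 by (intro ln_le_minus_one) auto
      moreover have "ln (1 / \<theta>) \<noteq> 1 / \<theta> - 1" using ln_eq_minus_one[of "1 / \<theta>"] theta_gt_1 by auto
      ultimately show ?thesis by linarith
    qed
    then have "1 - 1 / \<theta> < ln \<theta>" using theta_gt_1 by (simp add: ln_div)
    then have "(\<theta> - 1) / \<theta> < ln \<theta>" using theta_gt_1 by (simp add: diff_divide_distrib)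
    then show ?thesis using l theta_gt_1 by (simp add: field_simps)
  qed
  ultimately show "strictly_below_threshold \<mu> (\<lambda>_. j)" by (simp add: strictly_below_threshold_def)
  show "liminf (\<lambda>n. ereal (of_int ((\<lambda>_. j) n))) > -\<infinity>" by (simp add: Liminf_const)
qed

text \<open>
  If the maximum is one of the levels in the window, then there are \<open>k\<close> maximisers precisely if for one of
  these levels \<open>k\<close> vertices reach it and none exceeds it.
\<close>

lemma level_window:
  fixes N K k :: nat
  defines "lev \<equiv> \<lambda>j. level (\<lambda>_. j) N"
  assumes N: "1 \<le> N" and k: "1 \<le> k" and nn: "0 \<le> \<lfloor>log \<theta> (real N)\<rfloor> - int K"
  shows "\<bar>prob {\<omega> \<in> space M. card (max_vertices J N \<omega>) = k}
      - (\<Sum>j\<in>{- int K..int K}. prob {\<omega> \<in> space M. card (above N (lev j) \<omega>) = k \<and> card (above N (Suc (lev j)) \<omega>) = 0})\<bar>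
    \<le> (1 - prob {\<omega> \<in> space M. 0 < card (above N (lev (- int K)) \<omega>)}) + prob {\<omega> \<in> space M. 0 < card (above N (lev (int K + 1)) \<omega>)}"
proof -
  let ?fl = "\<lfloor>log \<theta> (real N)\<rfloor>"
  let ?E = "{\<omega> \<in> space M. card (max_vertices J N \<omega>) = k}"
  let ?F = "\<lambda>j. {\<omega> \<in> space M. card (above N (lev j) \<omega>) = k \<and> card (above N (Suc (lev j)) \<omega>) = 0}"
  let ?A = "\<lambda>j. {\<omega> \<in> space M. 0 < card (above N (lev j) \<omega>)}"
  have lev: "int (lev j) = ?fl + j" if "- int K \<le> j" for j using nn that by (simp add: lev_def level_def)
  note max_vertices_measurable[OF N, measurable]
  have sets: "?E \<in> sets M" "?F j \<in> sets M" "?A j \<in> sets M" for j by measurable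
  have Feq: "?F j = {\<omega> \<in> space M. max_indegree J N \<omega> = lev j \<and> card (max_vertices J N \<omega>) = k}" for j
    using max_indegree_exact[OF N k] by blast
  have disj: "disjoint_family_on ?F {- int K..int K}"
    unfolding disjoint_family_on_def
  proof (intro ballI impI)
    fix i j assume "i \<in> {- int K..int K}" "j \<in> {- int K..int K}" "i \<noteq> j"
    then have "int (lev i) \<noteq> int (lev j)" using lev by auto
    then show "?F i \<inter> ?F j = {}" unfolding Feq by auto
  qed
  have U: "prob (\<Union>j\<in>{- int K..int K}. ?F j) = (\<Sum>j\<in>{- int K..int K}. prob (?F j))"
    by (rule finite_measure_finite_Union) (use sets disj in auto)
  have sub1: "(\<Union>j\<in>{- int K..int K}. ?F j) \<subseteq> ?E" unfolding Feq by auto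
  have sub2: "?E \<subseteq> (\<Union>j\<in>{- int K..int K}. ?F j) \<union> ((space M - ?A (- int K)) \<union> ?A (int K + 1))"
  proof
    fix \<omega> assume w: "\<omega> \<in> ?E"
    show "\<omega> \<in> (\<Union>j\<in>{- int K..int K}. ?F j) \<union> ((space M - ?A (- int K)) \<union> ?A (int K + 1))"
    proof (cases "\<omega> \<in> (space M - ?A (- int K)) \<union> ?A (int K + 1)")
      case False
      then have "lev (- int K) \<le> max_indegree J N \<omega>" "\<not> lev (int K + 1) \<le> max_indegree J N \<omega>"
        using w max_indegree_ge[OF N] by auto
      then have b: "?fl - int K \<le> int (max_indegree J N \<omega>)" "int (max_indegree J N \<omega>) < ?fl + int K + 1"
        using lev[of "- int K"] lev[of "int K + 1"] by linarith+
      define j where "j = int (max_indegree J N \<omega>) - ?fl"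
      have j: "j \<in> {- int K..int K}" using b by (auto simp: j_def)
      then have "int (lev j) = int (max_indegree J N \<omega>)" using lev[of j] by (simp add: j_def)
      then have "max_indegree J N \<omega> = lev j" by simp
      then have "\<omega> \<in> ?F j" unfolding Feq using w by simp
      then show ?thesis using j by blast
    qed simp
  qed
  have "prob (\<Union>j\<in>{- int K..int K}. ?F j) \<le> prob ?E" using sub1 sets by (intro finite_measure_mono) auto
  moreover have "prob ?E \<le> prob ((\<Union>j\<in>{- int K..int K}. ?F j) \<union> ((space M - ?A (- int K)) \<union> ?A (int K + 1)))"
    using sub2 sets by (intro finite_measure_mono) auto
  moreover have "\<dots> \<le> prob (\<Union>j\<in>{- int K..int K}. ?F j) + prob ((space M - ?A (- int K)) \<union> ?A (int K + 1))"
    using sets by (intro measure_Un_le) auto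
  moreover have "prob ((space M - ?A (- int K)) \<union> ?A (int K + 1)) \<le> prob (space M - ?A (- int K)) + prob (?A (int K + 1))"
    using sets by (intro measure_Un_le) auto
  moreover have "prob (space M - ?A (- int K)) = 1 - prob (?A (- int K))" using sets by (intro prob_compl) auto
  ultimately show ?thesis unfolding U by linarith
qed

text \<open>
  Let \<open>L j\<close> be the limiting intensity at level \<open>j\<close>. For a fixed window of levels, each probability in
  \<open>level_window\<close> converges. Widening the window, the
  sum tends to \<open>s\<close> and the two boundary terms, whose limits are \<open>exp (- L (- K))\<close> and
  \<open>1 - exp (- L (K + 1))\<close>, tend to zero.
\<close>

lemma maximiser_count_limit:
  assumes n: "\<And>l. 1 \<le> n l" "filterlim n at_top sequentially" and eps: "(\<lambda>l. wrt_eps \<mu> (n l)) \<longlonglongrightarrow> e"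
    and k: "1 \<le> k"
    and s: "((\<lambda>j :: int. 1 / fact k * (q * (1 - 1 / \<theta>) * \<theta> powr (- of_int j + e)) ^ k * exp (- q * \<theta> powr (- of_int j + e))) has_sum s) UNIV"
  shows "(\<lambda>l. prob {\<omega> \<in> space M. card (max_vertices J (n l) \<omega>) = k}) \<longlonglongrightarrow> s"
proof (rule LIMSEQ_I)
  fix r :: real assume r: "0 < r"
  define L where "L j = q * \<theta> powr (- of_int j + e)" for j :: int
  define p where "p j = (L j * (1 - 1 / \<theta>)) ^ k / fact k * exp (- L j)" for j
  have "(\<lambda>j. 1 / fact k * (q * (1 - 1 / \<theta>) * \<theta> powr (- of_int j + e)) ^ k * exp (- q * \<theta> powr (- of_int j + e))) = p"
    by (simp add: p_def L_def fun_eq_iff mult_ac)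
  then have ps: "(p has_sum s) UNIV" using s by simp
  define lev where "lev j l = level (\<lambda>_. j) (n l)" for j l
  define mn where "mn j l = mean_above (n l) (lev j l)" for j l
  define A where "A j l = prob {\<omega> \<in> space M. 0 < card (above (n l) (lev j l) \<omega>)}" for j l
  define F where "F j l = prob {\<omega> \<in> space M. card (above (n l) (lev j l) \<omega>) = k \<and> card (above (n l) (Suc (lev j l)) \<omega>) = 0}" for j l
  have nonneg: "\<forall>\<^sub>F l in sequentially. 0 \<le> \<lfloor>log \<theta> (real (n l))\<rfloor> + j" for j
    using eventually_compose_filterlim[OF level_conditions(1)[OF const_level_admissible[of j]] n(2)] .
  have mlim: "mn j \<longlonglongrightarrow> L j" for j
  proof -
    have "(\<lambda>l. q * \<theta> powr (- of_int j + wrt_eps \<mu> (n l))) \<longlonglongrightarrow> L j"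
      unfolding L_def by (intro tendsto_intros eps) (use theta_gt_1 in auto)
    moreover have "\<forall>\<^sub>F l in sequentially. q * \<theta> powr (- of_int j + wrt_eps \<mu> (n l)) = mn j l"
      using nonneg[of j]
    proof eventually_elim
      case (elim l)
      have "0 < n l" using n(1)[of l] by simp
      then show ?case unfolding mn_def lev_def using mean_above_level[where i="\<lambda>_. j" and N="n l"] elim by simp
    qed
    ultimately show ?thesis by (rule Lim_transform_eventually)
  qed
  have mpos: "0 < mn j l" for j l using n(1)[of l] by (simp add: mn_def mean_above_pos)
  have Alim: "A j \<longlonglongrightarrow> 1 - exp (- L j)" for j
  proof -
    have "(\<lambda>l. A j l / mn j l - (1 - exp (- mn j l)) / mn j l) \<longlonglongrightarrow> 0"
      using filterlim_compose[OF level_asymptotics(1)[OF const_level_admissible[of j]] n(2)]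
      unfolding A_def mn_def lev_def .
    then have "(\<lambda>l. mn j l * (A j l / mn j l - (1 - exp (- mn j l)) / mn j l) + (1 - exp (- mn j l))) \<longlonglongrightarrow> L j * 0 + (1 - exp (- L j))"
      by (intro tendsto_intros mlim)
    moreover have "mn j l * (A j l / mn j l - (1 - exp (- mn j l)) / mn j l) + (1 - exp (- mn j l)) = A j l" for l
      using mpos[of j l] by (simp add: field_simps)
    ultimately show ?thesis by simp
  qed
  have Flim: "F j \<longlonglongrightarrow> p j" for j
  proof -
    have "(\<lambda>l. F j l - (mn j l * (1 - 1 / \<theta>)) ^ k / fact k * exp (- mn j l)) \<longlonglongrightarrow> 0"
      using filterlim_compose[OF level_asymptotics(2)[OF const_level_admissible[of j], of k] n(2)]
      unfolding F_def mn_def lev_def .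
    then have "(\<lambda>l. (F j l - (mn j l * (1 - 1 / \<theta>)) ^ k / fact k * exp (- mn j l)) + (mn j l * (1 - 1 / \<theta>)) ^ k / fact k * exp (- mn j l)) \<longlonglongrightarrow> 0 + p j"
      unfolding p_def by (intro tendsto_intros mlim) (assumption | rule fact_nonzero)+
    then show ?thesis by simp
  qed
  have "\<forall>\<^sub>F K in sequentially. \<bar>(\<Sum>j\<in>{- int K..int K}. p j) - s\<bar> < r / 4"
    using tendstoD[OF has_sum_int_interval[OF ps], of "r / 4"] r by (simp add: dist_real_def)
  moreover have "\<forall>\<^sub>F K in sequentially. exp (- L (- int K)) < r / 4"
  proof -
    have "(\<lambda>K. exp (- L (- int K))) \<longlonglongrightarrow> 0" unfolding L_def by (rule intensity_limits[OF theta_gt_1 atom_pos])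
    then show ?thesis using r by (intro order_tendstoD) auto
  qed
  moreover have "\<forall>\<^sub>F K in sequentially. 1 - exp (- L (int K + 1)) < r / 4"
  proof -
    have "(\<lambda>K. exp (- L (int K))) \<longlonglongrightarrow> 1" unfolding L_def by (rule intensity_limits[OF theta_gt_1 atom_pos])
    from tendsto_diff[OF tendsto_const[of 1] LIMSEQ_Suc[OF this]]
    have "(\<lambda>K. 1 - exp (- L (int K + 1))) \<longlonglongrightarrow> 0" by (simp add: add.commute)
    then show ?thesis using r by (intro order_tendstoD) auto
  qed
  ultimately have "\<forall>\<^sub>F K in sequentially. \<bar>(\<Sum>j\<in>{- int K..int K}. p j) - s\<bar> < r / 4 \<and> exp (- L (- int K)) < r / 4 \<and> 1 - exp (- L (int K + 1)) < r / 4"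
    by eventually_elim simp
  from eventually_happens'[OF sequentially_bot this] obtain K where K: "\<bar>(\<Sum>j\<in>{- int K..int K}. p j) - s\<bar> < r / 4"
     "exp (- L (- int K)) < r / 4" "1 - exp (- L (int K + 1)) < r / 4" by blast
  \<comment> \<open>The limit of \<open>err\<close> is the sum of the two boundary terms, which are both below \<open>r / 4\<close>.\<close>
  define err where "err l = \<bar>(\<Sum>j\<in>{- int K..int K}. F j l) - (\<Sum>j\<in>{- int K..int K}. p j)\<bar> + ((1 - A (- int K) l) + A (int K + 1) l)" for l
  have "err \<longlonglongrightarrow> \<bar>(\<Sum>j\<in>{- int K..int K}. p j) - (\<Sum>j\<in>{- int K..int K}. p j)\<bar> + ((1 - (1 - exp (- L (- int K)))) + (1 - exp (- L (int K + 1))))"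
    unfolding err_def[abs_def] by (intro tendsto_intros Flim Alim)
  then have "\<forall>\<^sub>F l in sequentially. err l < r / 2" using K by (intro order_tendstoD) auto
  then have "\<forall>\<^sub>F l in sequentially. norm (prob {\<omega> \<in> space M. card (max_vertices J (n l) \<omega>) = k} - s) < r"
    using nonneg[of "- int K"]
  proof eventually_elim
    case (elim l)
    have "\<bar>prob {\<omega> \<in> space M. card (max_vertices J (n l) \<omega>) = k} - (\<Sum>j\<in>{- int K..int K}. F j l)\<bar> \<le> (1 - A (- int K) l) + A (int K + 1) l"
      using level_window[OF n(1)[of l] k, of K] elim unfolding F_def A_def lev_def by simp
    then show ?case using elim(1) K(1) unfolding err_def real_norm_def by linarith
  qed
  then show "\<exists>no. \<forall>l\<ge>no. norm (prob {\<omega> \<in> space M. card (max_vertices J (n l) \<omega>) = k} - s) < r"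
    by (simp add: eventually_sequentially)
qed

text \<open>
  The distribution functions of laws on the positive integers are finite sums of point masses.
\<close>

lemma maximiser_count_weak_conv:
  assumes n: "\<And>l. 1 \<le> n l" and Q: "set_pmf Q \<subseteq> {1..}"
    and lim: "\<And>k. 1 \<le> k \<Longrightarrow> (\<lambda>l. prob {\<omega> \<in> space M. card (max_vertices J (n l) \<omega>) = k}) \<longlonglongrightarrow> pmf Q k"
  shows "weak_conv_m (\<lambda>l. distr M borel (\<lambda>\<omega>. real (card (max_vertices J (n l) \<omega>)))) (distr (measure_pmf Q) borel real)"
  unfolding weak_conv_m_def weak_conv_def
proof (intro allI impI)
  fix x :: real
  define K where "K = nat \<lfloor>x\<rfloor>"
  have iff: "real c \<le> x \<longleftrightarrow> c \<in> {1..K}" if "1 \<le> c" for c :: nat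
    using that unfolding K_def by (auto simp: le_nat_iff le_floor_iff) linarith+
  have l: "cdf (distr M borel (\<lambda>\<omega>. real (card (max_vertices J (n l) \<omega>)))) x = (\<Sum>k\<in>{1..K}. prob {\<omega> \<in> space M. card (max_vertices J (n l) \<omega>) = k})" for l
  proof -
    note max_vertices_measurable[OF n[of l], measurable]
    have "cdf (distr M borel (\<lambda>\<omega>. real (card (max_vertices J (n l) \<omega>)))) x = prob ((\<lambda>\<omega>. real (card (max_vertices J (n l) \<omega>))) -` {..x} \<inter> space M)"
      unfolding cdf_def by (rule measure_distr) auto
    also have "(\<lambda>\<omega>. real (card (max_vertices J (n l) \<omega>))) -` {..x} \<inter> space M = (\<Union>k\<in>{1..K}. {\<omega> \<in> space M. card (max_vertices J (n l) \<omega>) = k})"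
      using iff card_max_vertices_pos[OF n[of l]] by (auto simp: Suc_le_eq)
    also have "prob \<dots> = (\<Sum>k\<in>{1..K}. prob {\<omega> \<in> space M. card (max_vertices J (n l) \<omega>) = k})"
      by (rule finite_measure_finite_Union) (auto simp: disjoint_family_on_def)
    finally show ?thesis .
  qed
  have q: "cdf (distr (measure_pmf Q) borel real) x = (\<Sum>k\<in>{1..K}. pmf Q k)"
  proof -
    have "cdf (distr (measure_pmf Q) borel real) x = measure (measure_pmf Q) {k. real k \<le> x}"
      unfolding cdf_def by (subst measure_distr) (auto simp: vimage_def)
    also have "\<dots> = measure (measure_pmf Q) {1..K}"
      by (rule measure_pmf.finite_measure_eq_AE) (use Q iff in \<open>auto simp: AE_measure_pmf_iff subset_iff\<close>)
    also have "\<dots> = (\<Sum>k\<in>{1..K}. pmf Q k)" by (rule measure_measure_pmf_finite) simp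
    finally show ?thesis .
  qed
  show "(\<lambda>l. cdf (distr M borel (\<lambda>\<omega>. real (card (max_vertices J (n l) \<omega>)))) x) \<longlonglongrightarrow> cdf (distr (measure_pmf Q) borel real) x"
    unfolding l q by (intro tendsto_sum lim) simp
qed

end

theorem theorem2p8:
  fixes M :: "'a measure" and \<mu> :: "real measure"
    and W :: "nat \<Rightarrow> 'a \<Rightarrow> real" and J :: "nat \<Rightarrow> 'a \<Rightarrow> nat"
    and \<theta> q\<^sub>0 :: real
  assumes wrt: "weighted_recursive_tree M \<mu> W J"
    and theta: "\<theta> = wrt_theta \<mu>"
    and bounded: "AE x in \<mu>. x \<in> {0<..1}"
    and ess_sup: "Sup {x. cdf \<mu> x < 1} = 1"
    and lower_tail: "\<exists>C \<rho> x\<^sub>1. C > 0 \<and> \<rho> > 0 \<and> x\<^sub>1 \<in> {0<..<1} \<and>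
        (\<forall>x\<in>{0..x\<^sub>1}. cdf \<mu> x \<le> C * x powr \<rho>)"
    and atom: "measure \<mu> {1} = q\<^sub>0" "q\<^sub>0 \<in> {0<..1}"
  shows
    "(\<forall>i :: nat \<Rightarrow> int.
        strictly_below_threshold \<mu> i \<longrightarrow>
        liminf (\<lambda>n. ereal (of_int (i n))) > -\<infinity> \<longrightarrow>
        (\<lambda>n. measure M {\<omega> \<in> space M.
            int (max_indegree J n \<omega>) \<ge> \<lfloor>log \<theta> (real n)\<rfloor> + i n})
          \<sim>[sequentially]
        (\<lambda>n. 1 - exp (- q\<^sub>0 * \<theta> powr (- of_int (i n) + wrt_eps \<mu> n))))
     \<and>
     (\<forall>(\<epsilon> :: real) (n :: nat \<Rightarrow> nat).
        \<epsilon> \<in> {0..1} \<longrightarrow>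
        (\<forall>l. n l \<ge> 1) \<longrightarrow>
        filterlim n at_top sequentially \<longrightarrow>
        (\<lambda>l. wrt_eps \<mu> (n l)) \<longlonglongrightarrow> \<epsilon> \<longrightarrow>
        (\<exists>Q :: nat pmf.
           set_pmf Q \<subseteq> {1..} \<and>
           (\<forall>k\<ge>1.
              ((\<lambda>j :: int. 1 / fact k
                  * (q\<^sub>0 * (1 - 1 / \<theta>) * \<theta> powr (- of_int j + \<epsilon>)) ^ k
                  * exp (- q\<^sub>0 * \<theta> powr (- of_int j + \<epsilon>)))
                has_sum pmf Q k) UNIV) \<and>
           weak_conv_m
             (\<lambda>l. distr M borel (\<lambda>\<omega>. real (card (max_vertices J (n l) \<omega>))))
             (distr (measure_pmf Q) borel real)))"
proof -
  interpret bounded_weight_tree M \<mu> W J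
    by (intro bounded_weight_tree.intro wrt bounded_weight_tree_axioms.intro bounded) (use atom in auto)
  show ?thesis
    unfolding theta atom(1)[symmetric]
  proof (intro conjI allI impI)
    fix i :: "nat \<Rightarrow> int"
    assume "strictly_below_threshold \<mu> i" "liminf (\<lambda>n. ereal (of_int (i n))) > -\<infinity>"
    then show "(\<lambda>n. prob {\<omega> \<in> space M. int (max_indegree J n \<omega>) \<ge> \<lfloor>log (wrt_theta \<mu>) (real n)\<rfloor> + i n})
       \<sim>[sequentially] (\<lambda>n. 1 - exp (- measure \<mu> {1} * wrt_theta \<mu> powr (- of_int (i n) + wrt_eps \<mu> n)))"
      by (rule max_indegree_asymp)
  next
    fix \<epsilon> :: real and n :: "nat \<Rightarrow> nat"
    assume n: "\<forall>l. n l \<ge> 1" "filterlim n at_top sequentially" and eps: "(\<lambda>l. wrt_eps \<mu> (n l)) \<longlonglongrightarrow> \<epsilon>"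
    obtain Q :: "nat pmf" where Q: "set_pmf Q \<subseteq> {1..}"
      "\<forall>k\<ge>1. ((\<lambda>j :: int. 1 / fact k * (measure \<mu> {1} * (1 - 1 / wrt_theta \<mu>) * wrt_theta \<mu> powr (- of_int j + \<epsilon>)) ^ k
          * exp (- measure \<mu> {1} * wrt_theta \<mu> powr (- of_int j + \<epsilon>))) has_sum pmf Q k) UNIV"
      using maximiser_law_exists[OF theta_gt_1 atom_pos, of \<epsilon>] by blast
    have "weak_conv_m (\<lambda>l. distr M borel (\<lambda>\<omega>. real (card (max_vertices J (n l) \<omega>)))) (distr (measure_pmf Q) borel real)"
    proof (rule maximiser_count_weak_conv[OF _ Q(1)])
      show "1 \<le> n l" for l using n(1) by blast
      fix k :: nat assume k: "1 \<le> k"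
      show "(\<lambda>l. prob {\<omega> \<in> space M. card (max_vertices J (n l) \<omega>) = k}) \<longlonglongrightarrow> pmf Q k"
        by (rule maximiser_count_limit[OF _ n(2) eps k]) (use n(1) Q(2) k in blast)+
    qed
    then show "\<exists>Q :: nat pmf. set_pmf Q \<subseteq> {1..} \<and>
           (\<forall>k\<ge>1. ((\<lambda>j :: int. 1 / fact k * (measure \<mu> {1} * (1 - 1 / wrt_theta \<mu>) * wrt_theta \<mu> powr (- of_int j + \<epsilon>)) ^ k
                  * exp (- measure \<mu> {1} * wrt_theta \<mu> powr (- of_int j + \<epsilon>))) has_sum pmf Q k) UNIV) \<and>
           weak_conv_m (\<lambda>l. distr M borel (\<lambda>\<omega>. real (card (max_vertices J (n l) \<omega>)))) (distr (measure_pmf Q) borel real)"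
      using Q by blast
  qed
qed

end
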